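(* The Size Constrained Steiner Tree (SCST) problem polynomial-time Turing reduces to the Minimum-degree Constrained Steiner Tree (MCST) problem.
   Context: SCST problem: input $(V,E,T,\zeta)$ where $G=(V,E)$ is a simple undirected graph with non-negative edge weights (weight $\infty$ meaning an absent edge), $T\subseteq V$ a set of terminals, and $\zeta\ge |T|$ an integer; output the minimum weight of a sub-tree of $G$ containing all vertices of $T$ whose number of vertices is at most $\zeta$, or FAIL if none exists. MCST problem: input $(V,E,T,\Delta)$ where $G=(V,E)$ is a simple undirected graph with non-negative edge weights (weight $\infty$ meaning absent), $T\subseteq V$ a set of terminals, and $\Delta>0$ an integer; output the minimum weight of a sub-tree of $G$ containing all vertices of $T$ in which every internal (non-leaf) node has degree at least $\Delta$, or FAIL if none exists. The weight of a sub-tree is the sum of its edge weights. *)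

theory Defs
  imports Complex_Main "HOL-Computational_Algebra.Polynomial"
begin

section \<open>Trees\<close>

text \<open>
  Simple undirected graphs are given by a vertex set and a set of two-element vertex sets.
  The trees of AFP \<open>Graph_Theory\<close> are digraphs without directed cycles and do not fit.
\<close>

definition connected_graph :: "'a set \<Rightarrow> 'a set set \<Rightarrow> bool" where
  "connected_graph V E \<longleftrightarrow> (\<forall>u\<in>V. \<forall>v\<in>V. (u, v) \<in> {(x, y). {x, y} \<in> E}\<^sup>*)"

definition is_cycle :: "'a set set \<Rightarrow> 'a list \<Rightarrow> bool" where
  "is_cycle E c \<longleftrightarrow> length c \<ge> 3 \<and> distinct c \<and>
     (\<forall>i. Suc i < length c \<longrightarrow> {c ! i, c ! Suc i} \<in> E) \<and> {last c, hd c} \<in> E"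

definition is_tree :: "'a set \<Rightarrow> 'a set set \<Rightarrow> bool" where
  "is_tree V E \<longleftrightarrow> finite V \<and> V \<noteq> {} \<and> (\<forall>e\<in>E. e \<subseteq> V \<and> card e = 2) \<and>
     connected_graph V E \<and> (\<nexists>c. is_cycle E c)"

definition degree_in :: "'a set set \<Rightarrow> 'a \<Rightarrow> nat" where
  "degree_in E v = card {e \<in> E. v \<in> e}"


section \<open>The two Steiner tree problems\<close>

text \<open>
  Both problems have instances of the same shape. The vertex set is \<open>{..<num_vertices I}\<close>; the weight
  of an unordered pair is a rational (so that instances are finite objects), and \<open>None\<close> is the
  weight \<open>\<infinity>\<close> of an absent edge. The parameter is \<open>\<zeta>\<close> for SCST and \<open>\<Delta>\<close> for MCST.
\<close>

record steiner_instance =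
  num_vertices :: nat
  weight :: "nat set \<Rightarrow> rat option"
  terminals :: "nat set"
  param :: nat

definition edges :: "steiner_instance \<Rightarrow> nat set set" where
  "edges I = {e. e \<subseteq> {..<num_vertices I} \<and> card e = 2 \<and> weight I e \<noteq> None}"

definition wf_instance :: "steiner_instance \<Rightarrow> bool" where
  "wf_instance I \<longleftrightarrow> terminals I \<subseteq> {..<num_vertices I} \<and> (\<forall>e\<in>edges I. the (weight I e) \<ge> 0)"

definition steiner_subtrees :: "steiner_instance \<Rightarrow> (nat set \<times> nat set set) set" where
  "steiner_subtrees I = {(V', E'). V' \<subseteq> {..<num_vertices I} \<and> E' \<subseteq> edges I \<and> is_tree V' E' \<and>
     terminals I \<subseteq> V'}"

definition tree_weight :: "steiner_instance \<Rightarrow> nat set \<times> nat set set \<Rightarrow> rat" where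
  "tree_weight I S = (\<Sum>e\<in>snd S. the (weight I e))"

text \<open>The value \<open>None\<close> stands for FAIL.\<close>

definition min_weight :: "steiner_instance \<Rightarrow> (nat set \<times> nat set set) set \<Rightarrow> rat option" where
  "min_weight I F = (if F = {} then None else Some (Min (tree_weight I ` F)))"

definition scst_instance :: "steiner_instance \<Rightarrow> bool" where
  "scst_instance I \<longleftrightarrow> wf_instance I \<and> param I \<ge> card (terminals I)"

definition scst :: "steiner_instance \<Rightarrow> rat option" where
  "scst I = min_weight I {(V', E') \<in> steiner_subtrees I. card V' \<le> param I}"

definition mcst_instance :: "steiner_instance \<Rightarrow> bool" where
  "mcst_instance I \<longleftrightarrow> wf_instance I \<and> param I > 0"

text \<open>
  A leaf is a node of degree at most 1, so the node of a one-vertex tree counts as a leaf.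
\<close>

definition mcst :: "steiner_instance \<Rightarrow> rat option" where
  "mcst I = min_weight I {(V', E') \<in> steiner_subtrees I.
     \<forall>v\<in>V'. degree_in E' v > 1 \<longrightarrow> degree_in E' v \<ge> param I}"


section \<open>Binary encodings\<close>

text \<open>
  Lists are encoded with a continuation bit before every element, so that all the encodings are
  self-delimiting. Numbers are in binary, least significant bit first.
\<close>

definition enc_list :: "('a \<Rightarrow> bool list) \<Rightarrow> 'a list \<Rightarrow> bool list" where
  "enc_list f xs = concat (map (\<lambda>x. True # f x) xs) @ [False]"

fun bits :: "nat \<Rightarrow> bool list" where
  "bits n = (if n = 0 then [] else odd n # bits (n div 2))"

declare bits.simps [simp del]

definition enc_nat :: "nat \<Rightarrow> bool list" where
  "enc_nat n = enc_list (\<lambda>b. [b]) (bits n)"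

text \<open>Non-negative rationals in lowest terms; \<open>None\<close> is used for both \<open>\<infinity>\<close> and FAIL.\<close>

definition enc_value :: "rat option \<Rightarrow> bool list" where
  "enc_value w = (case w of None \<Rightarrow> [False]
     | Some q \<Rightarrow> True # enc_nat (nat (fst (quotient_of q))) @ enc_nat (nat (snd (quotient_of q))))"

definition matrix_entry :: "steiner_instance \<Rightarrow> nat \<Rightarrow> nat \<Rightarrow> rat option" where
  "matrix_entry I i j = (if i = j then None else weight I {i, j})"

definition enc_instance :: "steiner_instance \<Rightarrow> bool list" where
  "enc_instance I =
     enc_list (\<lambda>i. [i \<in> terminals I]) [0..<num_vertices I] @
     enc_list (\<lambda>i. enc_list (\<lambda>j. enc_value (matrix_entry I i j)) [0..<num_vertices I]) [0..<num_vertices I] @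
     enc_nat (param I)"

text \<open>
  A computational problem relates each (encoded) instance to its correct (encoded) answers;
  strings outside its domain are not instances.
\<close>

type_synonym problem = "(bool list \<times> bool list) set"

definition SCST :: problem where
  "SCST = {(enc_instance I, enc_value (scst I)) | I. scst_instance I}"

definition MCST :: problem where
  "MCST = {(enc_instance I, enc_value (mcst I)) | I. mcst_instance I}"


text \<open>Both problems are functional: no string encodes instances with different answers.\<close>

lemma enc_list_cancel:
  assumes "enc_list f xs @ r = enc_list g ys @ s"
    and "\<And>x y r s. x \<in> set xs \<Longrightarrow> y \<in> set ys \<Longrightarrow> f x @ r = g y @ s \<Longrightarrow> h x = k y \<and> r = s"
  shows "map h xs = map k ys \<and> r = s"
  using assms
proof (induction xs arbitrary: ys)
  case Nil
  then show ?case by (cases ys) (auto simp: enc_list_def)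
next
  case (Cons x xs)
  from Cons.prems(1) obtain y ys' where ys: "ys = y # ys'"
    by (cases ys) (auto simp: enc_list_def)
  have "f x @ (enc_list f xs @ r) = g y @ (enc_list g ys' @ s)"
    using Cons.prems(1) by (simp add: ys enc_list_def)
  then have *: "h x = k y" "enc_list f xs @ r = enc_list g ys' @ s"
    using Cons.prems(2)[of x y] by (auto simp: ys)
  have "map h xs = map k ys' \<and> r = s"
    by (rule Cons.IH[OF *(2)]) (use Cons.prems(2) ys in auto)
  then show ?case using * ys by simp
qed

lemma bits_inject: "bits m = bits n \<Longrightarrow> m = n"
proof (induction m arbitrary: n rule: bits.induct)
  case (1 m)
  show ?case
  proof (cases "m = 0 \<or> n = 0")
    case True
    then show ?thesis using 1(2) by (auto simp: bits.simps[of m] bits.simps[of n] split: if_splits)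
  next
    case False
    then have "odd m = odd n" "bits (m div 2) = bits (n div 2)"
      using 1(2) by (auto simp: bits.simps[of m] bits.simps[of n])
    moreover from this have "m div 2 = n div 2" using 1(1) False by blast
    ultimately show ?thesis by presburger
  qed
qed

lemma enc_nat_cancel: "enc_nat m @ r = enc_nat n @ s \<Longrightarrow> m = n \<and> r = s"
  using enc_list_cancel[of "\<lambda>b. [b]" "bits m" r "\<lambda>b. [b]" "bits n" s id id]
  by (auto simp: enc_nat_def intro: bits_inject)

lemma enc_value_cancel:
  assumes "enc_value v @ r = enc_value w @ s"
    and "\<forall>q. v = Some q \<longrightarrow> q \<ge> 0" "\<forall>q. w = Some q \<longrightarrow> q \<ge> 0"
  shows "v = w \<and> r = s"
proof (cases "v = None \<or> w = None")
  case True
  then show ?thesis using assms(1) by (auto simp: enc_value_def split: option.splits)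
next
  case False
  then obtain p q where pq: "v = Some p" "w = Some q" by auto
  have nonneg: "fst (quotient_of p) \<ge> 0" "fst (quotient_of q) \<ge> 0"
    "snd (quotient_of p) > 0" "snd (quotient_of q) > 0"
    using assms(2,3) pq quotient_of_denom_pos'[of p] quotient_of_denom_pos'[of q]
    by (auto simp: rat_less_eq_code split: prod.splits)
  have "nat (fst (quotient_of p)) = nat (fst (quotient_of q))"
    "nat (snd (quotient_of p)) = nat (snd (quotient_of q))" "r = s"
    using assms(1) by (auto simp: enc_value_def pq dest!: enc_nat_cancel)
  then have "quotient_of p = quotient_of q" "r = s"
    using nonneg by (auto simp: prod_eq_iff)
  then show ?thesis using pq by (simp add: quotient_of_inject_eq)
qed

lemma matrix_entry_nonneg:
  assumes "wf_instance I" "i < num_vertices I" "j < num_vertices I" "matrix_entry I i j = Some q"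
  shows "q \<ge> 0"
proof -
  have "i \<noteq> j" "weight I {i, j} = Some q"
    using assms(4) by (auto simp: matrix_entry_def split: if_splits)
  then have "{i, j} \<in> edges I" using assms by (auto simp: edges_def)
  then show ?thesis
    using assms(1) \<open>weight I {i, j} = Some q\<close> by (auto simp: wf_instance_def)
qed

lemma enc_instance_inject:
  assumes "enc_instance I = enc_instance J" "wf_instance I" "wf_instance J"
  shows "num_vertices I = num_vertices J" "terminals I = terminals J" "param I = param J"
    "edges I = edges J" "\<And>e. e \<in> edges I \<Longrightarrow> weight I e = weight J e"
proof -
  let ?row = "\<lambda>I i. enc_list (\<lambda>j. enc_value (matrix_entry I i j)) [0..<num_vertices I]"
  have 1: "map (\<lambda>i. i \<in> terminals I) [0..<num_vertices I] =
      map (\<lambda>i. i \<in> terminals J) [0..<num_vertices J] \<and>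
     enc_list (?row I) [0..<num_vertices I] @ enc_nat (param I) =
     enc_list (?row J) [0..<num_vertices J] @ enc_nat (param J)"
    by (rule enc_list_cancel[OF assms(1)[unfolded enc_instance_def]]) auto
  then have "length (map (\<lambda>i. i \<in> terminals I) [0..<num_vertices I]) =
      length (map (\<lambda>i. i \<in> terminals J) [0..<num_vertices J])"
    by metis
  then show n: "num_vertices I = num_vertices J" by simp
  show T: "terminals I = terminals J"
    using 1 assms(2,3) n by (auto simp: wf_instance_def)
  have 2: "map (\<lambda>i. map (matrix_entry I i) [0..<num_vertices I]) [0..<num_vertices I] =
     map (\<lambda>i. map (matrix_entry J i) [0..<num_vertices J]) [0..<num_vertices J] \<and>
     enc_nat (param I) = enc_nat (param J)"
  proof (rule enc_list_cancel[OF conjunct2[OF 1]])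
    fix i i' r s
    assume i: "i \<in> set [0..<num_vertices I]" "i' \<in> set [0..<num_vertices J]"
      and "?row I i @ r = ?row J i' @ s"
    then show "map (matrix_entry I i) [0..<num_vertices I] =
        map (matrix_entry J i') [0..<num_vertices J] \<and> r = s"
      by (elim enc_list_cancel, intro enc_value_cancel)
        (use i assms(2,3) matrix_entry_nonneg in auto)
  qed
  then show "param I = param J" using enc_nat_cancel[of "param I" "[]" "param J" "[]"] by simp
  have w: "weight I e = weight J e" if e: "e \<subseteq> {..<num_vertices I}" "card e = 2" for e
  proof -
    obtain i j where ij: "e = {i, j}" "i \<noteq> j" using e(2) by (auto simp: card_2_iff)
    have "matrix_entry I i j = matrix_entry J i j" using 2 n e(1) ij(1) by auto
    then show ?thesis using ij by (simp add: matrix_entry_def)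
  qed
  then show "edges I = edges J" by (auto simp: edges_def n)
  show "\<And>e. e \<in> edges I \<Longrightarrow> weight I e = weight J e" using w by (auto simp: edges_def)
qed

lemma min_weight_cong:
  assumes "enc_instance I = enc_instance J" "wf_instance I" "wf_instance J"
    and "F \<subseteq> steiner_subtrees I"
  shows "min_weight I F = min_weight J F"
proof -
  have "tree_weight I S = tree_weight J S" if "S \<in> F" for S
    unfolding tree_weight_def
    using that assms(4) enc_instance_inject(5)[OF assms(1-3)]
    by (intro sum.cong) (fastforce simp: steiner_subtrees_def)+
  then have "tree_weight I ` F = tree_weight J ` F" by simp
  then show ?thesis by (simp add: min_weight_def)
qed

lemma steiner_subtrees_cong:
  assumes "enc_instance I = enc_instance J" "wf_instance I" "wf_instance J"
  shows "steiner_subtrees I = steiner_subtrees J"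
  using enc_instance_inject[OF assms] by (simp add: steiner_subtrees_def)

lemma scst_cong:
  assumes "enc_instance I = enc_instance J" "wf_instance I" "wf_instance J"
  shows "scst I = scst J"
  unfolding scst_def
  by (subst min_weight_cong[OF assms])
    (auto simp: steiner_subtrees_cong[OF assms] enc_instance_inject(3)[OF assms])

lemma single_valued_SCST: "single_valued SCST"
proof (rule single_valuedI)
  fix x y z assume "(x, y) \<in> SCST" "(x, z) \<in> SCST"
  then obtain I J where "x = enc_instance I" "y = enc_value (scst I)" "wf_instance I"
    "x = enc_instance J" "z = enc_value (scst J)" "wf_instance J"
    unfolding SCST_def scst_instance_def by blast
  then show "y = z" using scst_cong[of I J] by simp
qed

lemma mcst_cong:
  assumes "enc_instance I = enc_instance J" "wf_instance I" "wf_instance J"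
  shows "mcst I = mcst J"
  unfolding mcst_def
  by (subst min_weight_cong[OF assms])
    (auto simp: steiner_subtrees_cong[OF assms] enc_instance_inject(3)[OF assms])

lemma single_valued_MCST: "single_valued MCST"
proof (rule single_valuedI)
  fix x y z assume "(x, y) \<in> MCST" "(x, z) \<in> MCST"
  then obtain I J where "x = enc_instance I" "y = enc_value (mcst I)" "wf_instance I"
    "x = enc_instance J" "z = enc_value (mcst J)" "wf_instance J"
    unfolding MCST_def mcst_instance_def by blast
  then show "y = z" using mcst_cong[of I J] by simp
qed


section \<open>Oracle Turing machines\<close>

text \<open>
  Deterministic multi-tape machines with two-way infinite read-write tapes: tape 0 holds the
  input, tape 1 is the oracle tape and tape 2 the output tape. The tape symbols are
  \<open>0\<close> (blank), \<open>1\<close> and \<open>2\<close> (the bits 0 and 1), and further ones below \<open>num_symbols\<close>.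
  A tape consists of its contents and the head position.
\<close>

type_synonym tape = "(int \<Rightarrow> nat) \<times> int"

type_synonym config = "nat \<times> tape list"

record oracle_tm =
  num_states :: nat
  num_symbols :: nat
  num_tapes :: nat
  start_state :: nat
  halt_state :: nat
  query_state :: nat
  resume_state :: nat
  delta :: "nat \<Rightarrow> nat list \<Rightarrow> nat \<times> (nat \<times> int) list"

definition wf_tm :: "oracle_tm \<Rightarrow> bool" where
  "wf_tm M \<longleftrightarrow> num_symbols M \<ge> 3 \<and> num_tapes M \<ge> 3 \<and>
     {start_state M, halt_state M, query_state M, resume_state M} \<subseteq> {..<num_states M} \<and>
     halt_state M \<noteq> query_state M \<and>
     (\<forall>q < num_states M. \<forall>ss. length ss = num_tapes M \<and> set ss \<subseteq> {..<num_symbols M} \<longrightarrow>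
        (case delta M q ss of (q', as) \<Rightarrow> q' < num_states M \<and> length as = num_tapes M \<and>
           set as \<subseteq> {..<num_symbols M} \<times> {-1, 0, 1}))"

definition tape_of :: "bool list \<Rightarrow> tape" where
  "tape_of x = ((\<lambda>i. if 0 \<le> i \<and> i < int (length x) then (if x ! nat i then 2 else 1) else 0), 0)"

text \<open>The string on a tape extends from cell 0 up to the first cell not containing a bit.\<close>

definition string_on :: "tape \<Rightarrow> bool list" where
  "string_on t = map (\<lambda>i. fst t (int i) = 2) [0..<(LEAST i. fst t (int i) \<notin> {1, 2})]"

definition act :: "nat \<times> int \<Rightarrow> tape \<Rightarrow> tape" where
  "act a t = ((fst t)(snd t := fst a), snd t + snd a)"

text \<open>
  A query takes one step: the string on the oracle tape is replaced by the answer of the oracle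
  and the head of this tape returns to cell 0.
\<close>

definition step :: "oracle_tm \<Rightarrow> (bool list \<Rightarrow> bool list) \<Rightarrow> config \<Rightarrow> config" where
  "step M f c = (case c of (q, ts) \<Rightarrow>
     if q = halt_state M then (q, ts)
     else if q = query_state M then (resume_state M, ts[1 := tape_of (f (string_on (ts ! 1)))])
     else (case delta M q (map (\<lambda>(t, p). t p) ts) of (q', as) \<Rightarrow> (q', map2 act as ts)))"

definition init_config :: "oracle_tm \<Rightarrow> bool list \<Rightarrow> config" where
  "init_config M x = (start_state M, tape_of x # replicate (num_tapes M - 1) (tape_of []))"

definition computes_within ::
    "oracle_tm \<Rightarrow> (bool list \<Rightarrow> bool list) \<Rightarrow> bool list \<Rightarrow> nat \<Rightarrow> bool list \<Rightarrow> bool" where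
  "computes_within M f x t y \<longleftrightarrow>
     (case (step M f ^^ t) (init_config M x) of (q, ts) \<Rightarrow>
        q = halt_state M \<and> string_on (ts ! 2) = y)"

text \<open>The oracle answers correctly on instances and arbitrarily on all other strings.\<close>

definition solves :: "(bool list \<Rightarrow> bool list) \<Rightarrow> problem \<Rightarrow> bool" where
  "solves f Q \<longleftrightarrow> (\<forall>x\<in>Domain Q. (x, f x) \<in> Q)"

definition poly_time_turing_reducible :: "problem \<Rightarrow> problem \<Rightarrow> bool" where
  "poly_time_turing_reducible P Q \<longleftrightarrow>
     (\<exists>M (p :: nat poly). wf_tm M \<and>
        (\<forall>f. solves f Q \<longrightarrow>
           (\<forall>x\<in>Domain P. \<exists>y. (x, y) \<in> P \<and> computes_within M f x (poly p (length x)) y)))"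

end

(*
Pad the graph with new vertices that can only be leaves: every terminal may use them freely, whereas
the non-terminals share a pool of budget * D of them, where D is the degree bound and the budget is
the number of non-terminals that the size bound still allows. As D exceeds the number of original
vertices, a new vertex is never internal, and an internal non-terminal needs almost D leaves of the
pool; hence at most budget many non-terminals are internal, and the other non-terminals are leaves
that can be pruned together with the new vertices. All new edges have weight 0, so the optimal
weights agree. The length of the input is a suitable D that is available both in unary and, by
counting, in binary.

The machine is written as a while program over the tapes and compiled to a state table.
*)
theory Submission
  imports Defs
begin

section \<open>Pruning and extending trees\<close>

text \<open>The reduction asks a single query. Four points shape it. (1) \<zeta> is given in binary
  and may be exponential in the input length, so the budget is capped by the number of
  non-terminals; this keeps the padded graph polynomial and loses no tree. (2) Up to n of the edges
  at an internal non-terminal lead to original vertices, so such a vertex is only known to occupy D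
  - n leaves of the pool. The pool still cannot serve budget + 1 of them if D exceeds n * (budget +
  1), and the input is that long because its matrix alone takes more than n * (n + 1) symbols. (3)
  With \<zeta> = 0 no tree is admissible, whereas the padded instance may have a one-vertex tree;
  equality of the optima is therefore proved for \<zeta> > 0 only. (4) The answer of the oracle has
  to be copied to the output tape within the time bound, so the length of an optimal weight in
  lowest terms must be bounded by a polynomial in the input length.\<close>

lemma is_treeD:
  assumes "is_tree V E"
  shows "finite V" "V \<noteq> {}" "\<And>e. e \<in> E \<Longrightarrow> e \<subseteq> V" "\<And>e. e \<in> E \<Longrightarrow> card e = 2"
    "connected_graph V E" "\<And>c. \<not> is_cycle E c" "finite E"
  using assms finite_subset[of E "Pow V"] unfolding is_tree_def by auto

lemma degree_le_1_unique:
  assumes "finite E" "degree_in E v \<le> 1" "e \<in> E" "f \<in> E" "v \<in> e" "v \<in> f"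
  shows "e = f"
  using assms card_le_Suc0_iff_eq[of "{e \<in> E. v \<in> e}"] by (auto simp: degree_in_def)

lemma is_cycle_mono: "is_cycle E c \<Longrightarrow> E \<subseteq> F \<Longrightarrow> is_cycle F c"
  unfolding is_cycle_def by blast

text \<open>It is used in the contrapositive: a vertex with a single neighbour lies on no
  cycle.\<close>

lemma is_cycle_neighbours:
  assumes "is_cycle E c" "v \<in> set c"
  shows "\<exists>a b. a \<noteq> b \<and> a \<noteq> v \<and> b \<noteq> v \<and> {v, a} \<in> E \<and> {v, b} \<in> E"
proof -
  let ?n = "length c"
  have c: "?n \<ge> 3" "distinct c" "\<And>i. Suc i < ?n \<Longrightarrow> {c ! i, c ! Suc i} \<in> E" "{last c, hd c} \<in> E"
    using assms(1) by (auto simp: is_cycle_def)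
  then have ne: "c \<noteq> []" by auto
  obtain i where i: "i < ?n" "v = c ! i" using assms(2) by (metis in_set_conv_nth)
  \<comment> \<open>The cyclic successor and predecessor of \<open>v\<close>; they differ because a
    cycle has at least three vertices.\<close>
  define j where "j = (if Suc i < ?n then Suc i else 0)"
  define k where "k = (if i > 0 then i - 1 else ?n - 1)"
  have jk: "j < ?n" "k < ?n" "j \<noteq> k" "j \<noteq> i" "k \<noteq> i" using i c(1) by (auto simp: j_def k_def)
  have "{v, c ! j} \<in> E"
  proof (cases "Suc i < ?n")
    case False
    then have "i = ?n - 1" using i by simp
    then show ?thesis using c(4) ne i False by (simp add: j_def last_conv_nth hd_conv_nth)
  qed (use c(3) i in \<open>simp add: j_def\<close>)
  moreover have "{v, c ! k} \<in> E"
  proof (cases "i > 0")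
    case True
    then show ?thesis using c(3)[of "i - 1"] i by (simp add: k_def insert_commute)
  next
    case False
    then show ?thesis using c(4) ne i by (simp add: k_def last_conv_nth hd_conv_nth insert_commute)
  qed
  ultimately show ?thesis
    using jk i c(2) by (intro exI[of _ "c ! j"] exI[of _ "c ! k"]) (auto simp: nth_eq_iff_index_eq)
qed

text \<open>\<open>R\<close> will consist of the non-terminals of degree at most 1, which include
  all new vertices of the tree. They are removed at once: the induction follows an arbitrary walk
  and, while it stands on a removed vertex, remembers a kept neighbour that is already
  reached.\<close>

lemma prune_tree:
  assumes tree: "is_tree V E" and deg: "\<And>v. v \<in> R \<Longrightarrow> degree_in E v \<le> 1" and ne: "V - R \<noteq> {}"
  shows "is_tree (V - R) {e \<in> E. e \<inter> R = {}}"
proof -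
  let ?E = "{e \<in> E. e \<inter> R = {}}"
  let ?r = "{(x, y). {x, y} \<in> E}" and ?s = "{(x, y). {x, y} \<in> ?E}"
  note T = is_treeD[OF tree]
  have "connected_graph (V - R) ?E"
    unfolding connected_graph_def
  proof (intro ballI)
    fix u v assume u: "u \<in> V - R" and v: "v \<in> V - R"
    have "(u, v) \<in> ?r\<^sup>*" using T(5) u v by (auto simp: connected_graph_def)
    \<comment> \<open>A removed vertex on the way is a dead end: its only neighbour is the one it was entered from.\<close>
    then have "(v \<notin> R \<longrightarrow> (u, v) \<in> ?s\<^sup>*) \<and>
        (v \<in> R \<longrightarrow> (\<exists>w. w \<notin> R \<and> {v, w} \<in> E \<and> (u, w) \<in> ?s\<^sup>*))"
    proof (induction rule: rtrancl_induct)
      case base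
      then show ?case using u by auto
    next
      case (step y z)
      then have yz: "{y, z} \<in> E" by simp
      then have "y \<noteq> z" using T(4) by fastforce
      show ?case
      proof (cases "y \<in> R")
        case False
        with step have y: "(u, y) \<in> ?s\<^sup>*" by blast
        show ?thesis
        proof (cases "z \<in> R")
          case True
          then show ?thesis using False y yz by (auto simp: insert_commute intro!: exI[of _ y])
        next
          case z: False
          then have "(y, z) \<in> ?s" using yz False by auto
          then show ?thesis using z y by (meson rtrancl.rtrancl_into_rtrancl)
        qed
      next
        case True
        with step obtain w where w: "w \<notin> R" "{y, w} \<in> E" "(u, w) \<in> ?s\<^sup>*" by blast
        have "{y, w} = {y, z}"
          by (rule degree_le_1_unique[OF T(7) deg[OF True]]) (use w yz in auto)
        then have "z = w" using \<open>y \<noteq> z\<close> by (auto simp: doubleton_eq_iff)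
        then show ?thesis using w by auto
      qed
    qed
    then show "(u, v) \<in> ?s\<^sup>*" using v by blast
  qed
  moreover have "\<not> is_cycle ?E c" for c using T(6) is_cycle_mono[of ?E c E] by blast
  ultimately show ?thesis using T ne unfolding is_tree_def by auto
qed

text \<open>\<open>h p\<close> is a fresh leaf hung on the old vertex \<open>g p\<close>. The second
  claim, that a fresh vertex lies on one edge only, excludes it from cycles here and bounds its
  degree later.\<close>

lemma attach_leaves:
  assumes tree: "is_tree V E" and P: "finite P" and h: "inj_on h P" "h ` P \<inter> V = {}"
    and g: "g ` P \<subseteq> V"
  shows "is_tree (V \<union> h ` P) (E \<union> (\<lambda>p. {g p, h p}) ` P)" (is "is_tree ?V ?E")
    and "\<And>p e. p \<in> P \<Longrightarrow> e \<in> E \<union> (\<lambda>p. {g p, h p}) ` P \<Longrightarrow> h p \<in> e \<Longrightarrow> e = {g p, h p}"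
proof -
  note T = is_treeD[OF tree]
  show leaf: "e = {g p, h p}" if A: "p \<in> P" "e \<in> ?E" "h p \<in> e" for p e
  proof -
    have "h p \<notin> V" using A(1) h(2) by auto
    then have "e \<notin> E" using T(3)[of e] A(3) by blast
    then obtain q where q: "q \<in> P" "e = {g q, h q}" using A(2) by blast
    have "h p \<noteq> g q" using \<open>h p \<notin> V\<close> g q(1) by blast
    then have "q = p" using A q \<open>h p \<noteq> g q\<close> h(1) by (auto dest: inj_onD)
    then show ?thesis using q by simp
  qed
  have gh: "g p \<noteq> h p" if "p \<in> P" for p using that h(2) g by auto
  let ?r = "{(x, y). {x, y} \<in> ?E}"
  have sym: "sym ?r" by (auto simp: sym_def insert_commute)
  have 1: "\<exists>w\<in>V. (u, w) \<in> ?r\<^sup>*" if "u \<in> ?V" for u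
  proof (cases "u \<in> V")
    case False
    then obtain p where "p \<in> P" "u = h p" using \<open>u \<in> ?V\<close> by auto
    then have "(u, g p) \<in> ?r" "g p \<in> V" using g by (auto simp: insert_commute)
    then show ?thesis by blast
  qed blast
  have "connected_graph ?V ?E"
    unfolding connected_graph_def
  proof (intro ballI)
    fix u v assume u: "u \<in> ?V" and v: "v \<in> ?V"
    obtain u' where u': "u' \<in> V" "(u, u') \<in> ?r\<^sup>*" using 1[OF u] by blast
    obtain v' where v': "v' \<in> V" "(v, v') \<in> ?r\<^sup>*" using 1[OF v] by blast
    have "(u', v') \<in> {(x, y). {x, y} \<in> E}\<^sup>*"
      using T(5) u'(1) v'(1) unfolding connected_graph_def by blast
    moreover have "{(x, y). {x, y} \<in> E} \<subseteq> ?r" by auto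
    ultimately have "(u', v') \<in> ?r\<^sup>*" by (meson in_mono rtrancl_mono)
    moreover have "(v', v) \<in> ?r\<^sup>*" using v'(2) sym by (meson symD sym_rtrancl)
    ultimately show "(u, v) \<in> ?r\<^sup>*" using u'(2) by (meson rtrancl_trans)
  qed
  moreover have "\<not> is_cycle ?E c" for c
  proof
    assume c: "is_cycle ?E c"
    have *: "set c \<inter> h ` P = {}"
    proof (rule ccontr)
      assume "set c \<inter> h ` P \<noteq> {}"
      then obtain p where p: "p \<in> P" "h p \<in> set c" by auto
      obtain a b where ab: "a \<noteq> b" "{h p, a} \<in> ?E" "{h p, b} \<in> ?E" "a \<noteq> h p" "b \<noteq> h p"
        using is_cycle_neighbours[OF c p(2)] by blast
      have "{h p, a} = {g p, h p}" "{h p, b} = {g p, h p}" using leaf[OF p(1)] ab by blast+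
      then show False using ab by (auto simp: doubleton_eq_iff)
    qed
    \<comment> \<open>A cycle that avoids the fresh vertices consists of old edges.\<close>
    have E: "e \<in> E" if "e \<in> ?E" "e \<subseteq> set c" for e using that * by auto
    have "c \<noteq> []" using c by (auto simp: is_cycle_def)
    have "is_cycle E c"
      unfolding is_cycle_def
    proof (intro conjI allI impI)
      show "3 \<le> length c" "distinct c" using c by (auto simp: is_cycle_def)
      show "{last c, hd c} \<in> E" by (rule E) (use c \<open>c \<noteq> []\<close> in \<open>auto simp: is_cycle_def\<close>)
      show "{c ! i, c ! Suc i} \<in> E" if "Suc i < length c" for i
        by (rule E) (use c that in \<open>auto simp: is_cycle_def\<close>)
    qed
    then show False using T(6) by blast
  qed
  moreover have "e \<subseteq> ?V \<and> card e = 2" if "e \<in> ?E" for e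
    using that T(3)[of e] T(4)[of e] g gh by auto
  ultimately show "is_tree ?V ?E" using T(1,2) P unfolding is_tree_def by auto
qed

lemma is_tree_singleton: "is_tree {v} {}"
proof -
  have "\<not> is_cycle {} c" for c :: "'a list" by (auto simp: is_cycle_def)
  then show ?thesis by (auto simp: is_tree_def connected_graph_def)
qed

lemma finite_steiner_subtrees: "finite (steiner_subtrees I)"
proof (rule finite_subset)
  show "steiner_subtrees I \<subseteq> Pow {..<num_vertices I} \<times> Pow (Pow {..<num_vertices I})"
    by (auto simp: steiner_subtrees_def edges_def)
qed simp

text \<open>Matching trees need only be no heavier, so neither direction has to preserve weights or
  invert the other. The same two hypotheses make both families empty together, hence FAIL
  corresponds to FAIL.\<close>

lemma min_weight_eqI:
  assumes "F \<subseteq> steiner_subtrees I" "G \<subseteq> steiner_subtrees J"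
    and FG: "\<And>S. S \<in> F \<Longrightarrow> \<exists>S'\<in>G. tree_weight J S' \<le> tree_weight I S"
    and GF: "\<And>S. S \<in> G \<Longrightarrow> \<exists>S'\<in>F. tree_weight I S' \<le> tree_weight J S"
  shows "min_weight I F = min_weight J G"
proof (cases "F = {}")
  case True
  then have "G = {}" using GF by blast
  then show ?thesis using True by (simp add: min_weight_def)
next
  case False
  then have "G \<noteq> {}" using FG by blast
  have fin: "finite F" "finite G"
    using assms(1,2) finite_steiner_subtrees finite_subset by blast+
  have Min_mono: "Min (w' ` F') \<le> Min (w ` G')"
    if A: "finite F'" "finite G'" "G' \<noteq> {}" "\<And>S. S \<in> G' \<Longrightarrow> \<exists>S'\<in>F'. w' S' \<le> w S"
    for F' G' :: "(nat set \<times> nat set set) set" and w w' :: "_ \<Rightarrow> rat"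
  proof -
    have "Min (w ` G') \<in> w ` G'" by (rule Min_in) (use A(2,3) in auto)
    then obtain S where S: "S \<in> G'" "Min (w ` G') = w S" by blast
    obtain S' where "S' \<in> F'" "w' S' \<le> w S" using A(4)[OF S(1)] by blast
    then show ?thesis using S(2) A(1) by (metis Min_le finite_imageI imageI order_trans)
  qed
  have "Min (tree_weight I ` F) = Min (tree_weight J ` G)"
    by (rule antisym) (rule Min_mono; use fin False \<open>G \<noteq> {}\<close> FG GF in blast)+
  then show ?thesis using False \<open>G \<noteq> {}\<close> by (simp add: min_weight_def)
qed

section \<open>The reduction\<close>

text \<open>
  Vertex kinds of the constructed instance: 1 for an original non-terminal, 2 for a terminal, and
  \<open>a + 2\<close> for a new vertex that can only be a leaf at an original vertex of kind \<open>a\<close>.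
\<close>

definition budget :: "steiner_instance \<Rightarrow> nat" where
  "budget I = min (num_vertices I - card (terminals I)) (param I - card (terminals I))"

definition base_kinds :: "steiner_instance \<Rightarrow> nat list" where
  "base_kinds I = map (\<lambda>i. if i \<in> terminals I then 2 else 1) [0..<num_vertices I]"

text \<open>Beyond the original pairs, adjacency depends on the kinds alone. The machine keeps
  exactly this list on a tape and decides a matrix entry from two symbols of it.\<close>

definition kinds :: "steiner_instance \<Rightarrow> nat \<Rightarrow> nat list" where
  "kinds I D = base_kinds I @ replicate (card (terminals I) * D) 4 @ replicate (budget I * D) 3"

definition linked :: "nat \<Rightarrow> nat \<Rightarrow> bool" where
  "linked a b \<longleftrightarrow> b = a + 2 \<or> a = b + 2"

definition reduced :: "steiner_instance \<Rightarrow> nat \<Rightarrow> steiner_instance" where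
  "reduced I D = \<lparr>num_vertices = length (kinds I D),
     weight = (\<lambda>e. if e \<subseteq> {..<num_vertices I} then weight I e
       else if \<exists>i j. e = {i, j} \<and> i < length (kinds I D) \<and> j < length (kinds I D) \<and>
         linked (kinds I D ! i) (kinds I D ! j) then Some 0 else None),
     terminals = terminals I, param = D\<rparr>"

text \<open>Origin of \<open>large\<close>: k internal non-terminals occupy at least k * (D - n)
  leaves of a pool of size budget * D. For k = budget + 1 the demand exceeds the supply exactly if n
  * (budget + 1) < D.\<close>

locale reduction =
  fixes I :: steiner_instance and D :: nat
  assumes scst: "scst_instance I" and large: "num_vertices I * Suc (budget I) < D"
begin

abbreviation "n \<equiv> num_vertices I"
abbreviation "N \<equiv> length (kinds I D)"
abbreviation "J \<equiv> reduced I D"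
abbreviation "T \<equiv> terminals I"
abbreviation "kind i \<equiv> kinds I D ! i"

lemma T_subset: "T \<subseteq> {..<n}" and nonneg: "e \<in> edges I \<Longrightarrow> the (weight I e) \<ge> 0"
  using scst by (auto simp: scst_instance_def wf_instance_def)

lemma finite_T: "finite T"
  using T_subset finite_subset by blast

lemma card_T: "card T \<le> n" "card T \<le> param I"
  using card_mono[OF _ T_subset] scst by (auto simp: scst_instance_def)

lemma n_le_N: "n \<le> N"
  by (simp add: kinds_def base_kinds_def)

lemma kind_simps:
  "i < n \<Longrightarrow> kind i = (if i \<in> T then 2 else 1)"
  "n \<le> i \<Longrightarrow> i < N \<Longrightarrow> kind i = 3 \<or> kind i = 4"
  by (auto simp: kinds_def base_kinds_def nth_append)

text \<open>Original vertices have the kinds 1 and 2, new ones 3 and 4, and a link changes the kind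
  by two, so it always crosses between the two groups.\<close>

lemma linked_cases:
  assumes "i < N" "j < N" "linked (kind i) (kind j)"
  shows "i < n \<and> j \<ge> n \<or> j < n \<and> i \<ge> n"
  using assms kind_simps(1)[of i] kind_simps(1)[of j] kind_simps(2)[of i] kind_simps(2)[of j]
  by (cases "i < n"; cases "j < n") (auto simp: linked_def split: if_splits)

lemma card_kind: "card {i. i < N \<and> kind i = 4} = card T * D" "card {i. i < N \<and> kind i = 3} = budget I * D"
proof -
  have f: "filter (\<lambda>k. k = a) (base_kinds I) = []" if "a > 2" for a
    using that by (auto simp: base_kinds_def filter_empty_conv)
  show "card {i. i < N \<and> kind i = 4} = card T * D" "card {i. i < N \<and> kind i = 3} = budget I * D"
    using length_filter_conv_card[of "\<lambda>k. k = 4" "kinds I D"]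
      length_filter_conv_card[of "\<lambda>k. k = 3" "kinds I D"]
    by (simp_all add: kinds_def f)
qed

lemma weight_old: "e \<subseteq> {..<n} \<Longrightarrow> weight J e = weight I e"
  by (simp add: reduced_def)

lemma weight_new:
  assumes "i < N" "j < N" "linked (kind i) (kind j)"
  shows "weight J {i, j} = Some 0"
  using assms linked_cases[OF assms] by (auto simp: reduced_def)

text \<open>New vertices are adjacent to original vertices only. This limits their degree to n,
  which is below D.\<close>

lemma new_edge:
  assumes "e \<in> edges J" "x \<in> e" "x \<ge> n"
  obtains v where "e = {v, x}" "v < n" "linked (kind v) (kind x)" "x < N"
proof -
  have e: "weight J e \<noteq> None" "\<not> e \<subseteq> {..<n}" using assms by (auto simp: edges_def)
  then obtain i j where ij: "e = {i, j}" "i < N" "j < N" "linked (kind i) (kind j)"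
    by (auto simp: reduced_def split: if_splits)
  show thesis
  proof (cases "x = i")
    case True
    show thesis by (rule that[of j])
      (use True ij assms(3) linked_cases[OF ij(2-4)] in \<open>auto simp: linked_def\<close>)
  next
    case False
    then have "x = j" using assms(2) ij(1) by auto
    then show thesis by (intro that[of i]) (use ij assms(3) linked_cases[OF ij(2-4)] in auto)
  qed
qed

lemma edges_J_nonneg: "e \<in> edges J \<Longrightarrow> the (weight J e) \<ge> 0"
  using nonneg by (auto simp: edges_def reduced_def split: if_splits)

lemma edges_old: "edges I \<subseteq> edges J" "e \<in> edges J \<Longrightarrow> e \<subseteq> {..<n} \<Longrightarrow> e \<in> edges I"
proof -
  have "num_vertices J = N" by (simp add: reduced_def)
  then show "edges I \<subseteq> edges J" using n_le_N by (fastforce simp: edges_def weight_old)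
  show "e \<in> edges J \<Longrightarrow> e \<subseteq> {..<n} \<Longrightarrow> e \<in> edges I"
    by (auto simp: edges_def weight_old)
qed

lemma J_simps [simp]: "num_vertices J = N" "terminals J = T" "param J = D"
  by (simp_all add: reduced_def)

lemma mcst_instance_J: "mcst_instance J"
  using T_subset n_le_N edges_J_nonneg large
  by (fastforce simp: mcst_instance_def wf_instance_def)

section \<open>Trees within the size bound versus trees with the degree bound\<close>

definition "small_trees = {(V', E') \<in> steiner_subtrees I. card V' \<le> param I}"
definition "branchy_trees = {(V', E') \<in> steiner_subtrees J.
     \<forall>v\<in>V'. degree_in E' v > 1 \<longrightarrow> degree_in E' v \<ge> param J}"

text \<open>Every vertex of the tree, even a leaf, is given D new leaves; its degree is then at
  least D whatever it was before. Terminals draw on the vertices of kind 4 and non-terminals on the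
  pool of kind 3, which suffices because the tree has at most \<open>budget I\<close>
  non-terminals.\<close>

lemma branchy_of_small:
  assumes "S \<in> small_trees"
  shows "\<exists>S'\<in>branchy_trees. tree_weight J S' \<le> tree_weight I S"
proof -
  obtain V E where S: "S = (V, E)" and V: "V \<subseteq> {..<n}" "T \<subseteq> V" "card V \<le> param I"
    and E: "E \<subseteq> edges I" "is_tree V E"
    using assms by (auto simp: small_trees_def steiner_subtrees_def)
  note tr = is_treeD[OF E(2)]
  have fin: "finite {i. i < N \<and> kind i = a}" for a by simp
  obtain h4 where h4: "h4 ` (T \<times> {..<D}) \<subseteq> {i. i < N \<and> kind i = 4}" "inj_on h4 (T \<times> {..<D})"
    using inj_on_iff_card_le[OF _ fin, of "T \<times> {..<D}" 4] card_kind finite_T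
    by (auto simp: card_cartesian_product)
  have "card (V - T) = card V - card T" using V(2) finite_T by (simp add: card_Diff_subset)
  moreover have "card V \<le> n" using card_mono[OF _ V(1)] by simp
  \<comment> \<open>The vertex range accounts for the first argument of the minimum in
    \<open>budget\<close>, the size bound for the second.\<close>
  ultimately have "card (V - T) \<le> budget I" using V(3) by (simp add: budget_def diff_le_mono)
  then obtain h3 where h3: "h3 ` ((V - T) \<times> {..<D}) \<subseteq> {i. i < N \<and> kind i = 3}"
      "inj_on h3 ((V - T) \<times> {..<D})"
    using inj_on_iff_card_le[OF _ fin, of "(V - T) \<times> {..<D}" 3] card_kind tr(1)
    by (auto simp: card_cartesian_product)
  define P where "P = V \<times> {..<D}"
  define h where "h = (\<lambda>p. if fst p \<in> T then h4 p else h3 p)"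
  have h_kind: "h p < N \<and> kind (h p) = kind (fst p) + 2" if "p \<in> P" for p
    using that h3(1) h4(1) kind_simps(1)[of "fst p"] V(1) by (fastforce simp: P_def h_def)
  have inj: "inj_on h P"
  proof (rule inj_onI)
    fix p q assume pq: "p \<in> P" "q \<in> P" "h p = h q"
    \<comment> \<open>The kind of a leaf determines that of its host, so the images of
      \<open>h3\<close> and \<open>h4\<close> do not meet.\<close>
    then have "kind (fst p) = kind (fst q)" using h_kind by (metis add_right_cancel)
    moreover have "fst p < n" "fst q < n" using pq(1,2) V(1) by (auto simp: P_def)
    ultimately have "fst p \<in> T \<longleftrightarrow> fst q \<in> T"
      by (simp add: kind_simps(1) split: if_splits)
    then show "p = q"
      using pq inj_onD[OF h4(2), of p q] inj_onD[OF h3(2), of p q]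
      by (cases "fst p \<in> T") (auto simp: P_def h_def)
  qed
  have h_new: "h p \<ge> n" if "p \<in> P" for p
    using h_kind[OF that] kind_simps(1)[of "h p"] kind_simps(1)[of "fst p"] that V(1)
    by (cases "h p < n") (auto simp: P_def split: if_splits)
  let ?L = "(\<lambda>p. {fst p, h p}) ` P"
  let ?V = "V \<union> h ` P" and ?E = "E \<union> ?L"
  have P: "finite P" "h ` P \<inter> V = {}" "fst ` P \<subseteq> V"
    using tr(1) V(1) h_new by (fastforce simp: P_def)+
  note att = attach_leaves[OF E(2) P(1) inj P(2,3)]
  have leaf_weight: "weight J {fst p, h p} = Some 0" if "p \<in> P" for p
    using weight_new[of "fst p" "h p"] h_kind[OF that] that V(1) n_le_N
    by (auto simp: P_def linked_def)
  have "?L \<subseteq> edges J"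
  proof
    fix e assume "e \<in> ?L"
    then obtain p where p: "p \<in> P" "e = {fst p, h p}" by blast
    have "fst p < n" using p(1) V(1) by (auto simp: P_def)
    then show "e \<in> edges J"
      using p h_kind[of p] h_new[of p] leaf_weight[of p] n_le_N by (auto simp: edges_def)
  qed
  then have "?E \<subseteq> edges J" using E(1) edges_old(1) by simp
  moreover have "h ` P \<subseteq> {..<N}" using h_kind by auto
  moreover have "V \<subseteq> {..<N}" using V(1) n_le_N by fastforce
  ultimately have sub: "(?V, ?E) \<in> steiner_subtrees J"
    using att(1) V(2) by (simp add: steiner_subtrees_def le_supI1)
  have finE: "finite ?E" using tr(7) P(1) by simp
  have "degree_in ?E v \<ge> D" if "v \<in> V" for v
  proof -
    have "inj_on (\<lambda>i. {v, h (v, i)}) {..<D}"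
      using that inj P(2) by (fastforce simp: inj_on_def P_def doubleton_eq_iff)
    then have "card ((\<lambda>i. {v, h (v, i)}) ` {..<D}) = D" by (simp add: card_image)
    moreover have "{v, h (v, i)} \<in> ?L" if "i < D" for i
      using \<open>v \<in> V\<close> that by (intro image_eqI[of _ _ "(v, i)"]) (auto simp: P_def)
    then have "(\<lambda>i. {v, h (v, i)}) ` {..<D} \<subseteq> {e \<in> ?E. v \<in> e}" by blast
    from card_mono[OF _ this] finE
    have "card ((\<lambda>i. {v, h (v, i)}) ` {..<D}) \<le> degree_in ?E v"
      by (simp add: degree_in_def)
    ultimately show ?thesis by simp
  qed
  moreover have "degree_in ?E (h p) \<le> 1" if "p \<in> P" for p
  proof -
    have "{e \<in> ?E. h p \<in> e} \<subseteq> {{fst p, h p}}" using att(2)[OF that] by blast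
    from card_mono[OF _ this] show ?thesis by (simp add: degree_in_def)
  qed
  ultimately have m: "(?V, ?E) \<in> branchy_trees" using sub by (fastforce simp: branchy_trees_def)
  have w: "tree_weight J (?V, ?E) = tree_weight I S"
  proof -
    have "E \<inter> ?L = {}" using tr(3) P(2) by fastforce
    then have "tree_weight J (?V, ?E) = (\<Sum>e\<in>E. the (weight J e)) + (\<Sum>e\<in>?L. the (weight J e))"
      using tr(7) P(1) by (simp add: tree_weight_def sum.union_disjoint)
    also have "(\<Sum>e\<in>?L. the (weight J e)) = 0" by (rule sum.neutral) (use leaf_weight in auto)
    also have "(\<Sum>e\<in>E. the (weight J e)) = (\<Sum>e\<in>E. the (weight I e))"
    proof (rule sum.cong[OF refl])
      fix e assume "e \<in> E"
      then have "e \<subseteq> {..<n}" using tr(3) V(1) by blast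
      then show "the (weight J e) = the (weight I e)" by (simp add: weight_old)
    qed
    finally show ?thesis by (simp add: S tree_weight_def)
  qed
  define S' where "S' = (?V, ?E)"
  have "S' \<in> branchy_trees" "tree_weight J S' = tree_weight I S"
    unfolding S'_def by (fact m, fact w)
  then show ?thesis by (intro bexI[of _ S']) simp_all
qed

text \<open>Pruning and counting the leaves of the pool. If there are no terminals, pruning might
  leave no vertex at all; a single original vertex of weight 0 is taken instead, and this is where
  \<zeta> > 0 enters.\<close>

lemma small_of_branchy:
  assumes "S \<in> branchy_trees" and pos: "param I > 0"
  shows "\<exists>S'\<in>small_trees. tree_weight I S' \<le> tree_weight J S"
proof -
  obtain V E where S: "S = (V, E)" and V: "V \<subseteq> {..<N}" "T \<subseteq> V"
    and deg: "\<And>v. v \<in> V \<Longrightarrow> degree_in E v > 1 \<Longrightarrow> degree_in E v \<ge> D"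
    and E: "E \<subseteq> edges J" "is_tree V E"
    using assms(1) by (auto simp: branchy_trees_def steiner_subtrees_def)
  note tr = is_treeD[OF E(2)]
  have nonnegE: "the (weight J e) \<ge> 0" if "e \<in> E" for e using that E(1) edges_J_nonneg by blast
  show ?thesis
  proof (cases "T = {}")
    case True
    have "N \<noteq> 0" using V(1) tr(2) by auto
    \<comment> \<open>Without original vertices the budget is 0 as well, so the padded graph would
      be empty.\<close>
    then have "n \<noteq> 0" using True by (auto simp: kinds_def base_kinds_def budget_def)
    then have "({0}, {}) \<in> small_trees"
      using True pos by (auto simp: small_trees_def steiner_subtrees_def is_tree_singleton)
    moreover have "tree_weight I ({0}, {}) \<le> tree_weight J S"
      using sum_nonneg[of E "\<lambda>e. the (weight J e)"] nonnegE by (simp add: tree_weight_def S)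
    ultimately show ?thesis by blast
  next
    case False
    have leaf: "degree_in E x \<le> 1" if "x \<in> V" "x \<ge> n" for x
    proof -
      have "{e \<in> E. x \<in> e} \<subseteq> (\<lambda>v. {v, x}) ` {..<n}"
      proof
        fix e assume e: "e \<in> {e \<in> E. x \<in> e}"
        then obtain v where "e = {v, x}" "v < n" using new_edge[of e x] E(1) \<open>x \<ge> n\<close> by auto
        then show "e \<in> (\<lambda>v. {v, x}) ` {..<n}" by blast
      qed
      from card_mono[OF _ this] have "degree_in E x \<le> card ((\<lambda>v. {v, x}) ` {..<n})"
        by (simp add: degree_in_def)
      also have "\<dots> \<le> n" using card_image_le[of "{..<n}" "\<lambda>v. {v, x}"] by simp
      also have "n < D" using large by simp
      finally show ?thesis using deg[OF that(1)] by linarith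
    qed
    \<comment> \<open>Terminals stay even if they are leaves. Any other vertex that stays is an
      original non-terminal of degree above 1, and hence at least D, in \<open>E\<close>.\<close>
    define R where "R = {v \<in> V. degree_in E v \<le> 1 \<and> v \<notin> T}"
    let ?V = "V - R" and ?E = "{e \<in> E. e \<inter> R = {}}"
    have TV: "T \<subseteq> ?V" using V(2) by (auto simp: R_def)
    have Vn: "?V \<subseteq> {..<n}"
      using leaf T_subset by (fastforce simp: R_def not_less)
    have tree: "is_tree ?V ?E"
      by (rule prune_tree[OF E(2)]) (use TV False in \<open>auto simp: R_def\<close>)
    have Eo: "?E \<subseteq> edges I"
    proof
      fix e assume e: "e \<in> ?E"
      then have "e \<subseteq> {..<n}" using is_treeD(3)[OF tree e] Vn by blast
      then show "e \<in> edges I" using edges_old(2) E(1) e by blast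
    qed
    let ?U = "?V - T"
    define A where "A = (\<lambda>v. {x. x < N \<and> kind x = 3 \<and> {v, x} \<in> E})"
    \<comment> \<open>New neighbours of a vertex of kind 1 all have kind 3, so at most n of its
      edges bypass the pool. The additive form avoids a truncated difference.\<close>
    have A: "D \<le> card (A v) + n" if v: "v \<in> ?U" for v
    proof -
      have vn: "v < n" and "v \<notin> T" using v Vn by auto
      then have k: "kind v = 1" by (simp add: kind_simps)
      have "{e \<in> E. v \<in> e} \<subseteq> (\<lambda>x. {v, x}) ` (A v \<union> {..<n})"
      proof
        fix e assume e: "e \<in> {e \<in> E. v \<in> e}"
        then have "card e = 2" using tr(4) by auto
        then obtain x where x: "e = {v, x}" using e by (auto simp: card_2_iff insert_commute)
        show "e \<in> (\<lambda>x. {v, x}) ` (A v \<union> {..<n})"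
        proof (cases "x < n")
          case False
          then obtain u where u: "e = {u, x}" "u < n" "linked (kind u) (kind x)" "x < N"
            using new_edge[of e x] e E(1) x by auto
          have "u = v" using u x vn False by (auto simp: doubleton_eq_iff)
          then have "kind x = 3" using u k kind_simps(2)[of x] False by (auto simp: linked_def)
          then show ?thesis using x u(4) e by (auto simp: A_def)
        qed (use x in auto)
      qed
      then have "degree_in E v \<le> card ((\<lambda>x. {v, x}) ` (A v \<union> {..<n}))"
        unfolding degree_in_def by (intro card_mono) (auto simp: A_def)
      also have "\<dots> \<le> card (A v \<union> {..<n})" by (rule card_image_le) (simp add: A_def)
      also have "\<dots> \<le> card (A v) + n" using card_Un_le[of "A v" "{..<n}"] by simp
      finally have "degree_in E v \<le> card (A v) + n" .
      moreover have "degree_in E v \<ge> D" by (rule deg) (use v in \<open>auto simp: R_def\<close>)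
      ultimately show ?thesis by simp
    qed
    \<comment> \<open>A vertex of the pool is a leaf of the tree and cannot have two hosts.\<close>
    have disj: "A v \<inter> A w = {}" if "v \<in> ?U" "w \<in> ?U" "v \<noteq> w" for v w
    proof (rule ccontr)
      assume "A v \<inter> A w \<noteq> {}"
      then obtain x where x: "kind x = 3" "{v, x} \<in> E" "{w, x} \<in> E" by (auto simp: A_def)
      have "x \<ge> n" using x(1) kind_simps(1)[of x] by (cases "x < n") (auto split: if_splits)
      moreover have "x \<in> V" using tr(3)[OF x(2)] by simp
      ultimately have "{v, x} = {w, x}"
        using degree_le_1_unique[OF tr(7) leaf x(2,3)] by auto
      then show False using that(3) by (auto simp: doubleton_eq_iff)
    qed
    have finU: "finite ?U" using tr(1) by simp
    have "card ?U * D \<le> (\<Sum>v\<in>?U. card (A v) + n)"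
      using sum_mono[of ?U "\<lambda>_. D" "\<lambda>v. card (A v) + n"] A by simp
    also have "\<dots> = card (\<Union>v\<in>?U. A v) + card ?U * n"
      using finU disj by (subst card_UN_disjoint) (auto simp: A_def sum.distrib)
    also have "card (\<Union>v\<in>?U. A v) \<le> card {x. x < N \<and> kind x = 3}"
      by (rule card_mono) (auto simp: A_def)
    finally have count: "card ?U * D \<le> budget I * D + card ?U * n" by (simp add: card_kind)
    have "card ?U \<le> budget I"
    proof (rule ccontr)
      assume "\<not> card ?U \<le> budget I"
      \<comment> \<open>By n \<le> D the excess \<open>d\<close> cancels from the count, which
        leaves D \<le> n * (budget + 1) against \<open>large\<close>.\<close>
      then obtain d where d: "card ?U = Suc (budget I) + d" using less_imp_Suc_add not_le by fastforce
      have "n \<le> D" using large by simp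
      then have "d * n \<le> d * D" by simp
      moreover have "D + budget I * D + d * D \<le> budget I * D + (n + budget I * n + d * n)"
        using count by (simp add: d algebra_simps)
      moreover have "n + budget I * n < D" using large by (simp add: algebra_simps)
      ultimately show False by linarith
    qed
    moreover have "card ?V = card T + card ?U"
      using TV finite_T tr(1) by (simp add: card_Diff_subset card_mono)
    ultimately have "card ?V \<le> param I" using card_T unfolding budget_def by linarith
    then have "(?V, ?E) \<in> small_trees"
      using Vn Eo tree TV by (simp add: small_trees_def steiner_subtrees_def)
    moreover have "tree_weight I (?V, ?E) \<le> tree_weight J S"
    proof -
      have "tree_weight I (?V, ?E) = (\<Sum>e\<in>?E. the (weight J e))"
        unfolding tree_weight_def snd_conv
      proof (rule sum.cong[OF refl])
        fix e assume e: "e \<in> ?E"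
        then have "e \<subseteq> {..<n}" using is_treeD(3)[OF tree e] Vn by blast
        then show "the (weight I e) = the (weight J e)" by (simp add: weight_old)
      qed
      also have "\<dots> \<le> (\<Sum>e\<in>E. the (weight J e))"
        by (rule sum_mono2) (use tr(7) nonnegE in auto)
      finally show ?thesis by (simp add: tree_weight_def S)
    qed
    ultimately show ?thesis by blast
  qed
qed

lemma mcst_reduced: "param I > 0 \<Longrightarrow> mcst J = scst I"
proof -
  assume "param I > 0"
  then have "min_weight I small_trees = min_weight J branchy_trees"
    by (intro min_weight_eqI branchy_of_small small_of_branchy)
      (auto simp: small_trees_def branchy_trees_def)
  then show ?thesis by (simp add: scst_def mcst_def small_trees_def branchy_trees_def)
qed

end

section \<open>Lengths of encodings\<close>

lemma length_enc_nat: "length (enc_nat m) = 2 * length (bits m) + 1"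
  by (simp add: enc_nat_def enc_list_def length_concat comp_def sum_list_triv)

lemma length_bits_less: "m < 2 ^ k \<Longrightarrow> length (bits m) \<le> k"
proof (induction k arbitrary: m)
  case 0
  then show ?case by (simp add: bits.simps)
next
  case (Suc k)
  then have "m div 2 < 2 ^ k" by auto
  from Suc.IH[OF this] show ?case by (subst bits.simps) simp
qed

lemma less_power_length_bits: "m < 2 ^ length (bits m)"
proof (induction m rule: bits.induct)
  case (1 m)
  show ?case
  proof (cases "m = 0")
    case False
    then have "m div 2 < 2 ^ length (bits (m div 2))" using 1 by blast
    moreover have "length (bits m) = Suc (length (bits (m div 2)))"
      using False by (subst bits.simps) simp
    ultimately show ?thesis by simp
  qed simp
qed

section \<open>The length of an optimal weight\<close>

text \<open>With lowest terms p / d, cross multiplication gives p * b = a * d, and coprimality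
  yields d dvd b and p dvd a. The case a = 0 is separate because divisors of 0 are
  unbounded.\<close>

lemma quotient_of_bounds:
  assumes "q = of_nat a / of_nat b" "b > 0"
  shows "nat (fst (quotient_of q)) \<le> a" "nat (snd (quotient_of q)) \<le> b"
proof -
  obtain p d where pd: "quotient_of q = (p, d)" by fastforce
  have d: "d > 0" "coprime p d" "q = of_int p / of_int d"
    using quotient_of_denom_pos[OF pd] quotient_of_coprime[OF pd] quotient_of_div[OF pd] by auto
  have "(of_int p :: rat) * of_nat b = of_nat a * of_int d"
    using assms d(1,3) by (simp add: field_simps)
  then have "(of_int (p * int b) :: rat) = of_int (int a * d)" by simp
  then have eq: "p * int b = int a * d" by (simp only: of_int_eq_iff)
  then have "d dvd int b"
    using d(2) by (metis coprime_commute coprime_dvd_mult_right_iff dvd_triv_right)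
  then show "nat (snd (quotient_of q)) \<le> b"
    using assms(2) zdvd_imp_le[of d "int b"] by (simp add: pd nat_le_iff)
  have "p dvd int a" using d(2) eq by (metis coprime_dvd_mult_left_iff dvd_triv_left)
  moreover have "p = 0" if "a = 0" using eq that assms(2) by simp
  ultimately show "nat (fst (quotient_of q)) \<le> a"
    using zdvd_imp_le[of p "int a"] by (cases "a = 0") (simp_all add: pd nat_le_iff)
qed

lemma enc_value_bounds:
  assumes "length (enc_value (Some q)) \<le> L"
  shows "nat (fst (quotient_of q)) < 2 ^ L" "nat (snd (quotient_of q)) < 2 ^ L"
proof -
  have "length (bits (nat (fst (quotient_of q)))) \<le> L" "length (bits (nat (snd (quotient_of q)))) \<le> L"
    using assms by (auto simp: enc_value_def length_enc_nat)
  then show "nat (fst (quotient_of q)) < 2 ^ L" "nat (snd (quotient_of q)) < 2 ^ L"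
    using less_power_length_bits
    by (meson less_le_trans one_le_numeral power_increasing)+
qed

text \<open>The fractions are added over the product of their denominators without cancelling. With
  H = 2 ^ L and c summands so far, one more summand multiplies the denominator bound by H and gives
  a numerator of at most H ^ (c + 1) + c * H ^ (c + 1).\<close>

lemma sum_fractions:
  fixes w :: "'a \<Rightarrow> rat"
  assumes "finite E" "\<And>e. e \<in> E \<Longrightarrow> w e \<ge> 0 \<and> length (enc_value (Some (w e))) \<le> L"
  shows "\<exists>a b. b > 0 \<and> b \<le> (2 ^ L) ^ card E \<and> a \<le> card E * (2 ^ L) ^ card E \<and>
    sum w E = of_nat a / of_nat b"
  using assms
proof (induction E rule: finite_induct)
  case empty
  then show ?case by (intro exI[of _ 0] exI[of _ 1]) simp
next
  case (insert e E)
  let ?H = "2 ^ L :: nat"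
  obtain a b where ab: "b > 0" "b \<le> ?H ^ card E" "a \<le> card E * ?H ^ card E"
    "sum w E = of_nat a / of_nat b"
    using insert by auto
  obtain p d where pd: "quotient_of (w e) = (p, d)" by fastforce
  have we: "w e \<ge> 0" "length (enc_value (Some (w e))) \<le> L" using insert.prems by auto
  have d: "d > 0" "w e = of_int p / of_int d"
    using quotient_of_denom_pos[OF pd] quotient_of_div[OF pd] by auto
  then have "p \<ge> 0" using we(1) by (auto simp: zero_le_divide_iff)
  define m k where "m = nat p" and "k = nat d"
  have "m < ?H" "k < ?H"
    using enc_value_bounds[OF we(2)] unfolding pd m_def k_def by simp_all
  then have mk: "m \<le> ?H" "k \<le> ?H" "k > 0" "w e = of_nat m / of_nat k"
    using d \<open>p \<ge> 0\<close> by (simp_all add: m_def k_def)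
  have "sum w (insert e E) = of_nat (m * b + a * k) / of_nat (b * k)"
    using insert.hyps ab mk by (simp add: field_simps)
  moreover have "b * k \<le> ?H ^ card (insert e E)"
    using mult_le_mono[OF ab(2) mk(2)] insert.hyps by (simp add: mult.commute)
  moreover have "m * b + a * k \<le> card (insert e E) * ?H ^ card (insert e E)"
    using mult_le_mono[OF mk(1) ab(2)] mult_le_mono[OF ab(3) mk(2)] insert.hyps
    by (simp add: algebra_simps)
  moreover have "0 < b * k" using ab(1) mk(3) by simp
  ultimately show ?case by (intro exI[of _ "m * b + a * k"] exI[of _ "b * k"] conjI)
qed

text \<open>The factor \<open>card E\<close> of the numerator is absorbed by c < 2 ^ c, hence
  \<open>Suc L\<close>. With k = Suc L * card E, numerator and denominator have at most k + 1
  digits, and two symbols per digit plus delimiters make 2 * (2 * (k + 1) + 1) + 1 = 4 * k +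
  7.\<close>

lemma length_enc_value_sum:
  fixes w :: "'a \<Rightarrow> rat"
  assumes "finite E" "\<And>e. e \<in> E \<Longrightarrow> w e \<ge> 0 \<and> length (enc_value (Some (w e))) \<le> L"
  shows "length (enc_value (Some (sum w E))) \<le> 4 * (Suc L * card E) + 7"
proof -
  obtain a b where ab: "b > 0" "b \<le> (2 ^ L) ^ card E" "a \<le> card E * (2 ^ L) ^ card E"
    "sum w E = of_nat a / of_nat b"
    using sum_fractions[where w = w, OF assms] by blast
  have pow: "(2 ^ L) ^ card E = (2 ^ (L * card E) :: nat)" by (simp add: power_mult)
  have "a \<le> 2 ^ card E * 2 ^ (L * card E)"
    using ab(3) pow by (metis less_exp less_imp_le mult_le_mono1 order_trans)
  then have a: "a \<le> 2 ^ (Suc L * card E)" by (simp add: power_add)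
  have "b \<le> 2 ^ (L * card E)" using ab(2) pow by simp
  also have "\<dots> \<le> 2 ^ (Suc L * card E)" by (rule power_increasing) auto
  finally have b: "b \<le> 2 ^ (Suc L * card E)" .
  have bits: "length (bits c) \<le> Suc (Suc L * card E)" if "c \<le> 2 ^ (Suc L * card E)" for c
    by (rule length_bits_less) (use that in \<open>simp add: le_less_trans\<close>)
  show ?thesis
    using bits[OF order_trans[OF quotient_of_bounds(1)[OF ab(4,1)] a]]
      bits[OF order_trans[OF quotient_of_bounds(2)[OF ab(4,1)] b]]
    by (simp add: enc_value_def length_enc_nat)
qed

lemma length_enc_list: "length (enc_list f xs) = (\<Sum>x\<leftarrow>xs. Suc (length (f x))) + 1"
  by (simp add: enc_list_def length_concat comp_def)

lemma length_le_enc_list: "x \<in> set xs \<Longrightarrow> length (f x) \<le> length (enc_list f xs)"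
  by (induction xs) (auto simp: length_enc_list)

lemma enc_list_length_ge:
  "(\<And>x. x \<in> set xs \<Longrightarrow> k \<le> length (f x)) \<Longrightarrow> length xs * Suc k + 1 \<le> length (enc_list f xs)"
  by (induction xs) (fastforce simp: length_enc_list)+

text \<open>Each row has a continuation bit for each of its n entries, and the matrix has one more
  for each row. Since the budget is at most n, the first bound makes the input length admissible as
  D.\<close>

lemma length_enc_instance:
  "num_vertices I * (num_vertices I + 1) < length (enc_instance I)"
  "num_vertices I \<le> length (enc_instance I)"
  "length (bits (param I)) \<le> length (enc_instance I)"
  "i < num_vertices I \<Longrightarrow> j < num_vertices I \<Longrightarrow>
     length (enc_value (matrix_entry I i j)) \<le> length (enc_instance I)"
proof -
  let ?n = "num_vertices I"
  let ?row = "\<lambda>i. enc_list (\<lambda>j. enc_value (matrix_entry I i j)) [0..<?n]"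
  have "?n \<le> length (?row i)" for i
    using enc_list_length_ge[of "[0..<?n]" 0 "\<lambda>j. enc_value (matrix_entry I i j)"] by simp
  then have m: "?n * Suc ?n + 1 \<le> length (enc_list ?row [0..<?n])"
    using enc_list_length_ge[of "[0..<?n]" ?n ?row] by simp
  then show *: "num_vertices I * (num_vertices I + 1) < length (enc_instance I)"
    by (simp add: enc_instance_def)
  have "?n \<le> ?n * (?n + 1)" by simp
  then show "?n \<le> length (enc_instance I)" using * by linarith
  show "length (bits (param I)) \<le> length (enc_instance I)"
    by (simp add: enc_instance_def length_enc_nat)
  assume "i < ?n" "j < ?n"
  then have "length (enc_value (matrix_entry I i j)) \<le> length (?row i)"
    "length (?row i) \<le> length (enc_list ?row [0..<?n])"
    using length_le_enc_list[of j "[0..<?n]" "\<lambda>j. enc_value (matrix_entry I i j)"]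
      length_le_enc_list[of i "[0..<?n]" ?row] by auto
  then show "length (enc_value (matrix_entry I i j)) \<le> length (enc_instance I)"
    by (simp add: enc_instance_def)
qed

text \<open>A tree has at most n * n edges, and each of their weights is spelled out in the input.
  This bounds the time for copying the answer.\<close>

lemma length_scst:
  assumes "wf_instance I"
  defines "l \<equiv> length (enc_instance I)"
  shows "length (enc_value (scst I)) \<le> 4 * (Suc l * (l * l)) + 7"
proof (cases "scst I")
  case None
  then show ?thesis by (simp add: enc_value_def)
next
  case (Some q)
  define F where "F = {(V', E') \<in> steiner_subtrees I. card V' \<le> param I}"
  have ne: "F \<noteq> {}" and q: "q = Min (tree_weight I ` F)"
    using Some by (auto simp: scst_def min_weight_def F_def split: if_splits)
  have "F \<subseteq> Pow {..<num_vertices I} \<times> Pow (Pow {..<num_vertices I})"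
    by (auto simp: F_def steiner_subtrees_def edges_def)
  then have "finite F" by (rule finite_subset) simp
  then have "q \<in> tree_weight I ` F" using ne q by simp
  then obtain V E where E: "E \<subseteq> edges I" "q = (\<Sum>e\<in>E. the (weight I e))"
    by (auto simp: F_def steiner_subtrees_def tree_weight_def)
  let ?n = "num_vertices I"
  have sub: "edges I \<subseteq> (\<lambda>(i, j). {i, j}) ` ({..<?n} \<times> {..<?n})"
    by (auto simp: edges_def card_2_iff)
  then have E_sub: "E \<subseteq> (\<lambda>(i, j). {i, j}) ` ({..<?n} \<times> {..<?n})" using E(1) by blast
  then have fin: "finite E" by (rule finite_subset) simp
  have "card E \<le> card ((\<lambda>(i, j). {i, j}) ` ({..<?n} \<times> {..<?n}))" by (rule card_mono[OF _ E_sub]) simp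
  also have "\<dots> \<le> ?n * ?n"
    using card_image_le[of "{..<?n} \<times> {..<?n}" "\<lambda>(i, j). {i, j}"] by (simp add: card_cartesian_product)
  also have "\<dots> \<le> l * l" using length_enc_instance(2)[of I] by (simp add: l_def mult_le_mono)
  finally have card: "card E \<le> l * l" .
  have w: "the (weight I e) \<ge> 0 \<and> length (enc_value (Some (the (weight I e)))) \<le> l" if "e \<in> E" for e
  proof -
    have e: "e \<in> edges I" using that E(1) by blast
    then obtain i j where ij: "e = {i, j}" "i \<noteq> j" "i < ?n" "j < ?n" "weight I e \<noteq> None"
      by (auto simp: edges_def card_2_iff)
    then have "Some (the (weight I e)) = matrix_entry I i j" by (auto simp: matrix_entry_def)
    then show ?thesis
      using length_enc_instance(4)[OF ij(3,4)] assms(1) e by (simp add: l_def wf_instance_def)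
  qed
  have "length (enc_value (Some q)) \<le> 4 * (Suc l * card E) + 7"
    unfolding E(2) by (rule length_enc_value_sum[OF fin]) (use w in auto)
  also have "\<dots> \<le> 4 * (Suc l * (l * l)) + 7"
    by (intro add_le_mono mult_le_mono card order_refl)
  finally show ?thesis unfolding Some .
qed

section \<open>While programs on tapes\<close>

type_synonym store = "nat \<Rightarrow> tape"

abbreviation (input) tape_count :: nat where "tape_count \<equiv> 10"
text \<open>Blank and the two bits, together with 3 and 4 for the kinds of new vertices; 3 also
  serves as the separator after weights.\<close>

abbreviation (input) symbol_count :: nat where "symbol_count \<equiv> 5"

text \<open>Tests and actions are arbitrary functions of the scanned symbols. They still yield a
  finite table, as there are finitely many tapes and symbols. A tape that an action maps to
  \<open>None\<close> is left alone.\<close>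

datatype com =
    Act "(nat \<Rightarrow> nat) \<Rightarrow> nat \<rightharpoonup> nat \<times> int"
  | Seq com com  (infixr ";;" 60)
  | Cond "(nat \<Rightarrow> nat) \<Rightarrow> bool" com com
  | Loop "(nat \<Rightarrow> nat) \<Rightarrow> bool" com

definition head :: "tape \<Rightarrow> nat" where
  "head t = fst t (snd t)"

text \<open>A store has a tape for every number, the machine only ten. The default 0 makes the
  scanned symbols depend on the ten real tapes alone.\<close>

definition reads :: "store \<Rightarrow> nat \<Rightarrow> nat" where
  "reads \<sigma> i = (if i < tape_count then head (\<sigma> i) else 0)"

definition apply_acts :: "(nat \<rightharpoonup> nat \<times> int) \<Rightarrow> store \<Rightarrow> store" where
  "apply_acts m \<sigma> = (\<lambda>j. case m j of None \<Rightarrow> \<sigma> j | Some a \<Rightarrow> act a (\<sigma> j))"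

fun control :: "com list \<Rightarrow> (nat \<Rightarrow> nat) \<Rightarrow> com list" where
  "control [] r = []"
| "control (Act a # K) r = K"
| "control (Seq c d # K) r = c # d # K"
| "control (Cond b c d # K) r = (if b r then c else d) # K"
| "control (Loop b c # K) r = (if b r then c # Loop b c # K else K)"

fun actions :: "com list \<Rightarrow> (nat \<Rightarrow> nat) \<Rightarrow> nat \<rightharpoonup> nat \<times> int" where
  "actions (Act a # K) r = a r"
| "actions _ r = Map.empty"

definition com_step :: "com list \<times> store \<Rightarrow> com list \<times> store" where
  "com_step = (\<lambda>(K, \<sigma>). (control K (reads \<sigma>), apply_acts (actions K (reads \<sigma>)) \<sigma>))"

text \<open>The quantifier over \<open>K\<close> says that the run does not look at what is to be
  done afterwards, so runs compose. \<open>T\<close> is only an upper bound, so that estimates can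
  be coarsened freely.\<close>

definition exec :: "com \<Rightarrow> store \<Rightarrow> nat \<Rightarrow> store \<Rightarrow> bool" where
  "exec c \<sigma> T \<sigma>' \<longleftrightarrow> (\<forall>K. \<exists>t\<le>T. (com_step ^^ t) (c # K, \<sigma>) = (K, \<sigma>'))"

lemma apply_acts_simps [simp]:
  "apply_acts Map.empty \<sigma> = \<sigma>"
  "apply_acts (m(j \<mapsto> a)) \<sigma> = (apply_acts m \<sigma>)(j := act a (\<sigma> j))"
  by (auto simp: apply_acts_def)

lemma reads_simp [simp]: "i < tape_count \<Longrightarrow> reads \<sigma> i = head (\<sigma> i)"
  by (simp add: reads_def)

lemma exec_weaken: "exec c \<sigma> T \<sigma>' \<Longrightarrow> T \<le> T' \<Longrightarrow> exec c \<sigma> T' \<sigma>'"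
  unfolding exec_def by (meson le_trans)

lemma exec_Act: "exec (Act a) \<sigma> 1 (apply_acts (a (reads \<sigma>)) \<sigma>)"
  unfolding exec_def by (intro allI exI[of _ 1]) (simp add: com_step_def)

lemma exec_Act': "apply_acts (a (reads \<sigma>)) \<sigma> = \<sigma>' \<Longrightarrow> exec (Act a) \<sigma> 1 \<sigma>'"
  using exec_Act by blast

text \<open>Unfolding \<open>Seq\<close>, \<open>Cond\<close> or \<open>Loop\<close> costs a step of
  its own that leaves the tapes alone; this is the \<open>Suc\<close> in the rules below.\<close>

lemma exec_after_step:
  assumes "\<And>K. com_step (c # K, \<sigma>) = (d K, \<sigma>)" "\<And>K. \<exists>t\<le>T. (com_step ^^ t) (d K, \<sigma>) = (K, \<sigma>')"
  shows "exec c \<sigma> (Suc T) \<sigma>'"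
  unfolding exec_def
proof
  fix K
  obtain t where "t \<le> T" "(com_step ^^ t) (d K, \<sigma>) = (K, \<sigma>')" using assms(2) by blast
  then show "\<exists>t\<le>Suc T. (com_step ^^ t) (c # K, \<sigma>) = (K, \<sigma>')"
    by (intro exI[of _ "Suc t"]) (simp add: funpow_Suc_right assms(1) del: funpow.simps)
qed

lemma exec_chain:
  assumes "exec c \<sigma> T1 \<sigma>1" "exec d \<sigma>1 T2 \<sigma>2"
  shows "\<exists>t\<le>T1 + T2. (com_step ^^ t) (c # d # K, \<sigma>) = (K, \<sigma>2)"
proof -
  obtain t1 where 1: "t1 \<le> T1" "(com_step ^^ t1) (c # d # K, \<sigma>) = (d # K, \<sigma>1)"
    using assms(1) unfolding exec_def by blast
  obtain t2 where 2: "t2 \<le> T2" "(com_step ^^ t2) (d # K, \<sigma>1) = (K, \<sigma>2)"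
    using assms(2) unfolding exec_def by blast
  show ?thesis
    using 1 2 by (intro exI[of _ "t2 + t1"]) (simp add: funpow_add)
qed

lemma exec_Seq:
  assumes "exec c \<sigma> T1 \<sigma>1" "exec d \<sigma>1 T2 \<sigma>2"
  shows "exec (c ;; d) \<sigma> (Suc (T1 + T2)) \<sigma>2"
  by (rule exec_after_step[where d = "\<lambda>K. c # d # K"])
    (use exec_chain[OF assms] in \<open>auto simp: com_step_def\<close>)

lemma exec_Cond:
  assumes "b (reads \<sigma>) \<Longrightarrow> exec c \<sigma> T \<sigma>'" "\<not> b (reads \<sigma>) \<Longrightarrow> exec d \<sigma> T \<sigma>'"
  shows "exec (Cond b c d) \<sigma> (Suc T) \<sigma>'"
  by (rule exec_after_step[where d = "\<lambda>K. (if b (reads \<sigma>) then c else d) # K"])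
    (use assms in \<open>auto simp: com_step_def exec_def\<close>)

lemma exec_Loop_stop: "\<not> b (reads \<sigma>) \<Longrightarrow> exec (Loop b c) \<sigma> 1 \<sigma>"
  unfolding exec_def by (intro allI exI[of _ 1]) (simp add: com_step_def)

lemma exec_Loop_step:
  assumes "b (reads \<sigma>)" "exec c \<sigma> T1 \<sigma>1" "exec (Loop b c) \<sigma>1 T2 \<sigma>2"
  shows "exec (Loop b c) \<sigma> (Suc (T1 + T2)) \<sigma>2"
  by (rule exec_after_step[where d = "\<lambda>K. c # Loop b c # K"])
    (use exec_chain[OF assms(2,3)] assms(1) in \<open>auto simp: com_step_def\<close>)

text \<open>The rule for sweeps: \<open>S ys zs\<close> is the store when \<open>ys\<close> has been
  processed and \<open>zs\<close> is still ahead. Each round costs the body and one test.\<close>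

lemma exec_foreach:
  assumes "\<And>ys a zs. xs = ys @ a # zs \<Longrightarrow>
      b (reads (S ys (a # zs))) \<and> exec c (S ys (a # zs)) B (S (ys @ [a]) zs)"
    and "\<not> b (reads (S xs []))"
  shows "exec (Loop b c) (S [] xs) (length xs * Suc B + 1) (S xs [])"
proof -
  have "exec (Loop b c) (S ys zs) (length zs * Suc B + 1) (S xs [])" if "xs = ys @ zs" for ys zs
    using that
  proof (induction zs arbitrary: ys)
    case Nil
    then show ?case using exec_Loop_stop[where b = b, OF assms(2)] by simp
  next
    case (Cons a zs)
    have "exec (Loop b c) (S (ys @ [a]) zs) (length zs * Suc B + 1) (S xs [])"
      using Cons by simp
    from exec_Loop_step[OF _ _ this] assms(1)[OF Cons.prems]
    have "exec (Loop b c) (S ys (a # zs)) (Suc (B + (length zs * Suc B + 1))) (S xs [])"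
      by blast
    then show ?case by (rule exec_weaken) simp
  qed
  from this[of "[]" xs] show ?thesis by simp
qed

section \<open>Compiling programs to oracle machines\<close>

fun wf_com :: "com \<Rightarrow> bool" where
  "wf_com (Act a) \<longleftrightarrow> (\<forall>r j s d. (\<forall>i. r i < symbol_count) \<longrightarrow> a r j = Some (s, d) \<longrightarrow>
     s < symbol_count \<and> d \<in> {-1, 0, 1})"
| "wf_com (Seq c d) \<longleftrightarrow> wf_com c \<and> wf_com d"
| "wf_com (Cond b c d) \<longleftrightarrow> wf_com c \<and> wf_com d"
| "wf_com (Loop b c) \<longleftrightarrow> wf_com c"

text \<open>
  The states of the compiled machine are the stacks of commands still to be executed; only finitely
  many of them can arise from a given program.
\<close>

fun continuations :: "com \<Rightarrow> com list \<Rightarrow> com list set" where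
  "continuations (Act a) K = {Act a # K}"
| "continuations (Seq c d) K = insert (Seq c d # K) (continuations c (d # K) \<union> continuations d K)"
| "continuations (Cond b c d) K =
     insert (Cond b c d # K) (continuations c K \<union> continuations d K)"
| "continuations (Loop b c) K = insert (Loop b c # K) (continuations c (Loop b c # K))"

lemma finite_continuations: "finite (continuations c K)"
  by (induction c arbitrary: K) auto

lemma Cons_in_continuations: "c # K \<in> continuations c K"
  by (cases c) auto

lemma control_continuations:
  "s \<in> continuations c K \<Longrightarrow> control s r \<in> insert K (continuations c K)"
proof (induction c arbitrary: K)
  case (Seq c d)
  then show ?case
    using Cons_in_continuations[of c "d # K"] Cons_in_continuations[of d K] by fastforce
next
  case (Cond b c d)
  then show ?case
    using Cons_in_continuations[of c K] Cons_in_continuations[of d K]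
    by (cases "s = Cond b c d # K") (auto split: if_splits)
next
  case (Loop b c)
  then show ?case
    using Cons_in_continuations[of c "Loop b c # K"] by fastforce
qed auto

lemma actions_continuations:
  assumes "s \<in> continuations c K" "wf_com c" "\<And>i. r i < symbol_count" "actions s r j = Some (a, d)"
  shows "a < symbol_count \<and> d \<in> {-1, 0, 1}"
  using assms by (induction c arbitrary: K) auto

definition init_store :: "bool list \<Rightarrow> store" where
  "init_store x = (\<lambda>j. tape_of [])(0 := tape_of x)"

text \<open>One program runs before the query and one after it. Their stacks are tagged
  \<open>Inl\<close> and \<open>Inr\<close>, as the same stack may occur in both; the empty stack is
  the query state in the first phase and the halting state in the second. The additional step is the
  query itself, and any larger \<open>t\<close> works because a halted machine stays put.\<close>

lemma compile:
  assumes wf: "wf_com pre" "wf_com post"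
  obtains M where "wf_tm M"
    "\<And>f x T1 \<sigma>1 T2 \<sigma>2 t. exec pre (init_store x) T1 \<sigma>1 \<Longrightarrow>
       exec post (\<sigma>1(1 := tape_of (f (string_on (\<sigma>1 1))))) T2 \<sigma>2 \<Longrightarrow> T1 + T2 + 1 \<le> t \<Longrightarrow>
       computes_within M f x t (string_on (\<sigma>2 2))"
proof -
  define A where "A = insert [] (continuations pre [])"
  define B where "B = insert [] (continuations post [])"
  define S where "S = A <+> B"
  have "finite S" by (simp add: S_def A_def B_def finite_continuations)
  then obtain h :: "com list + com list \<Rightarrow> nat" and n where h: "h ` S = {i. i < n}" "inj_on h S"
    using finite_imp_inj_to_nat_seg[of S] by blast
  define r where "r = (\<lambda>(ss :: nat list) i. if i < tape_count then ss ! i else 0)"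
  \<comment> \<open>A tape without an action rewrites the symbol just read and does not move.
    \<open>inv_into\<close> recovers the stack from the number of the state.\<close>
  define \<delta> where "\<delta> = (\<lambda>q ss. let s = inv_into S h q in
    (h (map_sum (\<lambda>K. control K (r ss)) (\<lambda>K. control K (r ss)) s),
     map (\<lambda>j. case actions (case_sum id id s) (r ss) j of None \<Rightarrow> (r ss j, 0) | Some a \<Rightarrow> a)
       [0..<tape_count]))"
  define M where "M = \<lparr>num_states = n, num_symbols = symbol_count, num_tapes = tape_count,
    start_state = h (Inl [pre]), halt_state = h (Inr []), query_state = h (Inl []),
    resume_state = h (Inr [post]), delta = \<delta>\<rparr>"
  have ctrlA: "control K ss \<in> A" if "K \<in> A" for K ss
    using that control_continuations[of K pre "[]" ss] by (auto simp: A_def)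
  have ctrlB: "control K ss \<in> B" if "K \<in> B" for K ss
    using that control_continuations[of K post "[]" ss] by (auto simp: B_def)
  have in_S: "Inl [pre] \<in> S" "Inl [] \<in> S" "Inr [post] \<in> S" "Inr [] \<in> S"
    using Cons_in_continuations[of pre "[]"] Cons_in_continuations[of post "[]"]
    by (auto simp: S_def A_def B_def)
  have act_ok: "a < symbol_count \<and> d \<in> {-1, 0, 1}"
    if "s \<in> S" "\<And>i. ss i < symbol_count" "actions (case_sum id id s) ss j = Some (a, d)"
    for s ss j a d
    using that wf actions_continuations[of _ pre "[]" ss j a d]
      actions_continuations[of _ post "[]" ss j a d]
    by (auto simp: S_def A_def B_def)
  have h_less: "h s < n" if "s \<in> S" for s using h(1) that by blast
  have "wf_tm M"
    unfolding wf_tm_def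
  proof (intro conjI allI impI)
    show "{start_state M, halt_state M, query_state M, resume_state M} \<subseteq> {..<num_states M}"
      using in_S h_less by (auto simp: M_def)
    show "halt_state M \<noteq> query_state M"
      using in_S inj_onD[OF h(2)] by (auto simp: M_def)
  next
    fix q ss assume q: "q < num_states M" and ss: "length ss = num_tapes M \<and> set ss \<subseteq> {..<num_symbols M}"
    define s where "s = inv_into S h q"
    have "q \<in> h ` S" using q h(1) by (simp add: M_def)
    then have s: "s \<in> S" by (simp add: s_def inv_into_into)
    have "map_sum (\<lambda>K. control K (r ss)) (\<lambda>K. control K (r ss)) s \<in> S"
      using s ctrlA ctrlB by (auto simp: S_def)
    moreover have rss: "r ss i < symbol_count" for i
      using ss nth_mem[of i ss] by (auto simp: r_def M_def subset_iff simp del: nth_mem)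
    ultimately show "case delta M q ss of (q', as) \<Rightarrow> q' < num_states M \<and> length as = num_tapes M \<and>
        set as \<subseteq> {..<num_symbols M} \<times> {-1, 0, 1}"
      using act_ok[OF s rss] h_less
      by (fastforce simp: M_def \<delta>_def Let_def simp flip: s_def split: option.splits)
  qed (simp_all add: M_def)
  moreover have "computes_within M f x t (string_on (\<sigma>2 2))"
    if pre: "exec pre (init_store x) T1 \<sigma>1" and
      post: "exec post (\<sigma>1(1 := tape_of (f (string_on (\<sigma>1 1))))) T2 \<sigma>2" and t: "T1 + T2 + 1 \<le> t"
    for f x T1 \<sigma>1 T2 \<sigma>2 t
  proof -
    let ?L = "\<lambda>\<sigma>. map \<sigma> [0..<tape_count]"
    have r_L: "r (map (\<lambda>(t, p). t p) (?L \<sigma>)) = reads \<sigma>" for \<sigma> :: store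
      by (auto simp: r_def reads_def head_def fun_eq_iff case_prod_beta simp del: upt_rec_numeral)
    have acts: "map2 act (map (\<lambda>j. case m j of None \<Rightarrow> (reads \<sigma> j, 0) | Some a \<Rightarrow> a)
        [0..<tape_count]) (?L \<sigma>) = ?L (apply_acts m \<sigma>)" for m \<sigma>
      by (intro nth_equalityI)
        (auto simp: apply_acts_def act_def reads_def head_def split: option.splits
          simp del: upt_rec_numeral)
    have step: "step M f (h (tag K), ?L \<sigma>) =
        (case com_step (K, \<sigma>) of (K', \<sigma>') \<Rightarrow> (h (tag K'), ?L \<sigma>'))"
      if "tag K \<in> S" "K \<noteq> []" "tag = Inl \<or> tag = Inr" for tag K \<sigma>
    proof -
      have "h (tag K) \<noteq> h (Inl [])" "h (tag K) \<noteq> h (Inr [])"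
        using that in_S inj_onD[OF h(2)] by auto
      moreover have "inv_into S h (h (tag K)) = tag K" using that h(2) by simp
      ultimately show ?thesis
        using that(3)
        by (auto simp: step_def M_def \<delta>_def Let_def r_L acts com_step_def
            simp del: upt_rec_numeral map_map cong del: option.case_cong_weak)
    qed
    \<comment> \<open>The empty stack is a fixed point of \<open>com_step\<close>, but for the
      machine the query state is not. The machine run is therefore cut off when the stack first
      becomes empty, possibly before \<open>t\<close>.\<close>
    have steps: "\<exists>t'\<le>t. (step M f ^^ t') (h (tag K), ?L \<sigma>) = (h (tag []), ?L \<sigma>')"
      if "(com_step ^^ t) (K, \<sigma>) = ([], \<sigma>')" "tag K \<in> S" "tag = Inl \<or> tag = Inr"
      for tag K t \<sigma> \<sigma>'
      using that
    proof (induction t arbitrary: K \<sigma>)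
      case 0
      then show ?case by simp
    next
      case (Suc t)
      show ?case
      proof (cases "K = []")
        case True
        have "(com_step ^^ i) ([], \<sigma>) = ([], \<sigma>)" for i
          by (induction i) (simp_all add: com_step_def)
        with Suc.prems True have "\<sigma>' = \<sigma>" by (metis prod.inject)
        then show ?thesis using True by (intro exI[of _ 0]) simp
      next
        case False
        obtain K' \<sigma>'' where c: "com_step (K, \<sigma>) = (K', \<sigma>'')" by fastforce
        have "tag K' \<in> S"
          using Suc.prems(2,3) ctrlA ctrlB c by (auto simp: S_def com_step_def)
        moreover have "(com_step ^^ t) (K', \<sigma>'') = ([], \<sigma>')"
          using Suc.prems(1) c by (simp add: funpow_Suc_right del: funpow.simps)
        ultimately obtain t' where "t' \<le> t" "(step M f ^^ t') (h (tag K'), ?L \<sigma>'') = (h (tag []), ?L \<sigma>')"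
          using Suc.IH Suc.prems(3) by blast
        then show ?thesis
          using step[OF Suc.prems(2) False Suc.prems(3), of \<sigma>] c
          by (intro exI[of _ "Suc t'"])
            (simp add: funpow_Suc_right del: funpow.simps upt_rec_numeral)
      qed
    qed
    obtain u1 where u1: "u1 \<le> T1" "(com_step ^^ u1) ([pre], init_store x) = ([], \<sigma>1)"
      using pre unfolding exec_def by blast
    from steps[OF u1(2), of Inl] in_S u1(1) obtain t1 where t1: "t1 \<le> T1"
      "(step M f ^^ t1) (h (Inl [pre]), ?L (init_store x)) = (h (Inl []), ?L \<sigma>1)"
      by (meson le_trans)
    define \<sigma>1' where "\<sigma>1' = \<sigma>1(1 := tape_of (f (string_on (\<sigma>1 1))))"
    obtain u2 where u2: "u2 \<le> T2" "(com_step ^^ u2) ([post], \<sigma>1') = ([], \<sigma>2)"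
      using post unfolding exec_def \<sigma>1'_def by blast
    from steps[OF u2(2), of Inr] in_S u2(1) obtain t2 where t2: "t2 \<le> T2"
      "(step M f ^^ t2) (h (Inr [post]), ?L \<sigma>1') = (h (Inr []), ?L \<sigma>2)"
      by (meson le_trans)
    have "h (Inl []) \<noteq> h (Inr [])" using in_S inj_onD[OF h(2)] by auto
    moreover have "(?L \<sigma>1)[1 := tape_of (f (string_on (?L \<sigma>1 ! 1)))] = ?L \<sigma>1'"
      by (auto simp: \<sigma>1'_def list_eq_iff_nth_eq nth_list_update simp del: upt_rec_numeral)
    ultimately have q: "step M f (h (Inl []), ?L \<sigma>1) = (h (Inr [post]), ?L \<sigma>1')"
      by (simp add: step_def M_def del: upt_rec_numeral)
    have init: "init_config M x = (h (Inl [pre]), ?L (init_store x))"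
      by (auto simp: init_config_def M_def init_store_def list_eq_iff_nth_eq nth_Cons'
          simp del: upt_rec_numeral)
    have "(step M f ^^ (t2 + (1 + t1))) (init_config M x) = (h (Inr []), ?L \<sigma>2)"
      by (simp only: funpow_add comp_apply init t1(2) t2(2) q One_nat_def funpow.simps id_apply)
    moreover have halted: "(step M f ^^ i) (h (Inr []), ts) = (h (Inr []), ts)" for i ts
      by (induction i) (simp_all add: step_def M_def)
    moreover have "t = (t - (t2 + (1 + t1))) + (t2 + (1 + t1))" using t t1 t2 by linarith
    ultimately have "(step M f ^^ t) (init_config M x) = (h (Inr []), ?L \<sigma>2)"
      by (metis funpow_add comp_apply)
    then show ?thesis
      by (simp add: computes_within_def M_def numeral_2_eq_2 del: upt_rec_numeral)
  qed
  ultimately show thesis using that by blast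
qed

section \<open>Operations on single tapes\<close>

definition bsym :: "bool \<Rightarrow> nat" where
  "bsym b = (if b then 2 else 1)"

text \<open>The head may be anywhere, in particular on the blank cell -1 where \<open>rewind\<close>
  turns round.\<close>

definition padded :: "nat list \<Rightarrow> int \<Rightarrow> tape" where
  "padded xs p = ((\<lambda>i. if 0 \<le> i \<and> i < int (length xs) then xs ! nat i else 0), p)"

text \<open>A zipper: the word starts at cell 0 and the head is on the first symbol of
  \<open>rs\<close>, or on the blank behind the word if \<open>rs\<close> is empty.\<close>

definition zt :: "nat list \<Rightarrow> nat list \<Rightarrow> tape" where
  "zt ls rs = padded (ls @ rs) (int (length ls))"

lemma bsym_simps [simp]:
  "bsym True = 2" "bsym False = 1" "bsym b \<noteq> 0" "0 < bsym b" "bsym b \<noteq> 3" "bsym b = 2 \<longleftrightarrow> b"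
  "bsym b = Suc 0 \<longleftrightarrow> \<not> b" "bsym b \<le> 2"
  by (auto simp: bsym_def)

lemma tape_of_zt: "tape_of x = zt [] (map bsym x)"
  by (auto simp: tape_of_def zt_def padded_def bsym_def fun_eq_iff)

lemma head_zt [simp]: "head (zt ls []) = 0" "head (zt ls (a # rs)) = a"
  by (auto simp: head_def zt_def padded_def)

lemma act_zt [simp]:
  "act (b, 1) (zt ls (a # rs)) = zt (ls @ [b]) rs"
  "act (b, 1) (zt ls []) = zt (ls @ [b]) []"
  "act (b, 0) (zt ls (a # rs)) = zt ls (b # rs)"
  "act (b, 0) (zt ls []) = zt ls [b]"
  by (auto simp: act_def zt_def padded_def fun_eq_iff nth_append nth_Cons' nat_eq_iff)

lemma string_on_zt: "string_on (zt (map bsym x) []) = x"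
proof -
  have "(LEAST i. fst (zt (map bsym x) []) (int i) \<notin> {1, 2}) = length x"
  proof (rule Least_equality)
    fix i assume "fst (zt (map bsym x) []) (int i) \<notin> {1, 2}"
    then show "length x \<le> i"
      by (cases "i < length x") (auto simp: zt_def padded_def bsym_def split: if_splits)
  qed (simp add: zt_def padded_def)
  then show ?thesis
    unfolding string_on_def by (intro nth_equalityI) (auto simp: zt_def padded_def)
qed

lemma exec_Seq':
  "exec c \<sigma> T1 \<sigma>1 \<Longrightarrow> exec d \<sigma>1 T2 \<sigma>2 \<Longrightarrow> Suc (T1 + T2) \<le> T \<Longrightarrow> exec (c ;; d) \<sigma> T \<sigma>2"
  by (rule exec_weaken[OF exec_Seq])

lemma exec_Act_Seq:
  assumes "apply_acts (a (reads \<sigma>)) \<sigma> = \<sigma>1" "exec d \<sigma>1 T2 \<sigma>2" "T2 + 2 \<le> T"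
  shows "exec (Act a ;; d) \<sigma> T \<sigma>2"
  by (rule exec_Seq'[OF exec_Act'[where a = a, OF assms(1)] assms(2)]) (use assms(3) in simp)

lemma exec_Act1: "apply_acts (a (reads \<sigma>)) \<sigma> = \<sigma>1 \<Longrightarrow> 1 \<le> T \<Longrightarrow> exec (Act a) \<sigma> T \<sigma>1"
  by (rule exec_weaken[OF exec_Act'])

lemma exec_foreach':
  assumes "\<And>ys a zs. xs = ys @ a # zs \<Longrightarrow> b (reads (S ys (a # zs)))"
    and "\<And>ys a zs. xs = ys @ a # zs \<Longrightarrow> exec c (S ys (a # zs)) B (S (ys @ [a]) zs)"
    and "\<not> b (reads (S xs []))" "\<sigma> = S [] xs" "\<sigma>' = S xs []" "length xs * Suc B + 1 \<le> T"
  shows "exec (Loop b c) \<sigma> T \<sigma>'"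
  using exec_weaken[OF exec_foreach[where xs = xs and S = S and b = b and c = c and B = B]] assms
  by blast

abbreviation right :: "nat \<Rightarrow> com" where
  "right j \<equiv> Act (\<lambda>r. [j \<mapsto> (r j, 1)])"

abbreviation left :: "nat \<Rightarrow> com" where
  "left j \<equiv> Act (\<lambda>r. [j \<mapsto> (r j, -1)])"

abbreviation put :: "nat \<Rightarrow> nat \<Rightarrow> com" where
  "put j s \<equiv> Act (\<lambda>r. [j \<mapsto> (s, 1)])"

text \<open>The first \<open>left\<close> is unconditional because the head usually stands on the
  blank behind the word. The tapes are two-way infinite, so the blank cell -1 marks the left
  end.\<close>

definition rewind :: "nat \<Rightarrow> com" where
  "rewind j = left j ;; Loop (\<lambda>r. r j \<noteq> 0) (left j) ;; right j"

lemma act_padded: "act (head (padded xs p), d) (padded xs p) = padded xs (p + d)"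
  by (auto simp: act_def head_def padded_def)

lemma exec_rewind:
  assumes "\<sigma> j = zt ls rs" "0 \<notin> set ls" "j < tape_count" "2 * length ls + 6 \<le> T"
  shows "exec (rewind j) \<sigma> T (\<sigma>(j := zt [] (ls @ rs)))"
proof -
  let ?S = "\<lambda>p. \<sigma>(j := padded (ls @ rs) p)"
  \<comment> \<open>The head is on the last of \<open>k\<close> cells still to be crossed, at cell
    -1 when none remains.\<close>
  have loop: "exec (Loop (\<lambda>r. r j \<noteq> 0) (left j)) (?S (int k - 1)) (2 * k + 1) (?S (-1))"
    if "k \<le> length ls" for k
    using that
  proof (induction k)
    case 0
    have "\<not> reads (?S (int 0 - 1)) j \<noteq> 0" using assms(3) by (simp add: head_def padded_def)
    from exec_Loop_stop[where b = "\<lambda>r. r j \<noteq> 0" and c = "left j", OF this]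
    show ?case by (simp only: of_nat_0 diff_0 mult_0_right add_0)
  next
    case (Suc k)
    have "head (padded (ls @ rs) (int (Suc k) - 1)) = ls ! k"
      using Suc.prems by (simp add: head_def padded_def nth_append)
    moreover have "ls ! k \<noteq> 0" using Suc.prems assms(2) by (metis Suc_le_lessD nth_mem)
    ultimately have b: "reads (?S (int (Suc k) - 1)) j \<noteq> 0" using assms(3) by simp
    have step: "exec (left j) (?S (int (Suc k) - 1)) 1 (?S (int k - 1))"
      by (rule exec_Act') (use assms(3) act_padded[of "ls @ rs" "int k" "-1"] in simp)
    show ?case
      by (rule exec_weaken[OF exec_Loop_step[where b = "\<lambda>r. r j \<noteq> 0", OF b step Suc.IH]])
        (use Suc.prems in auto)
  qed
  have "\<sigma> j = padded (ls @ rs) (int (length ls))" using assms(1) by (simp add: zt_def)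
  then have 1: "exec (left j) \<sigma> 1 (?S (int (length ls) - 1))"
    by (intro exec_Act') (use assms(3) act_padded[of "ls @ rs" "int (length ls)" "-1"] in simp)
  have 3: "exec (right j) (?S (-1)) 1 (\<sigma>(j := zt [] (ls @ rs)))"
    by (rule exec_Act') (use assms(3) act_padded[of "ls @ rs" "-1" 1] in \<open>simp add: zt_def\<close>)
  show ?thesis unfolding rewind_def
    by (rule exec_Seq'[OF 1 exec_Seq[OF loop[OF order_refl] 3]]) (use assms(4) in simp)
qed

section \<open>Binary counters\<close>

fun bval :: "bool list \<Rightarrow> nat" where
  "bval [] = 0"
| "bval (b # bs) = of_bool b + 2 * bval bs"

lemma bval_bits [simp]: "bval (bits n) = n"
proof (induction n rule: bits.induct)
  case (1 n)
  then show ?case by (subst bits.simps) auto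
qed

lemma length_bits_le: "length (bits n) \<le> n"
proof (induction n rule: bits.induct)
  case (1 n)
  then show ?case by (subst bits.simps) (auto simp: Suc_le_eq)
qed

lemma bits_simps [simp]: "bits 0 = []" "bits (Suc 0) = [True]"
  by (simp_all add: bits.simps)

text \<open>The carry in the form in which the machine performs it: the initial ones become zeros
  and the next digit becomes one. \<open>tl rest\<close> covers both a zero that is overwritten and
  a new digit written on a blank.\<close>

lemma bits_Suc:
  "\<exists>k rest. bits n = replicate k True @ rest \<and> (rest = [] \<or> hd rest = False) \<and>
     bits (Suc n) = replicate k False @ True # tl rest"
proof (induction n rule: bits.induct)
  case (1 n)
  show ?case
  proof (cases "even n")
    case True
    then show ?thesis
      by (intro exI[of _ 0] exI[of _ "bits n"])
        (auto simp: bits.simps[of n] bits.simps[of "Suc n"])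
  next
    case False
    then have "n \<noteq> 0" by (metis even_zero)
    with 1 obtain k rest where *: "bits (n div 2) = replicate k True @ rest"
      "rest = [] \<or> hd rest = False" "bits (Suc (n div 2)) = replicate k False @ True # tl rest"
      by blast
    have "Suc n div 2 = Suc (n div 2)" using False by (auto elim: oddE)
    then have "bits (Suc n) = False # bits (Suc (n div 2))" "bits n = True # bits (n div 2)"
      using False \<open>n \<noteq> 0\<close> by (auto simp: bits.simps[of n] bits.simps[of "Suc n"])
    then show ?thesis using * by (intro exI[of _ "Suc k"] exI[of _ rest]) auto
  qed
qed

lemma exec_replace:
  assumes "\<sigma> j = zt ls (replicate k a @ rs)" "a \<noteq> 0" "rs = [] \<or> hd rs \<noteq> a" "j < tape_count"
    "2 * k + 1 \<le> T"
  shows "exec (Loop (\<lambda>r. r j = a) (put j b)) \<sigma> T (\<sigma>(j := zt (ls @ replicate k b) rs))"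
proof (rule exec_foreach'[where xs = "replicate k a" and B = 1
      and S = "\<lambda>ys zs. \<sigma>(j := zt (ls @ replicate (length ys) b) (zs @ rs))"])
  fix ys x zs assume xs: "replicate k a = ys @ x # zs"
  then have "x \<in> set (replicate k a)" by simp
  then have x: "x = a" by simp
  then show "reads (\<sigma>(j := zt (ls @ replicate (length ys) b) ((x # zs) @ rs))) j = a"
    using assms(4) by simp
  show "exec (put j b) (\<sigma>(j := zt (ls @ replicate (length ys) b) ((x # zs) @ rs))) 1
    (\<sigma>(j := zt (ls @ replicate (length (ys @ [x])) b) (zs @ rs)))"
    by (rule exec_Act') (simp add: replicate_append_same)
next
  show "reads (\<sigma>(j := zt (ls @ replicate (length (replicate k a)) b) ([] @ rs))) j \<noteq> a"
    using assms by (cases rs) auto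
qed (use assms in auto)

definition increment :: com where
  "increment = Loop (\<lambda>r. r 4 = 2) (put 4 1) ;; Act (\<lambda>r. [4 \<mapsto> (2, 0)]) ;; rewind 4"

lemma exec_increment:
  assumes "\<sigma> 4 = zt [] (map bsym (bits m))" "4 * m + 12 \<le> T"
  shows "exec increment \<sigma> T (\<sigma>(4 := zt [] (map bsym (bits (Suc m)))))"
proof -
  obtain k rest where *: "bits m = replicate k True @ rest" "rest = [] \<or> hd rest = False"
    "bits (Suc m) = replicate k False @ True # tl rest"
    using bits_Suc by blast
  have k: "k \<le> m" using length_bits_le[of m] *(1) by simp
  have 1: "exec (Loop (\<lambda>r. r 4 = 2) (put 4 1)) \<sigma> (2 * k + 1)
      (\<sigma>(4 := zt ([] @ replicate k 1) (map bsym rest)))"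
    by (rule exec_replace) (use assms * in \<open>auto simp: hd_map\<close>)
  let ?\<sigma>2 = "\<sigma>(4 := zt (replicate k 1) (2 # map bsym (tl rest)))"
  have 2: "exec (Act (\<lambda>r. [4 \<mapsto> (2, 0)])) (\<sigma>(4 := zt ([] @ replicate k 1) (map bsym rest))) 1 ?\<sigma>2"
    by (rule exec_Act') (cases rest, auto)
  have "exec (rewind 4) ?\<sigma>2 (2 * k + 6) (?\<sigma>2(4 := zt [] (replicate k 1 @ 2 # map bsym (tl rest))))"
    by (rule exec_rewind) auto
  then have 3: "exec (rewind 4) ?\<sigma>2 (2 * k + 6) (\<sigma>(4 := zt [] (map bsym (bits (Suc m)))))"
    by (simp add: *)
  show ?thesis unfolding increment_def
    by (rule exec_Seq'[OF 1 exec_Seq[OF 2 3]]) (use assms(2) k in simp)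
qed

text \<open>Decrement at fixed width, stopping at 0. It can leave leading zeros, so the results are
  described by \<open>bval\<close> and not by \<open>bits\<close>.\<close>

fun pred_bits :: "bool list \<Rightarrow> bool list" where
  "pred_bits [] = []"
| "pred_bits (b # bs) =
    (if b then False # bs else if bval bs = 0 then b # bs else True # pred_bits bs)"

lemma length_pred_bits [simp]: "length (pred_bits bs) = length bs"
  by (induction bs) auto

lemma bval_pred_bits [simp]: "bval (pred_bits bs) = bval bs - 1"
  by (induction bs) auto

lemma bval_zero: "bval bs = 0 \<Longrightarrow> pred_bits bs = bs \<and> bs = replicate (length bs) False"
  by (induction bs) (auto simp: of_bool_def split: if_splits)

text \<open>The borrow: the initial zeros become ones and the first one becomes zero.\<close>

lemma bval_pos:
  "bval bs > 0 \<Longrightarrow> \<exists>k rest. bs = replicate k False @ True # rest \<and>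
     pred_bits bs = replicate k True @ False # rest"
proof (induction bs)
  case (Cons b bs)
  show ?case
  proof (cases b)
    case True
    then show ?thesis by (intro exI[of _ 0]) auto
  next
    case False
    then obtain k rest where "bs = replicate k False @ True # rest"
      "pred_bits bs = replicate k True @ False # rest"
      using Cons by auto
    then show ?thesis using False Cons.prems by (intro exI[of _ "Suc k"] exI[of _ rest]) auto
  qed
qed auto

section \<open>The program\<close>

text \<open>
  Tapes: 0 input, 1 oracle, 2 output, 3 the degree bound \<open>D\<close> in unary, 4 \<open>D\<close> in binary, 5 and 6 the
  vertex kinds for the rows and the columns, 7 the remaining budget in binary, 8 the kinds of the
  original vertices, 9 the input weights, each followed by the separator 3.
\<close>

definition transfers :: "nat set \<Rightarrow> com \<Rightarrow> nat \<Rightarrow> nat list \<Rightarrow> nat list \<Rightarrow> bool" where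
  "transfers D c T w v \<longleftrightarrow> (\<forall>\<sigma> ls rs out. \<sigma> 0 = zt ls (w @ rs) \<longrightarrow> (\<forall>j\<in>D. \<sigma> j = zt (out j) []) \<longrightarrow>
     exec c \<sigma> T (\<lambda>j. if j = 0 then zt (ls @ w) rs else if j \<in> D then zt (out j @ v) [] else \<sigma> j))"

lemma transfersD:
  assumes "transfers D c T w v" "\<sigma> 0 = zt ls (w @ rs)" "\<And>j. j \<in> D \<Longrightarrow> \<sigma> j = zt (out j) []"
  shows "exec c \<sigma> T (\<lambda>j. if j = 0 then zt (ls @ w) rs else if j \<in> D then zt (out j @ v) [] else \<sigma> j)"
  using assms unfolding transfers_def by blast

lemma transfers_weaken: "transfers D c T w v \<Longrightarrow> T \<le> T' \<Longrightarrow> transfers D c T' w v"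
  unfolding transfers_def using exec_weaken by blast

text \<open>\<open>transfers\<close> fixes neither the input around the word nor the earlier output.
  Parsers therefore compose by concatenation, following the grammar of the encoding.\<close>

lemma transfers_Seq:
  assumes "transfers D c T1 w1 v1" "transfers D d T2 w2 v2" "0 \<notin> D"
  shows "transfers D (c ;; d) (Suc (T1 + T2)) (w1 @ w2) (v1 @ v2)"
  unfolding transfers_def
proof (intro allI impI)
  fix \<sigma> :: store and ls rs :: "nat list" and out assume *: "\<sigma> 0 = zt ls ((w1 @ w2) @ rs)" "\<forall>j\<in>D. \<sigma> j = zt (out j) []"
  let ?\<sigma>1 = "\<lambda>j. if j = 0 then zt (ls @ w1) (w2 @ rs) else if j \<in> D then zt (out j @ v1) [] else \<sigma> j"
  have 1: "exec c \<sigma> T1 ?\<sigma>1" by (rule transfersD[OF assms(1)]) (use * in auto)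
  have 2: "exec d ?\<sigma>1 T2 (\<lambda>j. if j = 0 then zt ((ls @ w1) @ w2) rs
      else if j \<in> D then zt ((out j @ v1) @ v2) [] else ?\<sigma>1 j)"
    by (rule transfersD[OF assms(2)]) (use assms(3) in auto)
  have eq: "(\<lambda>j. if j = 0 then zt ((ls @ w1) @ w2) rs
      else if j \<in> D then zt ((out j @ v1) @ v2) [] else ?\<sigma>1 j) =
    (\<lambda>j. if j = 0 then zt (ls @ w1 @ w2) rs else if j \<in> D then zt (out j @ v1 @ v2) [] else \<sigma> j)"
    by (auto simp: fun_eq_iff)
  show "exec (c ;; d) \<sigma> (Suc (T1 + T2))
    (\<lambda>j. if j = 0 then zt (ls @ w1 @ w2) rs else if j \<in> D then zt (out j @ v1 @ v2) [] else \<sigma> j)"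
    using exec_Seq[OF 1 2] unfolding eq .
qed

definition emit :: "nat set \<Rightarrow> com" where
  "emit D = Act (\<lambda>r j. if j = 0 \<or> j \<in> D then Some (r 0, 1) else None)"

definition emit_separator :: "nat set \<Rightarrow> com" where
  "emit_separator D = Act (\<lambda>r j. if j \<in> D then Some (3, 1) else None)"

lemma transfers_emit: "transfers D (emit D) 1 [a] [a]"
  unfolding transfers_def emit_def
  by (intro allI impI exec_Act') (auto simp: apply_acts_def fun_eq_iff)

lemma transfers_skip: "0 \<notin> D \<Longrightarrow> transfers D (right 0) 1 [a] []"
  unfolding transfers_def
  by (intro allI impI exec_Act') (auto simp: apply_acts_def fun_eq_iff)

lemma transfers_separator: "0 \<notin> D \<Longrightarrow> transfers D (emit_separator D) 1 [] [3]"
  unfolding transfers_def emit_separator_def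
  by (intro allI impI exec_Act') (auto simp: apply_acts_def fun_eq_iff)

text \<open>The continuation bit is the loop test. The body \<open>c\<close> consumes it together
  with the element, and \<open>d\<close> consumes the closing bit.\<close>

lemma transfers_enc_list:
  assumes "\<And>x. x \<in> set xs \<Longrightarrow> transfers D c B (map bsym (True # f x)) (g x)"
    and "transfers D d 1 [1] v" "0 \<notin> D"
  shows "transfers D (Loop (\<lambda>r. r 0 = 2) c ;; d) (length xs * Suc B + 3)
    (map bsym (enc_list f xs)) (concat (map g xs) @ v)"
  unfolding transfers_def
proof (intro allI impI)
  fix \<sigma> :: store and ls rs :: "nat list" and out
  assume *: "\<sigma> 0 = zt ls (map bsym (enc_list f xs) @ rs)" "\<forall>j\<in>D. \<sigma> j = zt (out j) []"
  let ?w = "\<lambda>xs. concat (map (\<lambda>x. map bsym (True # f x)) xs)"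
  have w: "map bsym (enc_list f xs) = ?w xs @ [1]"
    by (induction xs) (auto simp: enc_list_def)
  define S where "S = (\<lambda>ys zs j. if j = 0 then zt (ls @ ?w ys) (?w zs @ 1 # rs)
    else if j \<in> D then zt (out j @ concat (map g ys)) [] else \<sigma> j)"
  have 1: "exec (Loop (\<lambda>r. r 0 = 2) c) \<sigma> (length xs * Suc B + 1) (S xs [])"
  proof (rule exec_foreach'[where S = S and xs = xs and B = B])
    fix ys a zs assume xs: "xs = ys @ a # zs"
    show "reads (S ys (a # zs)) 0 = 2" by (simp add: S_def)
    have "exec c (S ys (a # zs)) B (\<lambda>j. if j = 0 then zt ((ls @ ?w ys) @ map bsym (True # f a)) (?w zs @ 1 # rs)
        else if j \<in> D then zt ((out j @ concat (map g ys)) @ g a) [] else S ys (a # zs) j)"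
      by (rule transfersD[OF assms(1)]) (use assms(3) xs in \<open>auto simp: S_def\<close>)
    also have "\<dots> = S (ys @ [a]) zs"
      by (auto simp: S_def fun_eq_iff)
    finally show "exec c (S ys (a # zs)) B (S (ys @ [a]) zs)" .
  next
    show "\<sigma> = S [] xs" using * w by (auto simp: S_def fun_eq_iff)
  qed (simp_all add: S_def)
  have "exec d (S xs []) 1 (\<lambda>j. if j = 0 then zt ((ls @ ?w xs) @ [1]) rs
        else if j \<in> D then zt ((out j @ concat (map g xs)) @ v) [] else S xs [] j)"
    by (rule transfersD[OF assms(2)]) (use assms(3) in \<open>auto simp: S_def\<close>)
  also have "\<dots> = (\<lambda>j. if j = 0 then zt (ls @ map bsym (enc_list f xs)) rs
        else if j \<in> D then zt (out j @ concat (map g xs) @ v) [] else \<sigma> j)"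
    by (auto simp: S_def fun_eq_iff w)
  finally show "exec (Loop (\<lambda>r. r 0 = 2) c ;; d) \<sigma> (length xs * Suc B + 3)
      (\<lambda>j. if j = 0 then zt (ls @ map bsym (enc_list f xs)) rs
        else if j \<in> D then zt (out j @ concat (map g xs) @ v) [] else \<sigma> j)"
    by (rule exec_Seq'[OF 1]) simp
qed

lemma concat_map_singleton: "concat (map (\<lambda>x. [h x]) xs) = map h xs"
  by (induction xs) auto

definition scan_bits :: "nat set \<Rightarrow> com" where
  "scan_bits D = Loop (\<lambda>r. r 0 = 2) (right 0 ;; emit D) ;; right 0"

lemma transfers_scan_bits:
  assumes "0 \<notin> D"
  shows "transfers D (scan_bits D) (length xs * 4 + 3) (map bsym (enc_list (\<lambda>x. [h x]) xs))
    (map (\<lambda>x. bsym (h x)) xs)"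
proof -
  have "transfers D (scan_bits D) (length xs * Suc 3 + 3) (map bsym (enc_list (\<lambda>x. [h x]) xs))
    (concat (map (\<lambda>x. [bsym (h x)]) xs) @ [])"
    unfolding scan_bits_def
    by (rule transfers_enc_list)
      (use transfers_Seq[OF transfers_skip transfers_emit, of D] transfers_skip assms
        in \<open>auto simp: numeral_3_eq_3\<close>)
  then show ?thesis by (simp add: concat_map_singleton)
qed

text \<open>The continuation bits are copied along, so that the copy is again an encoding and can
  later be output verbatim.\<close>

definition copy_nat :: com where
  "copy_nat = Loop (\<lambda>r. r 0 = 2) (emit {9} ;; emit {9}) ;; emit {9}"

definition copy_value :: com where
  "copy_value = Cond (\<lambda>r. r 0 = 2) (emit {9} ;; copy_nat ;; copy_nat) (emit {9})"

text \<open>The continuation bits of the rows and of the matrix are dropped. The separator is not a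
  bit symbol, so that an entry can later be copied without parsing it.\<close>

definition copy_matrix :: com where
  "copy_matrix = Loop (\<lambda>r. r 0 = 2)
     (right 0 ;; Loop (\<lambda>r. r 0 = 2) (right 0 ;; copy_value ;; emit_separator {9}) ;; right 0) ;;
   right 0"

lemma transfers_copy_nat:
  "transfers {9} copy_nat (2 * length (enc_nat m) + 1) (map bsym (enc_nat m)) (map bsym (enc_nat m))"
proof -
  have "transfers {9} copy_nat (length (bits m) * Suc 3 + 3) (map bsym (enc_nat m))
    (concat (map (\<lambda>b. [2, bsym b]) (bits m)) @ [1])"
    unfolding copy_nat_def enc_nat_def
    by (rule transfers_enc_list)
      (use transfers_Seq[OF transfers_emit transfers_emit, of "{9}"] transfers_emit[of "{9}"]
        in \<open>auto simp: numeral_3_eq_3\<close>)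
  also have "concat (map (\<lambda>b. [2, bsym b]) (bits m)) @ [1] = map bsym (enc_nat m)"
    by (simp add: enc_nat_def enc_list_def map_concat comp_def)
  \<comment> \<open>Four steps per digit are two per symbol, since every digit occupies two
    symbols.\<close>
  finally show ?thesis
    by (rule transfers_weaken)
      (simp add: enc_nat_def enc_list_def length_concat comp_def sum_list_triv)
qed

lemma transfers_copy_value:
  "transfers {9} copy_value (2 * length (enc_value v) + 10) (map bsym (enc_value v))
    (map bsym (enc_value v))"
proof (cases v)
  case None
  show ?thesis unfolding transfers_def
  proof (intro allI impI)
    fix \<sigma> :: store and ls rs :: "nat list" and out assume *: "\<sigma> 0 = zt ls (map bsym (enc_value v) @ rs)" "\<forall>j\<in>{9}. \<sigma> j = zt (out j) []"
    have "exec (emit {9}) \<sigma> 1 (\<lambda>j. if j = 0 then zt (ls @ [1]) rs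
      else if j \<in> {9} then zt (out j @ [1]) [] else \<sigma> j)"
      by (rule transfersD[OF transfers_emit]) (use * None in \<open>auto simp: enc_value_def\<close>)
    moreover have "reads \<sigma> 0 \<noteq> 2" using * None by (simp add: enc_value_def)
    ultimately show "exec copy_value \<sigma> (2 * length (enc_value v) + 10)
        (\<lambda>j. if j = 0 then zt (ls @ map bsym (enc_value v)) rs
          else if j \<in> {9} then zt (out j @ map bsym (enc_value v)) [] else \<sigma> j)"
      unfolding copy_value_def
      by (intro exec_weaken[OF exec_Cond[where T = 1]])
        (simp_all add: None enc_value_def cong del: if_weak_cong)
  qed
next
  case (Some q)
  let ?a = "enc_nat (nat (fst (quotient_of q)))" and ?b = "enc_nat (nat (snd (quotient_of q)))"
  have v: "enc_value v = True # ?a @ ?b" by (simp add: Some enc_value_def)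
  let ?T = "Suc (1 + Suc ((2 * length ?a + 1) + (2 * length ?b + 1)))"
  have t: "transfers {9} (emit {9} ;; copy_nat ;; copy_nat) ?T
    ([2] @ map bsym ?a @ map bsym ?b) ([2] @ map bsym ?a @ map bsym ?b)"
    by (intro transfers_Seq transfers_emit transfers_copy_nat) auto
  show ?thesis unfolding transfers_def
  proof (intro allI impI)
    fix \<sigma> :: store and ls rs :: "nat list" and out assume *: "\<sigma> 0 = zt ls (map bsym (enc_value v) @ rs)" "\<forall>j\<in>{9}. \<sigma> j = zt (out j) []"
    have "exec (emit {9} ;; copy_nat ;; copy_nat) \<sigma> ?T
      (\<lambda>j. if j = 0 then zt (ls @ [2] @ map bsym ?a @ map bsym ?b) rs
        else if j \<in> {9} then zt (out j @ [2] @ map bsym ?a @ map bsym ?b) [] else \<sigma> j)"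
      by (rule transfersD[OF t]) (use * v in auto)
    moreover have "reads \<sigma> 0 = 2" using * v by simp
    ultimately show "exec copy_value \<sigma> (2 * length (enc_value v) + 10)
        (\<lambda>j. if j = 0 then zt (ls @ map bsym (enc_value v)) rs
          else if j \<in> {9} then zt (out j @ map bsym (enc_value v)) [] else \<sigma> j)"
      unfolding copy_value_def
      by (intro exec_weaken[OF exec_Cond[where T = ?T]]) (simp_all add: v cong del: if_weak_cong)
  qed
qed

lemma transfers_copy_matrix:
  assumes "\<And>i j. i \<in> set is \<Longrightarrow> j \<in> set js \<Longrightarrow> length (enc_value (e i j)) \<le> L"
  shows "transfers {9} copy_matrix (length is * (length js * (2 * L + 16) + 6) + 3)
    (map bsym (enc_list (\<lambda>i. enc_list (\<lambda>j. enc_value (e i j)) js) is))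
    (concat (map (\<lambda>i. concat (map (\<lambda>j. map bsym (enc_value (e i j)) @ [3]) js)) is))"
proof -
  have entry: "transfers {9} (right 0 ;; copy_value ;; emit_separator {9}) (2 * L + 15)
    (map bsym (True # enc_value (e i j))) (map bsym (enc_value (e i j)) @ [3])"
    if "i \<in> set is" "j \<in> set js" for i j
  proof -
    have "transfers {9} (right 0 ;; copy_value ;; emit_separator {9})
      (Suc (1 + Suc ((2 * length (enc_value (e i j)) + 10) + 1)))
      ([2] @ map bsym (enc_value (e i j)) @ []) ([] @ map bsym (enc_value (e i j)) @ [3])"
      by (intro transfers_Seq transfers_skip transfers_copy_value transfers_separator) auto
    from transfers_weaken[OF this, of "2 * L + 15"] show ?thesis using assms[OF that] by simp
  qed
  let ?row = "\<lambda>i. concat (map (\<lambda>j. map bsym (enc_value (e i j)) @ [3]) js)"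
  let ?inner = "Loop (\<lambda>r. r 0 = 2) (right 0 ;; copy_value ;; emit_separator {9}) ;; right 0"
  have row: "transfers {9} (right 0 ;; ?inner) (length js * (2 * L + 16) + 5)
    (map bsym (True # enc_list (\<lambda>j. enc_value (e i j)) js)) (?row i)"
    if "i \<in> set is" for i
  proof -
    have 1: "transfers {9} ?inner (length js * Suc (2 * L + 15) + 3)
       (map bsym (enc_list (\<lambda>j. enc_value (e i j)) js)) (?row i @ [])"
      by (rule transfers_enc_list[OF _ transfers_skip]) (use entry[OF that] in auto)
    have "transfers {9} (right 0 ;; ?inner) (Suc (1 + (length js * Suc (2 * L + 15) + 3)))
      ([2] @ map bsym (enc_list (\<lambda>j. enc_value (e i j)) js)) ([] @ ?row i @ [])"
      by (rule transfers_Seq[OF transfers_skip 1]) auto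
    from transfers_weaken[OF this, of "length js * (2 * L + 16) + 5"] show ?thesis by simp
  qed
  have "transfers {9} copy_matrix (length is * Suc (length js * (2 * L + 16) + 5) + 3)
    (map bsym (enc_list (\<lambda>i. enc_list (\<lambda>j. enc_value (e i j)) js) is)) (concat (map ?row is) @ [])"
    unfolding copy_matrix_def
    by (rule transfers_enc_list[OF _ transfers_skip]) (use row in auto)
  also have "concat (map ?row is) @ [] = concat (map ?row is)" by simp
  finally show ?thesis by (rule transfers_weaken) simp
qed

section \<open>Computing the degree bound and the vertex kinds\<close>

definition measure_input :: com where
  "measure_input = Loop (\<lambda>r. r 0 \<noteq> 0) (Act (\<lambda>r. [0 \<mapsto> (r 0, 1), 3 \<mapsto> (1, 1)]) ;; increment) ;;
     rewind 0 ;; rewind 3"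

text \<open>The unary copy drives the loops that append D equal kinds; the binary one is printed as
  the parameter of the query.\<close>

lemma exec_measure_input:
  assumes "\<sigma> 0 = zt [] (map bsym x)" "\<sigma> 3 = zt [] []" "\<sigma> 4 = zt [] []"
    "length x * (4 * length x + 20) + 20 \<le> T"
  shows "exec measure_input \<sigma> T
    (\<sigma>(3 := zt [] (replicate (length x) 1), 4 := zt [] (map bsym (bits (length x)))))"
proof -
  define S where "S = (\<lambda>ys zs. \<sigma>(0 := zt (map bsym ys) (map bsym zs),
    3 := zt (replicate (length ys) 1) [], 4 := zt [] (map bsym (bits (length ys)))))"
  let ?n = "length x"
  have 1: "exec (Loop (\<lambda>r. r 0 \<noteq> 0) (Act (\<lambda>r. [0 \<mapsto> (r 0, 1), 3 \<mapsto> (1, 1)]) ;; increment)) \<sigma>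
    (?n * Suc (4 * ?n + 14) + 1) (S x [])"
  proof (rule exec_foreach'[where S = S and xs = x and B = "4 * ?n + 14"])
    fix ys a zs assume xs: "x = ys @ a # zs"
    show "reads (S ys (a # zs)) 0 \<noteq> 0" by (simp add: S_def)
    let ?\<sigma>1 = "\<sigma>(0 := zt (map bsym (ys @ [a])) (map bsym zs),
      3 := zt (replicate (Suc (length ys)) 1) [], 4 := zt [] (map bsym (bits (length ys))))"
    have "exec increment ?\<sigma>1 (4 * ?n + 12)
      (?\<sigma>1(4 := zt [] (map bsym (bits (Suc (length ys))))))"
      by (rule exec_increment) (use xs in auto)
    then have i: "exec increment ?\<sigma>1 (4 * ?n + 12) (S (ys @ [a]) zs)"
      by (simp add: S_def)
    show "exec (Act (\<lambda>r. [0 \<mapsto> (r 0, 1), 3 \<mapsto> (1, 1)]) ;; increment) (S ys (a # zs)) (4 * ?n + 14)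
        (S (ys @ [a]) zs)"
      by (rule exec_Act_Seq[OF _ i]) (auto simp: S_def fun_eq_iff replicate_append_same)
  qed (use assms in \<open>auto simp: S_def fun_eq_iff\<close>)
  have 2: "exec (rewind 0) (S x []) (2 * ?n + 6) ((S x [])(0 := zt [] (map bsym x @ [])))"
    by (rule exec_rewind) (auto simp: S_def)
  have 3: "exec (rewind 3) ((S x [])(0 := zt [] (map bsym x @ []))) (2 * ?n + 6)
     ((S x [])(0 := zt [] (map bsym x @ []), 3 := zt [] (replicate ?n 1 @ [])))"
    by (rule exec_rewind) (auto simp: S_def)
  have eq: "(S x [])(0 := zt [] (map bsym x @ []), 3 := zt [] (replicate ?n 1 @ [])) =
    \<sigma>(3 := zt [] (replicate (length x) 1), 4 := zt [] (map bsym (bits (length x))))"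
    using assms by (auto simp: S_def fun_eq_iff)
  show ?thesis unfolding measure_input_def
    by (rule exec_Seq'[OF 1 exec_Seq[OF 2 3[unfolded eq]]])
      (use assms(4) in \<open>simp add: algebra_simps\<close>)
qed

abbreviation skip :: com where
  "skip \<equiv> Act (\<lambda>r. Map.empty)"

lemma exec_skip: "exec skip \<sigma> 1 \<sigma>"
  by (rule exec_Act') simp

definition fill :: "nat \<Rightarrow> com" where
  "fill s = Loop (\<lambda>r. r 3 \<noteq> 0) (Act (\<lambda>r. [3 \<mapsto> (r 3, 1), 5 \<mapsto> (s, 1), 6 \<mapsto> (s, 1)])) ;; rewind 3"

lemma exec_fill:
  assumes "\<sigma> 3 = zt [] (replicate D 1)" "\<sigma> 5 = zt R []" "\<sigma> 6 = zt R []" "4 * D + 8 \<le> T"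
  shows "exec (fill s) \<sigma> T
    (\<sigma>(5 := zt (R @ replicate D s) [], 6 := zt (R @ replicate D s) []))"
proof -
  define S where "S = (\<lambda>ys zs. \<sigma>(3 := zt ys zs, 5 := zt (R @ replicate (length ys) s) [],
    6 := zt (R @ replicate (length ys) s) []))"
  let ?u = "replicate D (1::nat)"
  have 1: "exec (Loop (\<lambda>r. r 3 \<noteq> 0) (Act (\<lambda>r. [3 \<mapsto> (r 3, 1), 5 \<mapsto> (s, 1), 6 \<mapsto> (s, 1)]))) \<sigma>
    (D * 2 + 1) (S ?u [])"
  proof (rule exec_foreach'[where S = S and xs = ?u and B = 1])
    fix ys a zs assume "?u = ys @ a # zs"
    then have "a \<in> set ?u" by simp
    then have a: "a = 1" by simp
    then show "reads (S ys (a # zs)) 3 \<noteq> 0" by (simp add: S_def)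
    show "exec (Act (\<lambda>r. [3 \<mapsto> (r 3, 1), 5 \<mapsto> (s, 1), 6 \<mapsto> (s, 1)])) (S ys (a # zs)) 1
        (S (ys @ [a]) zs)"
      by (rule exec_Act') (auto simp: S_def fun_eq_iff replicate_append_same)
  qed (use assms in \<open>auto simp: S_def fun_eq_iff\<close>)
  have 2: "exec (rewind 3) (S ?u []) (2 * D + 6) ((S ?u [])(3 := zt [] (?u @ [])))"
    by (rule exec_rewind) (auto simp: S_def)
  have eq: "(S ?u [])(3 := zt [] (?u @ [])) =
     \<sigma>(5 := zt (R @ replicate D s) [], 6 := zt (R @ replicate D s) [])"
    using assms by (auto simp: S_def fun_eq_iff)
  show ?thesis unfolding fill_def
    by (rule exec_Seq'[OF 1 2[unfolded eq]]) (use assms(4) in simp)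
qed

text \<open>A decrement combined with a zero test. The head passes the low zeros; on meeting a one
  it goes back, performs the borrow and grants D leaves, and on meeting the blank it knows that the
  counter is 0 and grants none.\<close>

definition spend :: "nat \<Rightarrow> com" where
  "spend s = Loop (\<lambda>r. r 7 = 1) (put 7 1) ;;
     Cond (\<lambda>r. r 7 = 2)
       (rewind 7 ;; Loop (\<lambda>r. r 7 = 1) (put 7 2) ;; Act (\<lambda>r. [7 \<mapsto> (1, 0)]) ;; fill s) skip ;;
     rewind 7"

lemma exec_spend:
  assumes "\<sigma> 3 = zt [] (replicate D 1)" "\<sigma> 5 = zt R []" "\<sigma> 6 = zt R []"
    "\<sigma> 7 = zt [] (map bsym bs)" "8 * length bs + 4 * D + 40 \<le> T"
  shows "exec (spend s) \<sigma> T
    (\<sigma>(5 := zt (R @ replicate (if bval bs = 0 then 0 else D) s) [],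
       6 := zt (R @ replicate (if bval bs = 0 then 0 else D) s) [],
       7 := zt [] (map bsym (pred_bits bs))))"
proof (cases "bval bs = 0")
  case True
  let ?n = "length bs"
  note bs = bval_zero[OF True]
  have b: "map bsym bs = replicate ?n 1" using bs by (metis bsym_simps(2) map_replicate)
  let ?\<sigma>1 = "\<sigma>(7 := zt ([] @ replicate ?n 1) [])"
  have 1: "exec (Loop (\<lambda>r. r 7 = 1) (put 7 1)) \<sigma> (2 * ?n + 1) ?\<sigma>1"
    by (rule exec_replace) (use assms(4) b in auto)
  have 2: "exec (Cond (\<lambda>r. r 7 = 2)
     (rewind 7 ;; Loop (\<lambda>r. r 7 = 1) (put 7 2) ;; Act (\<lambda>r. [7 \<mapsto> (1, 0)]) ;; fill s) skip)
     ?\<sigma>1 (Suc 1) ?\<sigma>1"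
    by (rule exec_Cond) (auto simp: exec_skip[simplified])
  have 3: "exec (rewind 7) ?\<sigma>1 (2 * ?n + 6) (?\<sigma>1(7 := zt [] (replicate ?n 1 @ [])))"
    by (rule exec_rewind) auto
  have eq: "?\<sigma>1(7 := zt [] (replicate ?n 1 @ [])) = \<sigma>(5 := zt (R @ replicate (if bval bs = 0 then 0 else D) s) [],
       6 := zt (R @ replicate (if bval bs = 0 then 0 else D) s) [],
       7 := zt [] (map bsym (pred_bits bs)))"
    using assms True bs b by (auto simp: fun_eq_iff)
  show ?thesis unfolding spend_def
    by (rule exec_Seq'[OF 1 exec_Seq[OF 2 3[unfolded eq]]]) (use assms(5) in simp)
next
  case False
  then obtain k rest where bs: "bs = replicate k False @ True # rest"
    "pred_bits bs = replicate k True @ False # rest"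
    using bval_pos by blast
  let ?r = "map bsym rest"
  let ?R' = "zt (R @ replicate D s) []"
  let ?fillc = "rewind 7 ;; Loop (\<lambda>r. r 7 = 1) (put 7 2) ;; Act (\<lambda>r. [7 \<mapsto> (1, 0)]) ;; fill s"
  have 1: "exec (Loop (\<lambda>r. r 7 = 1) (put 7 1)) \<sigma> (2 * k + 1) (\<sigma>(7 := zt ([] @ replicate k 1) (2 # ?r)))"
    by (rule exec_replace) (use assms(4) bs in auto)
  have 2: "exec (rewind 7) (\<sigma>(7 := zt ([] @ replicate k 1) (2 # ?r))) (2 * k + 6)
    (\<sigma>(7 := zt ([] @ replicate k 1) (2 # ?r), 7 := zt [] (replicate k 1 @ 2 # ?r)))"
    by (rule exec_rewind) auto
  have 3: "exec (Loop (\<lambda>r. r 7 = 1) (put 7 2)) (\<sigma>(7 := zt ([] @ replicate k 1) (2 # ?r), 7 := zt [] (replicate k 1 @ 2 # ?r)))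
    (2 * k + 1) (\<sigma>(7 := zt ([] @ replicate k 1) (2 # ?r), 7 := zt [] (replicate k 1 @ 2 # ?r), 7 := zt ([] @ replicate k 2) (2 # ?r)))"
    by (rule exec_replace) auto
  have 4: "exec (Act (\<lambda>r. [7 \<mapsto> (1, 0)])) (\<sigma>(7 := zt ([] @ replicate k 1) (2 # ?r), 7 := zt [] (replicate k 1 @ 2 # ?r), 7 := zt ([] @ replicate k 2) (2 # ?r)))
     1 (\<sigma>(7 := zt (replicate k 2) (1 # ?r)))"
    by (rule exec_Act') auto
  have 5: "exec (fill s) (\<sigma>(7 := zt (replicate k 2) (1 # ?r))) (4 * D + 8)
    (\<sigma>(7 := zt (replicate k 2) (1 # ?r), 5 := ?R', 6 := ?R'))"
    by (rule exec_fill) (use assms in auto)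
  note 25 = exec_Seq[OF 2 exec_Seq[OF 3 exec_Seq[OF 4 5]]]
  have 6: "exec (Cond (\<lambda>r. r 7 = 2) ?fillc skip) (\<sigma>(7 := zt ([] @ replicate k 1) (2 # ?r)))
      (Suc (Suc (2 * k + 6 + Suc (2 * k + 1 + Suc (1 + (4 * D + 8))))))
     (\<sigma>(7 := zt (replicate k 2) (1 # ?r), 5 := ?R', 6 := ?R'))"
    by (rule exec_Cond) (use 25 in auto)
  have 7: "exec (rewind 7) (\<sigma>(7 := zt (replicate k 2) (1 # ?r), 5 := ?R', 6 := ?R')) (2 * k + 6)
     (\<sigma>(7 := zt (replicate k 2) (1 # ?r), 5 := ?R', 6 := ?R', 7 := zt [] (replicate k 2 @ 1 # ?r)))"
    by (rule exec_rewind) auto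
  have eq: "\<sigma>(7 := zt (replicate k 2) (1 # ?r), 5 := ?R', 6 := ?R', 7 := zt [] (replicate k 2 @ 1 # ?r)) =
    \<sigma>(5 := zt (R @ replicate (if bval bs = 0 then 0 else D) s) [],
       6 := zt (R @ replicate (if bval bs = 0 then 0 else D) s) [],
       7 := zt [] (map bsym (pred_bits bs)))"
    using False bs(2) by (auto simp: fun_eq_iff)
  show ?thesis unfolding spend_def
    by (rule exec_Seq'[OF 1 exec_Seq[OF 6 7[unfolded eq]]]) (use assms(5) bs(1) in simp)
qed

text \<open>Every vertex of kind \<open>a\<close> buys D leaves of kind \<open>s\<close> while the
  counter lasts. Starting from \<zeta> and run first for the terminals and then for the
  non-terminals, this realises the budget without subtraction or comparison of numbers: \<zeta>
  \<ge> |T| serves all terminals, and the rest serves min (n - |T|) (\<zeta> - |T|) non-terminals.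
  The number of rounds depends on n and not on \<zeta>.\<close>

definition allot :: "nat \<Rightarrow> nat \<Rightarrow> com" where
  "allot a s = rewind 8 ;; Loop (\<lambda>r. r 8 \<noteq> 0) (Cond (\<lambda>r. r 8 = a) (spend s) skip ;; right 8)"

lemma bval_funpow_pred_bits [simp]: "bval ((pred_bits ^^ k) bs) = bval bs - k"
  by (induction k) auto

lemma length_funpow_pred_bits [simp]: "length ((pred_bits ^^ k) bs) = length bs"
  by (induction k) auto

lemma exec_allot:
  assumes "\<sigma> 3 = zt [] (replicate D 1)" "\<sigma> 5 = zt R []" "\<sigma> 6 = zt R []"
    "\<sigma> 7 = zt [] (map bsym bs)" "\<sigma> 8 = zt ts []" "0 \<notin> set ts"
    "length ts * (8 * length bs + 4 * D + 50) + 10 \<le> T"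
  shows "exec (allot a s) \<sigma> T
    (\<sigma>(5 := zt (R @ replicate (min (count_list ts a) (bval bs) * D) s) [],
       6 := zt (R @ replicate (min (count_list ts a) (bval bs) * D) s) [],
       7 := zt [] (map bsym ((pred_bits ^^ count_list ts a) bs))))"
proof -
  let ?R = "\<lambda>c. zt (R @ replicate (min c (bval bs) * D) s) []"
  let ?Z = "\<lambda>c. zt [] (map bsym ((pred_bits ^^ c) bs))"
  define S where "S = (\<lambda>ys zs. \<sigma>(5 := ?R (count_list ys a), 6 := ?R (count_list ys a),
    7 := ?Z (count_list ys a), 8 := zt ys zs))"
  let ?B = "8 * length bs + 4 * D + 43"
  have 1: "exec (rewind 8) \<sigma> (2 * length ts + 6) (\<sigma>(8 := zt [] (ts @ [])))"
    by (rule exec_rewind) (use assms in auto)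
  have 2: "exec (Loop (\<lambda>r. r 8 \<noteq> 0) (Cond (\<lambda>r. r 8 = a) (spend s) skip ;; right 8))
     (\<sigma>(8 := zt [] (ts @ []))) (length ts * Suc ?B + 1) (S ts [])"
  proof (rule exec_foreach'[where S = S and xs = ts and B = ?B])
    fix ys t zs assume xs: "ts = ys @ t # zs"
    then show "reads (S ys (t # zs)) 8 \<noteq> 0" using assms(6) by (auto simp: S_def)
    let ?c = "count_list ys a"
    let ?\<sigma>1 = "(S (ys @ [t]) zs)(8 := zt ys (t # zs))"
    have "exec (Cond (\<lambda>r. r 8 = a) (spend s) skip) (S ys (t # zs)) (Suc (8 * length bs + 4 * D + 40)) ?\<sigma>1"
    proof (rule exec_Cond)
      assume "reads (S ys (t # zs)) 8 = a"
      then have t: "t = a" by (simp add: S_def)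
      let ?k = "if bval ((pred_bits ^^ ?c) bs) = 0 then 0 else D"
      let ?R1 = "zt ((R @ replicate (min ?c (bval bs) * D) s) @ replicate ?k s) []"
      have e: "exec (spend s) (S ys (t # zs)) (8 * length bs + 4 * D + 40)
       ((S ys (t # zs))(5 := ?R1, 6 := ?R1,
          7 := zt [] (map bsym (pred_bits ((pred_bits ^^ ?c) bs)))))"
        by (rule exec_spend) (use assms in \<open>auto simp: S_def\<close>)
      \<comment> \<open>The minimum saturates exactly when the counter has reached 0.\<close>
      have "replicate (min ?c (bval bs) * D) s @ replicate ?k s =
        replicate (min (Suc ?c) (bval bs) * D) s"
        by (auto simp: min_def replicate_add[symmetric] not_le)
      then have "(S ys (t # zs))(5 := ?R1, 6 := ?R1,
          7 := zt [] (map bsym (pred_bits ((pred_bits ^^ ?c) bs)))) = ?\<sigma>1"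
        using t by (auto simp: S_def fun_eq_iff)
      then show "exec (spend s) (S ys (t # zs)) (8 * length bs + 4 * D + 40) ?\<sigma>1"
        using e by simp
    next
      assume "reads (S ys (t # zs)) 8 \<noteq> a"
      then have "t \<noteq> a" by (simp add: S_def)
      then have "?\<sigma>1 = S ys (t # zs)" by (auto simp: S_def fun_eq_iff)
      then show "exec skip (S ys (t # zs)) (8 * length bs + 4 * D + 40) ?\<sigma>1"
        using exec_weaken[OF exec_skip[of "S ys (t # zs)"]] by simp
    qed
    then show "exec (Cond (\<lambda>r. r 8 = a) (spend s) skip ;; right 8) (S ys (t # zs)) ?B (S (ys @ [t]) zs)"
      by (rule exec_Seq'[OF _ exec_Act']) (auto simp: S_def fun_eq_iff)
  qed (use assms in \<open>auto simp: S_def fun_eq_iff\<close>)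
  have "S ts [] = \<sigma>(5 := ?R (count_list ts a), 6 := ?R (count_list ts a), 7 := ?Z (count_list ts a))"
    using assms by (auto simp: S_def fun_eq_iff)
  then show ?thesis unfolding allot_def
    using exec_Seq'[OF 1 2, of T] assms(7) by (simp add: algebra_simps)
qed

section \<open>Writing the query\<close>

definition write_terminals :: com where
  "write_terminals = rewind 5 ;;
     Loop (\<lambda>r. r 5 \<noteq> 0)
       (put 1 2 ;; Act (\<lambda>r. [1 \<mapsto> (if r 5 = 2 then 2 else 1, 1), 5 \<mapsto> (r 5, 1)])) ;;
     put 1 1"

lemma exec_write_terminals:
  assumes "\<sigma> 5 = zt ts []" "0 \<notin> set ts" "\<sigma> 1 = zt out []" "6 * length ts + 15 \<le> T"
  shows "exec write_terminals \<sigma> T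
    (\<sigma>(1 := zt (out @ map bsym (enc_list (\<lambda>t. [t = 2]) ts)) []))"
proof -
  let ?w = "\<lambda>ts. concat (map (\<lambda>t. [2, if t = 2 then 2 else 1]) ts) :: nat list"
  have w: "?w ts @ [1] = map bsym (enc_list (\<lambda>t. [t = 2]) ts)"
    by (induction ts) (auto simp: enc_list_def)
  define S where "S = (\<lambda>ys zs. \<sigma>(1 := zt (out @ ?w ys) [], 5 := zt ys zs))"
  have 1: "exec (rewind 5) \<sigma> (2 * length ts + 6) (\<sigma>(5 := zt [] (ts @ [])))"
    by (rule exec_rewind) (use assms in auto)
  have 2: "exec (Loop (\<lambda>r. r 5 \<noteq> 0)
       (put 1 2 ;; Act (\<lambda>r. [1 \<mapsto> (if r 5 = 2 then 2 else 1, 1), 5 \<mapsto> (r 5, 1)])))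
     (\<sigma>(5 := zt [] (ts @ []))) (length ts * Suc 3 + 1) (S ts [])"
  proof (rule exec_foreach'[where S = S and xs = ts and B = 3])
    fix ys t zs assume xs: "ts = ys @ t # zs"
    then show "reads (S ys (t # zs)) 5 \<noteq> 0" using assms by (auto simp: S_def)
    have "exec (Act (\<lambda>r. [1 \<mapsto> (if r 5 = 2 then 2 else 1, 1), 5 \<mapsto> (r 5, 1)]))
       ((S ys (t # zs))(1 := zt (out @ ?w ys @ [2]) [])) 1 (S (ys @ [t]) zs)"
      by (rule exec_Act') (auto simp: S_def fun_eq_iff)
    then show "exec (put 1 2 ;; Act (\<lambda>r. [1 \<mapsto> (if r 5 = 2 then 2 else 1, 1), 5 \<mapsto> (r 5, 1)]))
       (S ys (t # zs)) 3 (S (ys @ [t]) zs)"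
      by (rule exec_Act_Seq[rotated]) (auto simp: S_def fun_eq_iff)
  qed (use assms in \<open>auto simp: S_def fun_eq_iff\<close>)
  have 3: "exec (put 1 1) (S ts []) 1
      (\<sigma>(1 := zt (out @ map bsym (enc_list (\<lambda>t. [t = 2]) ts)) []))"
    by (rule exec_Act') (use assms in \<open>auto simp: S_def fun_eq_iff w[symmetric]\<close>)
  show ?thesis unfolding write_terminals_def
    by (rule exec_Seq'[OF 1 exec_Seq[OF 2 3]]) (use assms(4) in simp)
qed

text \<open>Tape 9 holds the weights of pairs of original vertices only, row by row, so its head
  advances on such pairs and rests on all others. The five symbols written for a link spell the
  weight 0 as the fraction 0/1.\<close>

definition write_entry :: com where
  "write_entry = Cond (\<lambda>r. r 5 \<le> 2 \<and> r 6 \<le> 2)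
     (Loop (\<lambda>r. r 9 \<noteq> 3) (Act (\<lambda>r. [1 \<mapsto> (r 9, 1), 9 \<mapsto> (r 9, 1)])) ;; right 9)
     (Cond (\<lambda>r. linked (r 5) (r 6)) (put 1 2 ;; put 1 1 ;; put 1 2 ;; put 1 2 ;; put 1 1) (put 1 1))"

definition entry_value :: "(nat \<Rightarrow> nat \<Rightarrow> rat option) \<Rightarrow> (nat \<Rightarrow> nat) \<Rightarrow> nat \<Rightarrow> nat \<Rightarrow> rat option" where
  "entry_value w ty i j = (if ty i \<le> 2 \<and> ty j \<le> 2 then w i j
     else if linked (ty i) (ty j) then Some 0 else None)"

text \<open>The part of tape 9 that the pair consumes; it is empty as soon as a new vertex is
  involved.\<close>

definition source_entry :: "(nat \<Rightarrow> nat \<Rightarrow> rat option) \<Rightarrow> (nat \<Rightarrow> nat) \<Rightarrow> nat \<Rightarrow> nat \<Rightarrow> nat list" where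
  "source_entry w ty i j =
     (if ty i \<le> 2 \<and> ty j \<le> 2 then map bsym (enc_value (w i j)) @ [3] else [])"

lemma enc_value_zero: "enc_value (Some 0) = [True, False, True, True, False]"
  by (simp add: enc_value_def enc_nat_def enc_list_def)

lemma exec_write_entry:
  assumes "\<sigma> 5 = zt l5 (ty i # r5)" "\<sigma> 6 = zt l6 (ty j # r6)" "\<sigma> 1 = zt out []"
    "\<sigma> 9 = zt l9 (source_entry w ty i j @ r9)"
    "ty i \<le> 2 \<Longrightarrow> ty j \<le> 2 \<Longrightarrow> 2 * length (enc_value (w i j)) + 20 \<le> T" "20 \<le> T"
  shows "exec write_entry \<sigma> T
    (\<sigma>(1 := zt (out @ map bsym (enc_value (entry_value w ty i j))) [],
       9 := zt (l9 @ source_entry w ty i j) r9))"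
proof (cases "ty i \<le> 2 \<and> ty j \<le> 2")
  case True
  let ?e = "map bsym (enc_value (w i j))"
  have e: "source_entry w ty i j = ?e @ [3]" "entry_value w ty i j = w i j"
    using True by (auto simp: source_entry_def entry_value_def)
  define S where "S = (\<lambda>ys zs. \<sigma>(1 := zt (out @ ys) [], 9 := zt (l9 @ ys) (zs @ 3 # r9)))"
  have 1: "exec (Loop (\<lambda>r. r 9 \<noteq> 3) (Act (\<lambda>r. [1 \<mapsto> (r 9, 1), 9 \<mapsto> (r 9, 1)]))) \<sigma>
     (length ?e * Suc 1 + 1) (S ?e [])"
  proof (rule exec_foreach'[where S = S and xs = ?e and B = 1])
    fix ys a zs assume "?e = ys @ a # zs"
    then have "a \<in> set ?e" by (metis in_set_conv_decomp)
    then show "reads (S ys (a # zs)) 9 \<noteq> 3" by (auto simp: S_def)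
    show "exec (Act (\<lambda>r. [1 \<mapsto> (r 9, 1), 9 \<mapsto> (r 9, 1)])) (S ys (a # zs)) 1 (S (ys @ [a]) zs)"
      by (rule exec_Act') (auto simp: S_def fun_eq_iff)
  qed (use assms e in \<open>auto simp: S_def fun_eq_iff\<close>)
  have 2: "exec (right 9) (S ?e []) 1 (\<sigma>(1 := zt (out @ map bsym (enc_value (entry_value w ty i j))) [],
       9 := zt (l9 @ source_entry w ty i j) r9))"
    by (rule exec_Act') (auto simp: S_def fun_eq_iff e)
  show ?thesis unfolding write_entry_def
    by (rule exec_weaken[OF exec_Cond[where T = "2 * length (enc_value (w i j)) + 10"]])
      (use exec_weaken[OF exec_Seq[OF 1 2]] True assms in auto)
next
  case False
  then have e: "source_entry w ty i j = []" by (auto simp: source_entry_def)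
  have c: "exec (Cond (\<lambda>r. linked (r 5) (r 6)) (put 1 2 ;; put 1 1 ;; put 1 2 ;; put 1 2 ;; put 1 1) (put 1 1))
     \<sigma> (Suc 10) (\<sigma>(1 := zt (out @ map bsym (enc_value (entry_value w ty i j))) [],
       9 := zt (l9 @ source_entry w ty i j) r9))"
  proof (rule exec_Cond)
    let ?\<sigma>' = "\<lambda>xs. \<sigma>(1 := zt (out @ xs) [])"
    assume "linked (reads \<sigma> 5) (reads \<sigma> 6)"
    then have v: "entry_value w ty i j = Some 0"
      using False assms by (auto simp: entry_value_def)
    have p: "exec (put 1 s) (?\<sigma>' xs) 1 (?\<sigma>' (xs @ [s]))" for s xs
      by (rule exec_Act') simp
    have "exec (put 1 2 ;; put 1 1 ;; put 1 2 ;; put 1 2 ;; put 1 1) (?\<sigma>' [])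
      (Suc (1 + (Suc (1 + Suc (1 + Suc (1 + 1)))))) (?\<sigma>' ((((([] @ [2]) @ [1]) @ [2]) @ [2]) @ [1]))"
      by (intro exec_Seq[OF p] p)
    moreover have "?\<sigma>' [] = \<sigma>" using assms by auto
    moreover have "?\<sigma>' ((((([] @ [2]) @ [1]) @ [2]) @ [2]) @ [1]) =
      \<sigma>(1 := zt (out @ map bsym (enc_value (entry_value w ty i j))) [], 9 := zt (l9 @ source_entry w ty i j) r9)"
      using assms(4) e by (auto simp: v enc_value_zero fun_eq_iff)
    ultimately show "exec (put 1 2 ;; put 1 1 ;; put 1 2 ;; put 1 2 ;; put 1 1) \<sigma> 10
      (\<sigma>(1 := zt (out @ map bsym (enc_value (entry_value w ty i j))) [], 9 := zt (l9 @ source_entry w ty i j) r9))"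
      using exec_weaken[of _ \<sigma> "(Suc (1 + (Suc (1 + Suc (1 + Suc (1 + 1))))))" _ 10] by simp
  next
    assume "\<not> linked (reads \<sigma> 5) (reads \<sigma> 6)"
    then have v: "entry_value w ty i j = None"
      using False assms by (auto simp: entry_value_def)
    show "exec (put 1 1) \<sigma> 10
      (\<sigma>(1 := zt (out @ map bsym (enc_value (entry_value w ty i j))) [], 9 := zt (l9 @ source_entry w ty i j) r9))"
      by (rule exec_Act1) (use assms(3,4) e in \<open>auto simp: v enc_value_def fun_eq_iff\<close>)
  qed
  have "exec write_entry \<sigma> (Suc (Suc 10)) (\<sigma>(1 := zt (out @ map bsym (enc_value (entry_value w ty i j))) [],
       9 := zt (l9 @ source_entry w ty i j) r9))"
    unfolding write_entry_def
    by (rule exec_Cond, use False assms in force, rule c)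
  then show ?thesis by (rule exec_weaken) (use assms in simp)
qed

text \<open>Rows are followed on tape 5 and columns on tape 6, which is why the kinds are kept
  twice.\<close>

definition write_row :: com where
  "write_row = rewind 6 ;; Loop (\<lambda>r. r 6 \<noteq> 0) (put 1 2 ;; write_entry ;; right 6) ;; put 1 1"

lemma exec_write_row:
  assumes "\<sigma> 5 = zt l5 (ty i # r5)" "\<sigma> 6 = zt (map ty js) []" "\<sigma> 1 = zt out []"
    "\<sigma> 9 = zt l9 (concat (map (source_entry w ty i) js) @ r9)" "\<And>j. j \<in> set js \<Longrightarrow> ty j \<noteq> 0"
    "\<And>j. j \<in> set js \<Longrightarrow> ty i \<le> 2 \<Longrightarrow> ty j \<le> 2 \<Longrightarrow> length (enc_value (w i j)) \<le> L"
    "length js * (2 * L + 30) + 15 \<le> T"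
  shows "exec write_row \<sigma> T
    (\<sigma>(1 := zt (out @ map bsym (enc_list (\<lambda>j. enc_value (entry_value w ty i j)) js)) [],
       9 := zt (l9 @ concat (map (source_entry w ty i) js)) r9))"
proof -
  let ?f = "\<lambda>j. enc_value (entry_value w ty i j)" and ?g = "source_entry w ty i"
  let ?w = "\<lambda>js. map bsym (concat (map (\<lambda>j. True # ?f j) js))"
  define S where "S = (\<lambda>ys zs. \<sigma>(1 := zt (out @ ?w ys) [], 6 := zt (map ty ys) (map ty zs),
     9 := zt (l9 @ concat (map ?g ys)) (concat (map ?g zs) @ r9)))"
  have nz: "0 \<notin> set (map ty js)" using assms(5) by fastforce
  have 1: "exec (rewind 6) \<sigma> (2 * length js + 6) (\<sigma>(6 := zt [] (map ty js @ [])))"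
    by (rule exec_rewind) (use assms(2) nz in simp_all)
  have 2: "exec (Loop (\<lambda>r. r 6 \<noteq> 0) (put 1 2 ;; write_entry ;; right 6)) (\<sigma>(6 := zt [] (map ty js @ [])))
     (length js * Suc (2 * L + 25) + 1) (S js [])"
  proof (rule exec_foreach'[where S = S and xs = js and B = "2 * L + 25"])
    fix ys j zs assume xs: "js = ys @ j # zs"
    then show "reads (S ys (j # zs)) 6 \<noteq> 0" using assms(5) by (auto simp: S_def)
    let ?\<sigma>1 = "(S ys (j # zs))(1 := zt (out @ ?w ys @ [2]) [])"
    let ?\<sigma>2 = "?\<sigma>1(1 := zt ((out @ ?w ys @ [2]) @ map bsym (?f j)) [],
        9 := zt ((l9 @ concat (map ?g ys)) @ ?g j) (concat (map ?g zs) @ r9))"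
    have "exec write_entry ?\<sigma>1 (2 * L + 20) ?\<sigma>2"
      by (rule exec_write_entry) (use assms xs in \<open>auto simp: S_def\<close>)
    moreover have "exec (right 6) ?\<sigma>2 1 (S (ys @ [j]) zs)"
      by (rule exec_Act') (auto simp: S_def fun_eq_iff)
    ultimately have "exec (write_entry ;; right 6) ?\<sigma>1 (Suc (2 * L + 20 + 1)) (S (ys @ [j]) zs)"
      by (rule exec_Seq)
    then show "exec (put 1 2 ;; write_entry ;; right 6) (S ys (j # zs)) (2 * L + 25) (S (ys @ [j]) zs)"
      by (rule exec_Act_Seq[rotated]) (auto simp: S_def fun_eq_iff)
  qed (use assms in \<open>auto simp: S_def fun_eq_iff\<close>)
  have 3: "exec (put 1 1) (S js []) 1 (\<sigma>(1 := zt (out @ map bsym (enc_list ?f js)) [],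
       9 := zt (l9 @ concat (map ?g js)) r9))"
    by (rule exec_Act') (use assms in \<open>auto simp: S_def fun_eq_iff enc_list_def\<close>)
  show ?thesis unfolding write_row_def
    by (rule exec_Seq'[OF 1 exec_Seq[OF 2 3]]) (use assms(7) in \<open>simp add: algebra_simps\<close>)
qed

definition write_matrix :: com where
  "write_matrix = rewind 5 ;; rewind 9 ;;
     Loop (\<lambda>r. r 5 \<noteq> 0) (put 1 2 ;; write_row ;; right 5) ;; put 1 1"

lemma exec_write_matrix:
  assumes "\<sigma> 5 = zt l5 r5" "l5 @ r5 = map ty js" "\<sigma> 6 = zt (map ty js) []" "\<sigma> 1 = zt out []"
    "\<sigma> 9 = zt (concat (map (\<lambda>i. concat (map (source_entry w ty i) js)) js)) []"
    "\<And>j. j \<in> set js \<Longrightarrow> ty j \<noteq> 0"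
    "\<And>i j. i \<in> set js \<Longrightarrow> j \<in> set js \<Longrightarrow> ty i \<le> 2 \<Longrightarrow> ty j \<le> 2 \<Longrightarrow> length (enc_value (w i j)) \<le> L"
    "length js * (length js * (4 * L + 40) + 30) + 30 \<le> T"
  shows "exec write_matrix \<sigma> T
    (\<sigma>(1 := zt (out @ map bsym (enc_list (\<lambda>i. enc_list (\<lambda>j. enc_value (entry_value w ty i j)) js) js)) [],
       5 := zt (map ty js) []))"
proof -
  let ?n = "length js"
  let ?f = "\<lambda>i. enc_list (\<lambda>j. enc_value (entry_value w ty i j)) js"
  let ?g = "\<lambda>i. concat (map (source_entry w ty i) js)"
  let ?w = "\<lambda>is. map bsym (concat (map (\<lambda>i. True # ?f i) is))"
  let ?m = "concat (map ?g js)"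
  define S where "S = (\<lambda>ys zs. \<sigma>(1 := zt (out @ ?w ys) [], 5 := zt (map ty ys) (map ty zs),
     9 := zt (concat (map ?g ys)) (concat (map ?g zs))))"
  have nz: "0 \<notin> set (map ty js)" using assms(6) by fastforce
  \<comment> \<open>The length of tape 9 enters the time through its rewinding.\<close>
  have "length ?m \<le> ?n * (?n * (L + 1))"
  proof -
    have entry: "length (source_entry w ty i j) \<le> L + 1" if "i \<in> set js" "j \<in> set js" for i j
      using assms(7)[OF that] by (auto simp: source_entry_def)
    have row: "length (?g i) \<le> ?n * (L + 1)" if "i \<in> set js" for i
      using sum_list_mono[of js "\<lambda>j. length (source_entry w ty i j)" "\<lambda>_. L + 1"] entry[OF that]
      by (simp add: length_concat comp_def sum_list_triv)
    show ?thesis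
      using sum_list_mono[of js "\<lambda>i. length (?g i)" "\<lambda>_. ?n * (L + 1)"] row
      by (simp only: length_concat comp_def sum_list_triv map_map of_nat_id)
  qed
  note m = this
  have m0: "0 \<notin> set ?m" by (auto simp: source_entry_def split: if_splits)
  have "exec (rewind 5) \<sigma> (2 * length l5 + 6) (\<sigma>(5 := zt [] (l5 @ r5)))"
    by (rule exec_rewind) (use assms nz in \<open>auto simp flip: assms(2)\<close>)
  then have 1: "exec (rewind 5) \<sigma> (2 * ?n + 6) (\<sigma>(5 := zt [] (map ty js)))"
    unfolding assms(2)
    by (rule exec_weaken) (use arg_cong[OF assms(2), of length] in simp)
  have 2: "exec (rewind 9) (\<sigma>(5 := zt [] (map ty js))) (2 * (?n * (?n * (L + 1))) + 6)
      (\<sigma>(5 := zt [] (map ty js), 9 := zt [] (?m @ [])))"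
    by (rule exec_rewind) (use assms(5) m m0 in auto)
  have 3: "exec (Loop (\<lambda>r. r 5 \<noteq> 0) (put 1 2 ;; write_row ;; right 5))
     (\<sigma>(5 := zt [] (map ty js), 9 := zt [] (?m @ [])))
     (?n * Suc (?n * (2 * L + 30) + 20) + 1) (S js [])"
  proof (rule exec_foreach'[where S = S and xs = js and B = "?n * (2 * L + 30) + 20"])
    fix ys i zs assume xs: "js = ys @ i # zs"
    then show "reads (S ys (i # zs)) 5 \<noteq> 0" using assms(6) by (auto simp: S_def)
    let ?\<sigma>1 = "(S ys (i # zs))(1 := zt (out @ ?w ys @ [2]) [])"
    let ?\<sigma>2 = "?\<sigma>1(1 := zt ((out @ ?w ys @ [2]) @ map bsym (?f i)) [],
        9 := zt (concat (map ?g ys) @ ?g i) (concat (map ?g zs)))"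
    have "exec write_row ?\<sigma>1 (?n * (2 * L + 30) + 15) ?\<sigma>2"
      by (rule exec_write_row[where L = L]) (use assms(3,6,7) xs in \<open>auto simp: S_def\<close>)
    moreover have "exec (right 5) ?\<sigma>2 1 (S (ys @ [i]) zs)"
      by (rule exec_Act') (auto simp: S_def fun_eq_iff)
    ultimately have "exec (write_row ;; right 5) ?\<sigma>1 (Suc (?n * (2 * L + 30) + 15 + 1)) (S (ys @ [i]) zs)"
      by (rule exec_Seq)
    then show "exec (put 1 2 ;; write_row ;; right 5) (S ys (i # zs)) (?n * (2 * L + 30) + 20) (S (ys @ [i]) zs)"
      by (rule exec_Act_Seq[rotated]) (auto simp: S_def fun_eq_iff)
  qed (use assms in \<open>auto simp: S_def fun_eq_iff\<close>)
  have 4: "exec (put 1 1) (S js []) 1 (\<sigma>(1 := zt (out @ map bsym (enc_list ?f js)) [], 5 := zt (map ty js) []))"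
    by (rule exec_Act') (use assms in \<open>auto simp: S_def fun_eq_iff enc_list_def\<close>)
  show ?thesis unfolding write_matrix_def
    by (rule exec_Seq'[OF 1 exec_Seq[OF 2 exec_Seq[OF 3 4]]])
      (use assms(8) in \<open>simp add: algebra_simps\<close>)
qed

definition write_param :: com where
  "write_param = Loop (\<lambda>r. r 4 \<noteq> 0) (put 1 2 ;; Act (\<lambda>r. [1 \<mapsto> (r 4, 1), 4 \<mapsto> (r 4, 1)])) ;; put 1 1"

lemma exec_write_param:
  assumes "\<sigma> 4 = zt [] (map bsym (bits m))" "\<sigma> 1 = zt out []" "4 * m + 10 \<le> T"
  shows "exec write_param \<sigma> T
    (\<sigma>(1 := zt (out @ map bsym (enc_nat m)) [], 4 := zt (map bsym (bits m)) []))"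
proof -
  define S where "S = (\<lambda>ys zs. \<sigma>(1 := zt (out @ concat (map (\<lambda>b. [2, bsym b]) ys)) [],
    4 := zt (map bsym ys) (map bsym zs)))"
  have 1: "exec (Loop (\<lambda>r. r 4 \<noteq> 0) (put 1 2 ;; Act (\<lambda>r. [1 \<mapsto> (r 4, 1), 4 \<mapsto> (r 4, 1)]))) \<sigma>
    (length (bits m) * Suc 3 + 1) (S (bits m) [])"
  proof (rule exec_foreach'[where S = S and xs = "bits m" and B = 3])
    fix ys b zs
    show "reads (S ys (b # zs)) 4 \<noteq> 0" by (simp add: S_def)
    have "exec (Act (\<lambda>r. [1 \<mapsto> (r 4, 1), 4 \<mapsto> (r 4, 1)]))
      ((S ys (b # zs))(1 := zt (out @ concat (map (\<lambda>b. [2, bsym b]) ys) @ [2]) [])) 1 (S (ys @ [b]) zs)"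
      by (rule exec_Act') (auto simp: S_def fun_eq_iff)
    then show "exec (put 1 2 ;; Act (\<lambda>r. [1 \<mapsto> (r 4, 1), 4 \<mapsto> (r 4, 1)])) (S ys (b # zs)) 3 (S (ys @ [b]) zs)"
      by (rule exec_Act_Seq[rotated]) (auto simp: S_def fun_eq_iff)
  qed (use assms in \<open>auto simp: S_def fun_eq_iff\<close>)
  have 2: "exec (put 1 1) (S (bits m) []) 1
    (\<sigma>(1 := zt (out @ map bsym (enc_nat m)) [], 4 := zt (map bsym (bits m)) []))"
    by (rule exec_Act') (auto simp: S_def fun_eq_iff enc_nat_def enc_list_def map_concat comp_def)
  show ?thesis unfolding write_param_def
    by (rule exec_Seq'[OF 1 2]) (use assms(3) length_bits_le[of m] in simp)
qed

text \<open>
  The budget tape is only overwritten, never shortened, so it is blank exactly if \<open>\<zeta> = 0\<close>. In that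
  case the answer of the oracle is wrong (a single vertex is a tree) and is ignored.
\<close>

definition copy_answer :: com where
  "copy_answer = Cond (\<lambda>r. r 7 = 0) (put 2 1)
     (Loop (\<lambda>r. r 1 \<noteq> 0) (Act (\<lambda>r. [1 \<mapsto> (r 1, 1), 2 \<mapsto> (r 1, 1)])))"

lemma exec_copy_answer_fail:
  assumes "\<sigma> 7 = zt [] []" "\<sigma> 2 = zt [] []"
  shows "exec copy_answer \<sigma> 2 (\<sigma>(2 := zt (map bsym (enc_value None)) []))"
  unfolding copy_answer_def
  by (rule exec_weaken[OF exec_Cond[where T = 1]], rule exec_Act')
    (use assms in \<open>auto simp: enc_value_def\<close>)

lemma exec_copy_answer:
  assumes "\<sigma> 7 = zt [] (map bsym bs)" "bs \<noteq> []" "\<sigma> 1 = zt [] (map bsym y)" "\<sigma> 2 = zt [] []"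
    "2 * length y + 5 \<le> T"
  shows "exec copy_answer \<sigma> T (\<sigma>(1 := zt (map bsym y) [], 2 := zt (map bsym y) []))"
proof -
  define S where "S = (\<lambda>ys zs. \<sigma>(1 := zt (map bsym ys) (map bsym zs), 2 := zt (map bsym ys) []))"
  have "exec (Loop (\<lambda>r. r 1 \<noteq> 0) (Act (\<lambda>r. [1 \<mapsto> (r 1, 1), 2 \<mapsto> (r 1, 1)]))) \<sigma>
    (2 * length y + 4) (\<sigma>(1 := zt (map bsym y) [], 2 := zt (map bsym y) []))"
  proof (rule exec_foreach'[where S = S and xs = y and B = 1])
    fix ys b zs
    show "reads (S ys (b # zs)) 1 \<noteq> 0" by (simp add: S_def)
    show "exec (Act (\<lambda>r. [1 \<mapsto> (r 1, 1), 2 \<mapsto> (r 1, 1)])) (S ys (b # zs)) 1 (S (ys @ [b]) zs)"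
      by (rule exec_Act') (auto simp: S_def fun_eq_iff)
  qed (use assms in \<open>auto simp: S_def fun_eq_iff\<close>)
  then show ?thesis unfolding copy_answer_def
    by (intro exec_weaken[OF exec_Cond[where T = "2 * length y + 4"]]) 
     (use assms in \<open>auto simp: neq_Nil_conv\<close>)
qed

section \<open>The query program and its running time\<close>

definition parse :: com where
  "parse = measure_input ;; scan_bits {5, 6, 8} ;; copy_matrix ;; scan_bits {7} ;; rewind 7"

definition query_program :: com where
  "query_program = parse ;; allot 2 4 ;; allot 1 3 ;; write_terminals ;; write_matrix ;; write_param"

text \<open>The symbols 1 and 2 of the bits coincide with the kinds of non-terminals and terminals,
  so scanning the terminal bits already yields \<open>base_kinds\<close>. Tape 8 preserves this list
  while leaf kinds are appended on tapes 5 and 6.\<close>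

lemma exec_parse:
  fixes I
  defines "x \<equiv> enc_instance I" and "n \<equiv> num_vertices I"
  assumes T: "T \<ge> length x * (4 * length x + 20) + n * (n * (2 * length x + 16) + 10) + 6 * length x + 40"
  shows "\<exists>\<sigma>. exec parse (init_store x) T \<sigma> \<and>
    \<sigma> 1 = zt [] [] \<and> \<sigma> 2 = zt [] [] \<and> \<sigma> 3 = zt [] (replicate (length x) 1) \<and>
    \<sigma> 4 = zt [] (map bsym (bits (length x))) \<and>
    \<sigma> 5 = zt (base_kinds I) [] \<and> \<sigma> 6 = zt (base_kinds I) [] \<and> \<sigma> 8 = zt (base_kinds I) [] \<and>
    \<sigma> 7 = zt [] (map bsym (bits (param I))) \<and>
    \<sigma> 9 = zt (concat (map (\<lambda>i. concat (map (\<lambda>j.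
        map bsym (enc_value (matrix_entry I i j)) @ [3]) [0..<n])) [0..<n])) []"
proof -
  let ?e = "\<lambda>i j. enc_value (matrix_entry I i j)"
  let ?w1 = "map bsym (enc_list (\<lambda>i. [i \<in> terminals I]) [0..<n])"
  let ?w2 = "map bsym (enc_list (\<lambda>i. enc_list (?e i) [0..<n]) [0..<n])"
  let ?w3 = "map bsym (enc_list (\<lambda>b. [b]) (bits (param I)))"
  let ?m = "concat (map (\<lambda>i. concat (map (\<lambda>j. map bsym (?e i j) @ [3]) [0..<n])) [0..<n])"
  have x: "map bsym x = ?w1 @ ?w2 @ ?w3"
    by (simp add: x_def n_def enc_instance_def enc_nat_def)
  have blank: "tape_of [] = zt [] []" by (simp add: tape_of_zt)
  let ?\<sigma>0 = "init_store x"
  define \<sigma>1 where "\<sigma>1 = ?\<sigma>0(3 := zt [] (replicate (length x) 1), 4 := zt [] (map bsym (bits (length x))))"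
  have 1: "exec measure_input ?\<sigma>0 (length x * (4 * length x + 20) + 20) \<sigma>1"
    unfolding \<sigma>1_def by (rule exec_measure_input) (auto simp: init_store_def tape_of_zt)
  have base: "map (\<lambda>i. bsym (i \<in> terminals I)) [0..<n] = base_kinds I"
    by (simp add: base_kinds_def n_def bsym_def)
  define \<sigma>2 where "\<sigma>2 = (\<lambda>j. if j = 0 then zt ([] @ ?w1) (?w2 @ ?w3)
    else if j \<in> {5, 6, 8} then zt ([] @ base_kinds I) [] else \<sigma>1 j)"
  have 2: "exec (scan_bits {5, 6, 8}) \<sigma>1 (length [0..<n] * 4 + 3) \<sigma>2"
    unfolding \<sigma>2_def
    by (rule transfersD[OF transfers_scan_bits[of "{5, 6, 8}" "[0..<n]" "\<lambda>i. i \<in> terminals I", unfolded base]])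
      (auto simp: \<sigma>1_def init_store_def blank tape_of_zt[of x] x)
  define \<sigma>3 where "\<sigma>3 = (\<lambda>j. if j = 0 then zt (([] @ ?w1) @ ?w2) ?w3
    else if j \<in> {9} then zt ([] @ ?m) [] else \<sigma>2 j)"
  have 3: "exec copy_matrix \<sigma>2 (length [0..<n] * (length [0..<n] * (2 * length x + 16) + 6) + 3) \<sigma>3"
    unfolding \<sigma>3_def
    by (rule transfersD[OF transfers_copy_matrix])
      (auto simp: \<sigma>2_def \<sigma>1_def init_store_def blank x_def n_def length_enc_instance(4))
  define \<sigma>4 where "\<sigma>4 = (\<lambda>j. if j = 0 then zt ((([] @ ?w1) @ ?w2) @ ?w3) []
    else if j \<in> {7} then zt ([] @ map bsym (bits (param I))) [] else \<sigma>3 j)"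
  have 4: "exec (scan_bits {7}) \<sigma>3 (length (bits (param I)) * 4 + 3) \<sigma>4"
    unfolding \<sigma>4_def
    by (rule transfersD[OF transfers_scan_bits[of "{7}" "bits (param I)" "\<lambda>b. b"]])
      (auto simp: \<sigma>3_def \<sigma>2_def \<sigma>1_def init_store_def blank)
  have 5: "exec (rewind 7) \<sigma>4 (2 * length (bits (param I)) + 6) (\<sigma>4(7 := zt [] (map bsym (bits (param I)) @ [])))"
    by (rule exec_rewind) (auto simp: \<sigma>4_def)
  have "exec parse ?\<sigma>0 T (\<sigma>4(7 := zt [] (map bsym (bits (param I)) @ [])))"
    unfolding parse_def
  proof (rule exec_Seq'[OF 1 exec_Seq[OF 2 exec_Seq[OF 3 exec_Seq[OF 4 5]]]])
    have "length (bits (param I)) \<le> length x" by (simp add: x_def length_enc_instance(3))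
    then show "Suc (length x * (4 * length x + 20) + 20 +
     Suc (length [0..<n] * 4 + 3 +
       Suc (length [0..<n] * (length [0..<n] * (2 * length x + 16) + 6) + 3 +
         Suc (length (bits (param I)) * 4 + 3 + (2 * length (bits (param I)) + 6))))) \<le> T"
      using T by (simp add: algebra_simps)
  qed
  then show ?thesis
    by (intro exI conjI, assumption) (simp_all add: \<sigma>4_def \<sigma>3_def \<sigma>2_def \<sigma>1_def init_store_def blank)
qed

lemma enc_list_map: "enc_list f (map g xs) = enc_list (f \<circ> g) xs"
  by (simp add: enc_list_def comp_def)

lemma enc_list_cong: "(\<And>x. x \<in> set xs \<Longrightarrow> f x = g x) \<Longrightarrow> enc_list f xs = enc_list g xs"
  by (simp add: enc_list_def cong: map_cong)

context reduction
begin

lemma kind_nonzero: "i < N \<Longrightarrow> kind i \<noteq> 0"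
  using kind_simps[of i] by (cases "i < n") (auto split: if_splits)

lemma kind_le_2: "i < N \<Longrightarrow> kind i \<le> 2 \<longleftrightarrow> i < n"
  using kind_simps[of i] by (cases "i < n") (auto split: if_splits)

lemma kind_eq_2: "i < N \<Longrightarrow> kind i = 2 \<longleftrightarrow> i \<in> T"
  using kind_simps[of i] T_subset by (cases "i < n") (auto split: if_splits)

lemma matrix_entry_J:
  assumes "i < N" "j < N"
  shows "matrix_entry J i j = entry_value (matrix_entry I) (\<lambda>i. kind i) i j"
proof (cases "i < n \<and> j < n")
  case True
  then show ?thesis using assms by (simp add: entry_value_def kind_le_2 matrix_entry_def weight_old)
next
  case False
  \<comment> \<open>An unordered pair may be presented in either order, which the symmetry of
    \<open>linked\<close> absorbs. No kind is linked to itself, so the diagonal stays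
    absent.\<close>
  have "(\<exists>i' j'. {i, j} = {i', j'} \<and> i' < N \<and> j' < N \<and> linked (kind i') (kind j')) \<longleftrightarrow>
      linked (kind i) (kind j)"
    using assms by (auto simp: doubleton_eq_iff linked_def)
  then show ?thesis using False assms
    by (auto simp: entry_value_def kind_le_2 matrix_entry_def reduced_def linked_def)
qed

lemma enc_instance_J:
  "enc_instance J = enc_list (\<lambda>t. [t = 2]) (kinds I D) @
     enc_list (\<lambda>i. enc_list (\<lambda>j. enc_value (entry_value (matrix_entry I) (\<lambda>i. kind i) i j)) [0..<N]) [0..<N] @
     enc_nat D"
proof -
  have "enc_list (\<lambda>t. [t = 2]) (kinds I D) = enc_list (\<lambda>t. [t = 2]) (map (\<lambda>i. kind i) [0..<N])"
    by (simp add: map_nth)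
  also have "\<dots> = enc_list (\<lambda>i. [i \<in> T]) [0..<N]"
    unfolding enc_list_map by (rule enc_list_cong) (simp add: kind_eq_2)
  finally have t: "enc_list (\<lambda>t. [t = 2]) (kinds I D) = enc_list (\<lambda>i. [i \<in> T]) [0..<N]" .
  have m: "enc_list (\<lambda>i. enc_list (\<lambda>j. enc_value (matrix_entry J i j)) [0..<N]) [0..<N] =
      enc_list (\<lambda>i. enc_list (\<lambda>j. enc_value (entry_value (matrix_entry I) (\<lambda>i. kind i) i j)) [0..<N]) [0..<N]"
    by (intro enc_list_cong) (simp add: matrix_entry_J)
  show ?thesis by (simp add: enc_instance_def t m)
qed

lemma count_base_kinds: "count_list (base_kinds I) 2 = card T" "count_list (base_kinds I) 1 = n - card T"
proof -
  have "count_list (map f xs) a = length (filter (\<lambda>i. f i = a) xs)" for f :: "nat \<Rightarrow> nat" and xs a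
    by (induction xs) auto
  note c = this[of "\<lambda>i. if i \<in> T then 2 else 1" "[0..<n]"]
  have filter: "length (filter P [0..<n]) = card {i. i < n \<and> P i}" for P
    using distinct_card[of "filter P [0..<n]"] by simp
  have "count_list (base_kinds I) 2 = card {i. i < n \<and> i \<in> T}"
    unfolding base_kinds_def c filter by (rule arg_cong[where f = card]) auto
  also have "{i. i < n \<and> i \<in> T} = T" using T_subset by auto
  finally show "count_list (base_kinds I) 2 = card T" .
  have "count_list (base_kinds I) 1 = card {i. i < n \<and> i \<notin> T}"
    unfolding base_kinds_def c filter by (rule arg_cong[where f = card]) auto
  also have "{i. i < n \<and> i \<notin> T} = {..<n} - T" by auto
  also have "card \<dots> = n - card T" using T_subset finite_T by (simp add: card_Diff_subset)
  finally show "count_list (base_kinds I) 1 = n - card T" .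
qed

text \<open>Here the cap in \<open>budget\<close> pays off: at most n groups of D leaves are added,
  however large \<zeta> is.\<close>

lemma N_le: "N \<le> n + n * D"
proof -
  have "card T + budget I \<le> n" using card_T by (simp add: budget_def)
  then have "(card T + budget I) * D \<le> n * D" by simp
  then show ?thesis by (simp add: kinds_def base_kinds_def algebra_simps)
qed

end

text \<open>The type is polymorphic so that one expression serves both as a bound on natural numbers
  and, applied to the indeterminate, as the required polynomial. It replaces n by l and the number
  of vertices of the query by l + l * l.\<close>

definition query_time :: "'a :: comm_semiring_1 \<Rightarrow> 'a" where
  "query_time l =
     l * (4 * l + 20) + l * (l * (2 * l + 16) + 10) + 6 * l + 40 + 2 * (l * (12 * l + 50) + 10) +
     (6 * (l + l * l) + 15) + ((l + l * l) * ((l + l * l) * (4 * l + 40) + 30) + 30) + 4 * l + 20"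

context reduction
begin

text \<open>The final counter is described by its width only: this decides whether tape 7 is blank,
  that is, whether \<zeta> = 0.\<close>

lemma exec_query_program:
  assumes D: "D = length (enc_instance I)"
  shows "\<exists>\<sigma> bs. exec query_program (init_store (enc_instance I)) (query_time D) \<sigma> \<and>
    \<sigma> 1 = zt (map bsym (enc_instance J)) [] \<and> \<sigma> 2 = zt [] [] \<and> \<sigma> 7 = zt [] (map bsym bs) \<and>
    length bs = length (bits (param I))"
proof -
  let ?bs = "bits (param I)"
  let ?x = "enc_instance I"
  let ?T0 = "D * (4 * D + 20) + n * (n * (2 * D + 16) + 10) + 6 * D + 40"
  obtain \<sigma> where ex: "exec parse (init_store ?x) ?T0 \<sigma>"
    and \<sigma>: "\<sigma> 1 = zt [] []" "\<sigma> 2 = zt [] []" "\<sigma> 3 = zt [] (replicate D 1)"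
      "\<sigma> 4 = zt [] (map bsym (bits D))" "\<sigma> 5 = zt (base_kinds I) []" "\<sigma> 6 = zt (base_kinds I) []"
      "\<sigma> 8 = zt (base_kinds I) []" "\<sigma> 7 = zt [] (map bsym ?bs)"
      "\<sigma> 9 = zt (concat (map (\<lambda>i. concat (map (\<lambda>j.
        map bsym (enc_value (matrix_entry I i j)) @ [3]) [0..<n])) [0..<n])) []"
    using exec_parse[of I ?T0] unfolding D by auto
  have nz: "0 \<notin> set (base_kinds I)" by (auto simp: base_kinds_def)
  have len: "length (base_kinds I) = n" by (simp add: base_kinds_def)
  have lb: "length ?bs \<le> D" by (simp add: D length_enc_instance(3))
  have nD: "n \<le> D" by (simp add: D length_enc_instance(2))
  let ?B = "n * (8 * length ?bs + 4 * D + 50) + 10"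
  define R where "R = base_kinds I @ replicate (card T * D) 4"
  define \<sigma>1 where "\<sigma>1 = \<sigma>(5 := zt R [], 6 := zt R [], 7 := zt [] (map bsym ((pred_bits ^^ card T) ?bs)))"
  have "exec (allot 2 4) \<sigma> ?B
    (\<sigma>(5 := zt (base_kinds I @ replicate (min (count_list (base_kinds I) 2) (bval ?bs) * D) 4) [],
       6 := zt (base_kinds I @ replicate (min (count_list (base_kinds I) 2) (bval ?bs) * D) 4) [],
       7 := zt [] (map bsym ((pred_bits ^^ count_list (base_kinds I) 2) ?bs))))"
    by (rule exec_allot) (use \<sigma> nz len in auto)
  then have 1: "exec (allot 2 4) \<sigma> ?B \<sigma>1"
    using card_T by (simp add: count_base_kinds \<sigma>1_def R_def)
  define bs where "bs = (pred_bits ^^ (n - card T)) ((pred_bits ^^ card T) ?bs)"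
  define \<sigma>2 where "\<sigma>2 = \<sigma>1(5 := zt (kinds I D) [], 6 := zt (kinds I D) [], 7 := zt [] (map bsym bs))"
  let ?bs1 = "(pred_bits ^^ card T) ?bs"
  have "exec (allot 1 3) \<sigma>1 ?B
    (\<sigma>1(5 := zt (R @ replicate (min (count_list (base_kinds I) 1) (bval ?bs1) * D) 3) [],
       6 := zt (R @ replicate (min (count_list (base_kinds I) 1) (bval ?bs1) * D) 3) [],
       7 := zt [] (map bsym ((pred_bits ^^ count_list (base_kinds I) 1) ?bs1))))"
    by (rule exec_allot) (use \<sigma> nz len in \<open>auto simp: \<sigma>1_def\<close>)
  then have 2: "exec (allot 1 3) \<sigma>1 ?B \<sigma>2"
    by (simp only: count_base_kinds \<sigma>2_def R_def bs_def bval_funpow_pred_bits bval_bits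
        kinds_def budget_def append_assoc)
  let ?t = "enc_list (\<lambda>t. [t = 2]) (kinds I D)"
  have knz: "0 \<notin> set (kinds I D)" using nz by (auto simp: kinds_def)
  define \<sigma>3 where "\<sigma>3 = \<sigma>2(1 := zt (map bsym ?t) [])"
  have "exec write_terminals \<sigma>2 (6 * N + 15) (\<sigma>2(1 := zt ([] @ map bsym ?t) []))"
    by (rule exec_write_terminals) (use knz \<sigma> in \<open>auto simp: \<sigma>2_def \<sigma>1_def\<close>)
  then have 3: "exec write_terminals \<sigma>2 (6 * N + 15) \<sigma>3" by (simp add: \<sigma>3_def)
  let ?m = "enc_list (\<lambda>i. enc_list (\<lambda>j. enc_value (entry_value (matrix_entry I) (\<lambda>i. kind i) i j)) [0..<N]) [0..<N]"
  let ?src = "source_entry (matrix_entry I) (\<lambda>i. kind i)"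
  have ks: "map (\<lambda>i. kind i) [0..<N] = kinds I D" by (rule map_nth)
  \<comment> \<open>Pairs with a new vertex consume nothing, so the word expected by
    \<open>write_matrix\<close> for all vertices of the query is the one that \<open>parse\<close>
    has left for the original vertices.\<close>
  have split: "[0..<N] = [0..<n] @ [n..<N]" using upt_add_eq_append[of 0 n "N - n"] n_le_N by simp
  have split_concat: "concat (map g [0..<N]) = concat (map g [0..<n]) @ concat (map g [n..<N])"
    for g :: "nat \<Rightarrow> nat list"
    by (simp only: split map_append concat_append)
  have src0: "?src i j = []" if "i < N" "j < N" "i \<ge> n \<or> j \<ge> n" for i j
    using that by (auto simp: source_entry_def kind_le_2)
  have row: "concat (map (?src i) [0..<N]) = concat (map (\<lambda>j. map bsym (enc_value (matrix_entry I i j)) @ [3]) [0..<n])"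
    if "i < n" for i
  proof -
    have iN: "i < N" using that n_le_N by simp
    have "concat (map (?src i) [n..<N]) = []" using src0[OF iN] by auto
    moreover have "map (?src i) [0..<n] = map (\<lambda>j. map bsym (enc_value (matrix_entry I i j)) @ [3]) [0..<n]"
      using that n_le_N iN by (intro map_cong) (auto simp: source_entry_def kind_le_2)
    ultimately show ?thesis unfolding split_concat[of "?src i"] by (simp only: append_Nil2)
  qed
  have "concat (map (\<lambda>i. concat (map (?src i) [0..<N])) [n..<N]) = []" using src0 by auto
  moreover have "map (\<lambda>i. concat (map (?src i) [0..<N])) [0..<n] = map (\<lambda>i. concat (map (\<lambda>j.
      map bsym (enc_value (matrix_entry I i j)) @ [3]) [0..<n])) [0..<n]"
    by (intro map_cong) (auto simp: row)
  ultimately have src: "concat (map (\<lambda>i. concat (map (?src i) [0..<N])) [0..<N]) = concat (map (\<lambda>i. concat (map (\<lambda>j.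
      map bsym (enc_value (matrix_entry I i j)) @ [3]) [0..<n])) [0..<n])"
    unfolding split_concat[of "\<lambda>i. concat (map (?src i) [0..<N])"] by (simp only: append_Nil2)
  define \<sigma>4 where "\<sigma>4 = \<sigma>3(1 := zt (map bsym ?t @ map bsym ?m) [], 5 := zt (kinds I D) [])"
  have 4: "exec write_matrix \<sigma>3 (N * (N * (4 * D + 40) + 30) + 30) \<sigma>4"
  proof -
    have "exec write_matrix \<sigma>3 (N * (N * (4 * D + 40) + 30) + 30)
      (\<sigma>3(1 := zt (map bsym ?t @ map bsym ?m) [], 5 := zt (map (\<lambda>i. kind i) [0..<N]) []))"
    proof (rule exec_write_matrix[of \<sigma>3 "kinds I D" "[]" _ _ _ _ D])
      show "\<sigma>3 9 = zt (concat (map (\<lambda>i. concat (map (?src i) [0..<N])) [0..<N])) []"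
        unfolding src by (simp add: \<sigma>3_def \<sigma>2_def \<sigma>1_def \<sigma>)
      show "length (enc_value (matrix_entry I i j)) \<le> D"
        if "i \<in> set [0..<N]" "j \<in> set [0..<N]" "kind i \<le> 2" "kind j \<le> 2" for i j
        using that kind_le_2[of i] kind_le_2[of j] length_enc_instance(4)[of i I j]
        by (simp flip: D)
      show "kind j \<noteq> 0" if "j \<in> set [0..<N]" for j using that kind_nonzero by simp
    qed (simp_all add: \<sigma>3_def \<sigma>2_def \<sigma>1_def ks)
    then show ?thesis by (simp only: \<sigma>4_def ks)
  qed
  have 5: "exec write_param \<sigma>4 (4 * D + 10) (\<sigma>4(1 := zt ((map bsym ?t @ map bsym ?m) @ map bsym (enc_nat D)) [],
     4 := zt (map bsym (bits D)) []))" (is "exec _ _ _ ?\<sigma>5")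
    by (rule exec_write_param) (auto simp: \<sigma>4_def \<sigma>3_def \<sigma>2_def \<sigma>1_def \<sigma>)
  have "exec query_program (init_store ?x) (query_time D) ?\<sigma>5"
    unfolding query_program_def
  proof (rule exec_Seq'[OF ex exec_Seq[OF 1 exec_Seq[OF 2 exec_Seq[OF 3 exec_Seq[OF 4 5]]]]])
    have NQ: "N \<le> D + D * D" using N_le mult_le_mono1[OF nD, of D] nD by linarith
    have b0: "n * (n * (2 * D + 16) + 10) \<le> D * (D * (2 * D + 16) + 10)"
      by (intro mult_le_mono add_le_mono nD order_refl)
    have b1: "?B \<le> D * (12 * D + 50) + 10"
      by (intro mult_le_mono add_le_mono nD order_refl) (use lb in simp)
    have b2: "N * (N * (4 * D + 40) + 30) + 30 \<le> (D + D * D) * ((D + D * D) * (4 * D + 40) + 30) + 30"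
      by (intro mult_le_mono add_le_mono NQ order_refl)
    \<comment> \<open>Naming the non-linear terms turns the time comparison into linear
      arithmetic.\<close>
    have sum_le: "Suc (q + a + 6 * D + 40 + Suc (b + Suc (b + Suc (d + Suc (c + (4 * D + 10))))))
        \<le> q + a' + 6 * D + 40 + 2 * b' + d' + c' + 4 * D + 20"
      if "a \<le> a'" "b \<le> b'" "c \<le> c'" "d \<le> d'" for q a a' b b' c c' d d' :: nat
      using that by linarith
    have b3: "6 * N + 15 \<le> 6 * (D + D * D) + 15" using NQ by simp
    show "Suc (?T0 + Suc (?B + Suc (?B + Suc (6 * N + 15 + Suc (N * (N * (4 * D + 40) + 30) + 30 + (4 * D + 10))))))
      \<le> query_time D"
      unfolding query_time_def by (rule sum_le[OF b0 b1 b2 b3])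
  qed
  moreover have "?\<sigma>5 1 = zt (map bsym (enc_instance J)) []" "?\<sigma>5 2 = zt [] []" "?\<sigma>5 7 = zt [] (map bsym bs)"
    "length bs = length ?bs"
    by (simp_all add: enc_instance_J \<sigma>4_def \<sigma>3_def \<sigma>2_def \<sigma>1_def \<sigma> bs_def)
  ultimately show ?thesis by blast
qed

end

section \<open>The oracle machine for SCST\<close>

lemma wf_query_program: "wf_com query_program"
  by (auto simp: query_program_def parse_def measure_input_def increment_def rewind_def scan_bits_def
      copy_matrix_def copy_value_def copy_nat_def emit_def emit_separator_def allot_def spend_def fill_def
      write_terminals_def write_matrix_def write_row_def write_entry_def write_param_def
      split: if_splits)

lemma wf_copy_answer: "wf_com copy_answer"
  by (auto simp: copy_answer_def split: if_splits)

theorem theorem6: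
  shows "poly_time_turing_reducible SCST MCST"
proof -
  obtain M where M: "wf_tm M" and run: "\<And>f x T1 \<sigma>1 T2 \<sigma>2 t. exec query_program (init_store x) T1 \<sigma>1 \<Longrightarrow>
       exec copy_answer (\<sigma>1(1 := tape_of (f (string_on (\<sigma>1 1))))) T2 \<sigma>2 \<Longrightarrow> T1 + T2 + 1 \<le> t \<Longrightarrow>
       computes_within M f x t (string_on (\<sigma>2 2))"
    using compile[OF wf_query_program wf_copy_answer] by blast
  let ?X = "[:0, 1:] :: nat poly"
  \<comment> \<open>The time for the query program, for copying the longest possible answer, and for
    the query step itself.\<close>
  define p where "p = query_time ?X + (2 * (4 * ((1 + ?X) * (?X * ?X)) + 7) + 5) + 1"
  have p: "poly p l = query_time l + (2 * (4 * (Suc l * (l * l)) + 7) + 5) + 1" for l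
    unfolding p_def query_time_def by (simp add: algebra_simps)
  have "\<exists>y. (x, y) \<in> SCST \<and> computes_within M f x (poly p (length x)) y"
    if f: "solves f MCST" and x: "x \<in> Domain SCST" for f x
  proof -
    obtain I where I: "scst_instance I" "x = enc_instance I" using x by (auto simp: SCST_def)
    then have y: "(x, enc_value (scst I)) \<in> SCST" by (auto simp: SCST_def)
    let ?l = "length x"
    \<comment> \<open>The input length is an admissible D because the budget is at most n.\<close>
    interpret reduction I ?l
    proof
      have "num_vertices I * Suc (budget I) \<le> num_vertices I * (num_vertices I + 1)"
        by (intro mult_le_mono) (simp_all add: budget_def)
      also have "\<dots> < ?l" using length_enc_instance(1) I(2) by simp
      finally show "num_vertices I * Suc (budget I) < ?l" .
    qed (rule I(1))
    obtain \<sigma> bs where q: "exec query_program (init_store x) (query_time ?l) \<sigma>"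
      and \<sigma>: "\<sigma> 1 = zt (map bsym (enc_instance (reduced I ?l))) []" "\<sigma> 2 = zt [] []"
        "\<sigma> 7 = zt [] (map bsym bs)" "length bs = length (bits (param I))"
      using exec_query_program I(2) by auto
    let ?a = "f (enc_instance (reduced I ?l))"
    have \<sigma>1: "\<sigma>(1 := tape_of (f (string_on (\<sigma> 1)))) = \<sigma>(1 := zt [] (map bsym ?a))"
      by (simp only: \<sigma>(1) string_on_zt tape_of_zt)
    have len: "length (enc_value (scst I)) \<le> 4 * (Suc ?l * (?l * ?l)) + 7"
      using length_scst[of I] I by (simp add: scst_instance_def)
    have "computes_within M f x (poly p ?l) (enc_value (scst I))"
    proof (cases "param I = 0")
      case True
      then have "bs = []" using \<sigma>(4) by simp
      have "exec copy_answer (\<sigma>(1 := zt [] (map bsym ?a))) 2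
          (\<sigma>(1 := zt [] (map bsym ?a), 2 := zt (map bsym (enc_value None)) []))"
        by (rule exec_copy_answer_fail) (use \<sigma> \<open>bs = []\<close> in auto)
      from run[OF q, where f = f, unfolded \<sigma>1, OF this]
      have "computes_within M f x (poly p ?l) (enc_value None)"
        by (simp add: string_on_zt p)
      moreover have "scst I = None"
      proof -
        have "\<not> card V \<le> param I" if "(V, E) \<in> steiner_subtrees I" for V E
          using that True by (auto simp: steiner_subtrees_def is_tree_def)
        then show ?thesis by (auto simp: scst_def min_weight_def)
      qed
      ultimately show ?thesis by simp
    next
      case False
      \<comment> \<open>The oracle is only known to give some correct answer to the string;
        single-valuedness identifies it with the optimum of this particular instance.\<close>
      have "(enc_instance J, ?a) \<in> MCST"
        using f mcst_instance_J unfolding solves_def by (auto simp: MCST_def)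
      moreover have "(enc_instance J, enc_value (mcst J)) \<in> MCST"
        using mcst_instance_J by (auto simp: MCST_def)
      ultimately have "?a = enc_value (mcst J)"
        using single_valued_MCST by (auto dest: single_valuedD)
      then have a: "?a = enc_value (scst I)" using mcst_reduced False by simp
      have "bits (param I) \<noteq> []" using False by (subst bits.simps) simp
      then have "bs \<noteq> []" using \<sigma>(4) by auto
      have "exec copy_answer (\<sigma>(1 := zt [] (map bsym ?a))) (2 * length ?a + 5)
          (\<sigma>(1 := zt [] (map bsym ?a), 1 := zt (map bsym ?a) [], 2 := zt (map bsym ?a) []))"
        by (rule exec_copy_answer) (use \<sigma> \<open>bs \<noteq> []\<close> in auto)
      from run[OF q, where f = f, unfolded \<sigma>1, OF this, of "poly p ?l"]
      show ?thesis using len unfolding p by (simp add: string_on_zt a)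
    qed
    then show ?thesis using y by blast
  qed
  then show ?thesis unfolding poly_time_turing_reducible_def using M by blast
qed

end
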